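(* The exact distribution of $R_{n}^{(k)}$ is characterized by the following probability mass function, for $0 \le m \le k \le n$ and $n \ge 1$ (and equal to $0$ otherwise): $$\mathbb{P}(R_{n}^{(k)} = m) = \begin{cases} 1-\frac{k}{n}, & \text{for } m=0,\\[1ex] \frac{m^{m} (n-k) (n-m)^{k-m-1}}{n^{k}} \binom{k}{m}, & \text{for } 1 \le m \le k < n,\\[1ex] 1, & \text{for } m=k=n. \end{cases}$$ Depending on the growth of $k=k(n)$, the following limiting behavior holds as $n\to\infty$: (1) If $k = o(n)$, then $R_{n}^{(k)} \xrightarrow{p} 0$. (2) If $k \sim \alpha n$ with $0 < \alpha < 1$, then $R_{n}^{(k)} \xrightarrow{d} R_{\alpha}$, where the discrete random variable $R_{\alpha}$ is characterized by its probability mass function $$\mathbb{P}(R_{\alpha} = m) = p_{m} = \begin{cases} 1-\alpha, & m = 0,\\ \frac{m^{m}}{m!} (1-\alpha) \alpha^{m} e^{-\alpha m}, & m \ge 1, \end{cases}$$ or alternatively by the probability generating function $p(v) = \sum_{m \ge 0} p_{m} v^{m} = \frac{1-\alpha}{1-T^{\bullet}(v \alpha e^{-\alpha})}$. (3) If $k=n-d$ with $d=\omega(\sqrt{n})$ and $d=o(n)$, then $\big(\frac{d}{n}\big)^{2} R_{n}^{(k)} \xrightarrow{d} \mathrm{Gamma}(\frac12,\frac12)$, the Gamma distribution characterized by its density $f(x) = \frac{1}{\sqrt{2 \pi x}} \, e^{-\frac{x}{2}}$, for $x > 0$. (4) If $k=n-d$ with $d \sim c \sqrt{n}$ and $c >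 0$, then $\frac{1}{n} R_{n}^{(k)} \xrightarrow{d} R(c)$, where the continuous random variable $R(c)$ is characterized by its density $$f_{c}(x) = \frac{1}{\sqrt{2 \pi}} \frac{c}{\sqrt{x} (1-x)^{\frac{3}{2}}} \, e^{-\frac{c^{2} x}{2(1-x)}}, \quad 0 < x < 1.$$ (5) If $k=n-d$ with $d=\omega(1)$ and $d = o(\sqrt{n})$, then $\frac{1}{d^{2}} \big(n - R_{n}^{(k)}\big) \xrightarrow{d} D$, where the continuous random variable $D$ is characterized by its density $f(x) = \frac{1}{\sqrt{2 \pi} \, x^{3/2}} \, e^{-\frac{1}{2x}}$, $x > 0$. (6) If $k=n-d$ with $d$ a fixed positive integer, then $n - d - R_{n}^{(k)} \xrightarrow{d} D(d)$, where the discrete random variable $D(d)$ is characterized by the probability mass function $$\mathbb{P}(D(d) = j) = p_{j} = e^{-d} \cdot \frac{d (d+j)^{j-1}}{j!} \cdot e^{-j}, \quad j \ge 0,$$ or alternatively via the probability generating function $p(v) = \sum_{j \ge 0} p_{j} v^{j} = e^{d (T^{\bullet}(\frac{v}{e})-1)}$.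
   Context: A rooted labeled tree of size $n$ is a tree with vertex set $[n]=\{1,\dots,n\}$ together with a distinguished root vertex; there are $n^{n-1}$ of them. For $0\le k\le n$, after uncovering $k$ vertices (those with labels in $[k]$), the root cluster is the connected component containing the root in the subgraph induced by the uncovered vertices; its size is taken to be $0$ if the root is not uncovered. $R_n^{(k)}$ denotes the size of the root cluster of a uniformly random rooted labeled tree of size $n$ with $k$ uncovered vertices. $T^{\bullet}(z)=\sum_{n\ge1}\frac{n^{n-1}}{n!}z^n$ is the Cayley tree function (exponential generating function of rooted labeled trees), satisfying $T^\bullet(z)=z e^{T^\bullet(z)}$. $\xrightarrow{p}$ and $\xrightarrow{d}$ denote convergence in probability and in distribution; $d=\omega(g)$ means $d/g\to\infty$; $a_n\sim b_n$ means $a_n/b_n\to1$. *)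

theory Defs
  imports "HOL-Probability.Probability" "HOL-Library.Landau_Symbols"
begin

section \<open>Rooted labeled trees\<close>

text \<open>A finite simple graph is given by a vertex set and a set of two-element edge sets.\<close>

definition adj :: "nat set set \<Rightarrow> (nat \<times> nat) set" where
  "adj E = {(u, v). {u, v} \<in> E}"

definition is_cycle :: "nat set set \<Rightarrow> nat list \<Rightarrow> bool" where
  "is_cycle E c \<longleftrightarrow> length c \<ge> 3 \<and> distinct c \<and>
     (\<forall>i<length c. {c ! i, c ! ((i + 1) mod length c)} \<in> E)"

definition is_tree :: "nat set \<Rightarrow> nat set set \<Rightarrow> bool" where
  "is_tree V E \<longleftrightarrow>
     V \<noteq> {} \<and> (\<forall>e\<in>E. e \<subseteq> V \<and> card e = 2) \<and>
     (\<forall>u\<in>V. \<forall>v\<in>V. (u, v) \<in> (adj E)\<^sup>*) \<and>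
     (\<nexists>c. is_cycle E c)"

definition rooted_trees :: "nat \<Rightarrow> (nat set set \<times> nat) set" where
  "rooted_trees n = {(E, r). is_tree {1..n} E \<and> r \<in> {1..n}}"

text \<open>\<^const>\<open>pmf_of_set\<close> is meaningful only for a finite nonempty set.\<close>

lemma finite_rooted_trees: "finite (rooted_trees n)"
proof (rule finite_subset)
  show "rooted_trees n \<subseteq> Pow (Pow {1..n}) \<times> {1..n}"
    by (auto simp: rooted_trees_def is_tree_def)
qed auto

lemma rooted_trees_nonempty:
  assumes "n \<ge> 1"
  shows "rooted_trees n \<noteq> {}"
proof -
  define E where "E = (\<lambda>i. {1, i}) ` {2..n}"
  have edge: "1 \<in> e" if "e \<in> E" for e
    using that by (auto simp: E_def)
  have to_1: "(1, v) \<in> (adj E)\<^sup>*" "(v, 1) \<in> (adj E)\<^sup>*" if "v \<in> {1..n}" for v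
  proof -
    have "v = 1 \<or> {1, v} \<in> E"
      using that by (cases "v = 1") (auto simp: E_def)
    thus "(1, v) \<in> (adj E)\<^sup>*" "(v, 1) \<in> (adj E)\<^sup>*"
      by (auto simp: adj_def insert_commute)
  qed
  have "\<not> is_cycle E c" for c
  proof
    assume c: "is_cycle E c"
    hence len: "length c \<ge> 3" and dist: "distinct c"
      and step: "\<And>i. i < length c \<Longrightarrow> 1 \<in> {c ! i, c ! ((i + 1) mod length c)}"
      using edge by (auto simp: is_cycle_def)
    have a: "1 \<in> {c ! 0, c ! 1}" using step[of 0] len by force
    have b: "1 \<in> {c ! 1, c ! 2}" using step[of 1] len by (simp add: numeral_2_eq_2)
    have d: "1 \<in> {c ! 2, c ! (3 mod length c)}" using step[of 2] len by simp
    have j: "3 mod length c < length c" "3 mod length c \<noteq> 1"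
      using len by (cases "length c = 3"; simp)+
    have "c ! 1 = 1"
    proof (rule ccontr)
      assume "c ! 1 \<noteq> 1"
      hence "c ! 0 = c ! 2" using a b by auto
      moreover have "c ! 0 \<noteq> c ! 2"
        using nth_eq_iff_index_eq[OF dist, of 0 2] len by force
      ultimately show False by contradiction
    qed
    hence "c ! 1 = c ! 2 \<or> c ! 1 = c ! (3 mod length c)" using d by auto
    moreover have "c ! 1 \<noteq> c ! 2" "c ! 1 \<noteq> c ! (3 mod length c)"
      using nth_eq_iff_index_eq[OF dist, of 1 2] nth_eq_iff_index_eq[OF dist, of 1 "3 mod length c"]
        len j by fastforce+
    ultimately show False by blast
  qed
  moreover have "(u, v) \<in> (adj E)\<^sup>*" if "u \<in> {1..n}" "v \<in> {1..n}" for u v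
    using to_1(2)[OF that(1)] to_1(1)[OF that(2)] by (rule rtrancl_trans)
  moreover have "\<forall>e\<in>E. e \<subseteq> {1..n} \<and> card e = 2"
    using assms by (auto simp: E_def)
  ultimately have "(E, 1) \<in> rooted_trees n"
    using assms by (auto simp: rooted_trees_def is_tree_def)
  thus ?thesis by blast
qed


section \<open>The root cluster\<close>

definition induced_edges :: "nat set set \<Rightarrow> nat set \<Rightarrow> nat set set" where
  "induced_edges E U = {e \<in> E. e \<subseteq> U}"

definition root_cluster :: "nat \<Rightarrow> nat set set \<times> nat \<Rightarrow> nat set" where
  "root_cluster k = (\<lambda>(E, r).
     if r \<in> {1..k} then {v \<in> {1..k}. (r, v) \<in> (adj (induced_edges E {1..k}))\<^sup>*} else {})"

definition R :: "nat \<Rightarrow> nat \<Rightarrow> nat pmf" where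
  "R n k = map_pmf (\<lambda>t. card (root_cluster k t)) (pmf_of_set (rooted_trees n))"


section \<open>Analytic notions\<close>

text \<open>The summation index is shifted by one: the series starts with the term \<open>z\<close>.\<close>

definition cayley_T :: "complex \<Rightarrow> complex" where
  "cayley_T z = (\<Sum>n. of_nat (Suc n ^ n) / fact (Suc n) * z ^ Suc n)"

text \<open>The distribution of the real random variable \<open>f X\<close>, where \<open>X\<close> has distribution \<open>p\<close>.\<close>

definition law :: "nat pmf \<Rightarrow> (nat \<Rightarrow> real) \<Rightarrow> real measure" where
  "law p f = distr (measure_pmf p) borel f"

definition law_density :: "(real \<Rightarrow> real) \<Rightarrow> real measure" where
  "law_density f = density lborel (\<lambda>x. ennreal (f x))"

text \<open>
  Convergence in probability to a constant, in terms of the laws only: the random variables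
  of the sequence live on different probability spaces.
\<close>

definition tendsto_in_prob_const :: "(nat \<Rightarrow> real measure) \<Rightarrow> real \<Rightarrow> bool" where
  "tendsto_in_prob_const M c \<longleftrightarrow>
     (\<forall>\<epsilon>>0. (\<lambda>n. measure (M n) {x. \<bar>x - c\<bar> > \<epsilon>}) \<longlonglongrightarrow> 0)"

text \<open>Shape \<open>a\<close> and rate \<open>b\<close>.\<close>

definition gamma_density :: "real \<Rightarrow> real \<Rightarrow> real \<Rightarrow> real" where
  "gamma_density a b x =
     (if x > 0 then b powr a / Gamma a * x powr (a - 1) * exp (- b * x) else 0)"

definition giant_fraction_density :: "real \<Rightarrow> real \<Rightarrow> real" where
  "giant_fraction_density c x =
     (if 0 < x \<and> x < 1
      then 1 / sqrt (2 * pi) * (c / (sqrt x * (1 - x) powr (3/2))) *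
           exp (- (c\<^sup>2 * x / (2 * (1 - x))))
      else 0)"

definition levy_density :: "real \<Rightarrow> real" where
  "levy_density x =
     (if x > 0 then 1 / (sqrt (2 * pi) * x powr (3/2)) * exp (- (1 / (2 * x))) else 0)"

end

theory Submission
  imports Defs "HOL-Real_Asymp.Real_Asymp"
begin

text \<open>
  The exact law is a count of trees.  A tree rooted at $r$ is the same thing as an acyclic parent
  map on the other vertices, and for a parent map a subset $S$ of $[k]$ is the root cluster iff
  it contains $r$, it contains the parents of its other elements, and no further vertex of $[k]$ has
  its parent in $S$.  Restricting a parent map
  to $S$ and to the rest therefore splits it into a tree on $S$ and a forest hanging below $S$ in
  which only the $n-k$ covered vertices may be attached directly to $S$ (\<open>card_forests_split\<close>).
  Forests are counted by recursion on the layer of vertices attached directly to the roots; the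
  binomial theorem turns the recursion into a closed form even when this layer is confined to a
  prescribed set (\<open>card_forests_restricted\<close>).  Multiplying out gives \<open>pmf_root_cluster\<close>.

  If $k = o(n)$, the cluster is nonempty with probability $k/n$ only.  The other five limits are local
  limit theorems.  If $k \sim \alpha n$, or if $k = n - d$ with $d$ fixed, the
  probability mass function converges at every single point, and a distribution function at a
  point is a finite sum of such values.  For the generating functions put $T = z e^T$: the series
  $\sum_j d (d+j)^{j-1} z^j / j!$ is $e^{d T}$, because substituting $z = x e^{-x}$ turns it into
  $e^{d x}$, by the vanishing of finite differences of polynomials of low degree
  (\<open>abel_fps_compose\<close>).  Both limit laws have total mass $1$ because $T(\alpha e^{-\alpha}) = \alpha$ for
  $0 < \alpha < 1$ and $T(1/e) = 1$.

  In the three remaining regimes $k$, $m$ and $J = k - m$ all tend to infinity along the values of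
  $m$ that matter, and Stirling's formula applies to the binomial coefficient.  With
  $h(y) = \ln (1 + y) / y$ the powers combine to $\exp (-d\,(h(d/k) - h(d/J)))$, and since
  $h'(0) = -1/2$ the exponent is asymptotically $-d^2 (1/J - 1/k) / 2$
  (\<open>exponent_limit\<close>).  This produces the three densities pointwise (\<open>pmf_R_local_limit\<close>).  By
  Scheffe's lemma pointwise convergence to a density of total mass $1$ already gives weak
  convergence, with no tail estimate (\<open>weak_conv_m_lattice\<close>).  The three densities have mass $1$
  because they are the laws of $Z^2$, of $Z^2/(c^2+Z^2)$ and of $1/Z^2$ for a standard normal $Z$.
\<close>

section \<open>Forests as acyclic parent maps\<close>

text \<open>
  The parent maps of forests with vertex set \<open>A \<union> B\<close> and set of roots \<open>B\<close>.  Acyclicity is phrased as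
  the absence of a nonempty invariant subset of \<open>A\<close>: this restricts well to subsets and yields the
  induction rule along parents directly, without iterating the map.
\<close>

definition forests :: "'a set \<Rightarrow> 'a set \<Rightarrow> ('a \<Rightarrow> 'a) set" where
  "forests A B = {f \<in> A \<rightarrow>\<^sub>E A \<union> B. \<forall>X\<subseteq>A. f ` X \<subseteq> X \<longrightarrow> X = {}}"

lemma forests_induct [consumes 2, case_names step]:
  assumes f: "f \<in> forests A B" and a: "a \<in> A"
    and step: "\<And>a. a \<in> A \<Longrightarrow> (f a \<in> A \<Longrightarrow> P (f a)) \<Longrightarrow> P a"
  shows "P a"
proof -
  have "f ` {a \<in> A. \<not> P a} \<subseteq> {a \<in> A. \<not> P a}"
    using step by blast
  moreover have "{a \<in> A. \<not> P a} \<subseteq> A" by auto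
  ultimately have "{a \<in> A. \<not> P a} = {}"
    using f unfolding forests_def by blast
  thus ?thesis using a by blast
qed

lemma forests_mem: "f \<in> forests A B \<Longrightarrow> a \<in> A \<Longrightarrow> f a \<in> A \<union> B"
  by (auto simp: forests_def)

lemma finite_forests: "finite A \<Longrightarrow> finite B \<Longrightarrow> finite (forests A B)"
  unfolding forests_def by (rule finite_subset[of _ "A \<rightarrow>\<^sub>E A \<union> B"]) (auto intro: finite_PiE)

lemma forests_empty_domain [simp]: "forests {} B = {\<lambda>_. undefined}"
  by (auto simp: forests_def)

lemma forests_empty_roots: "A \<noteq> {} \<Longrightarrow> forests A {} = {}"
  by (auto simp: forests_def)

text \<open>
  The key decomposition: a forest in which \<open>L\<close> has all its parents in \<open>L \<union> B\<close> is a forest on \<open>L\<close> with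
  roots \<open>B\<close> together with an arbitrary forest on the remaining vertices with roots \<open>L \<union> B\<close>.  It is used
  twice, with \<open>L\<close> the layer next to the roots and with \<open>L\<close> the root cluster without its root.  Acyclicity
  survives gluing because an invariant set meets \<open>L\<close> in an invariant set.
\<close>

lemma forests_split_bij:
  assumes AB: "A \<inter> B = {}" and L: "L \<subseteq> A"
  shows "bij_betw (\<lambda>f. (restrict f L, restrict f (A - L)))
           {f \<in> forests A B. f ` L \<subseteq> L \<union> B}
           (forests L B \<times> forests (A - L) (L \<union> B))"
proof (rule bij_betw_byWitness[where f' = "\<lambda>(g, h) a. if a \<in> L then g a else h a"])
  let ?M = "A - L"
  show "\<forall>f\<in>{f \<in> forests A B. f ` L \<subseteq> L \<union> B}.
      (\<lambda>(g, h) a. if a \<in> L then g a else h a) (restrict f L, restrict f ?M) = f"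
    using L by (auto simp: forests_def fun_eq_iff PiE_def extensional_def)
  show "\<forall>p\<in>forests L B \<times> forests ?M (L \<union> B).
      (\<lambda>f. (restrict f L, restrict f ?M)) ((\<lambda>(g, h) a. if a \<in> L then g a else h a) p) = p"
    by (auto simp: forests_def fun_eq_iff PiE_def extensional_def)
  show "(\<lambda>f. (restrict f L, restrict f ?M)) ` {f \<in> forests A B. f ` L \<subseteq> L \<union> B}
      \<subseteq> forests L B \<times> forests ?M (L \<union> B)"
  proof (clarsimp, intro conjI)
    fix f assume f: "f \<in> forests A B" and fL: "f ` L \<subseteq> L \<union> B"
    have closed: "X = {}" if "X \<subseteq> A" "f ` X \<subseteq> X" for X
      using f that by (auto simp: forests_def)
    show "restrict f L \<in> forests L B"
      unfolding forests_def
    proof (intro CollectI conjI allI impI)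
      show "restrict f L \<in> L \<rightarrow>\<^sub>E L \<union> B" using fL by auto
      fix X assume X: "X \<subseteq> L" "restrict f L ` X \<subseteq> X"
      hence "f ` X \<subseteq> X" by (auto simp: image_subset_iff subset_iff)
      thus "X = {}" using closed X L by blast
    qed
    show "restrict f ?M \<in> forests ?M (L \<union> B)"
      unfolding forests_def
    proof (intro CollectI conjI allI impI)
      show "restrict f ?M \<in> ?M \<rightarrow>\<^sub>E ?M \<union> (L \<union> B)" using forests_mem[OF f] by auto
      fix X assume X: "X \<subseteq> ?M" "restrict f ?M ` X \<subseteq> X"
      hence "f ` X \<subseteq> X" by (auto simp: image_subset_iff subset_iff)
      thus "X = {}" using closed X L by blast
    qed
  qed
  show "(\<lambda>(g, h) a. if a \<in> L then g a else h a) ` (forests L B \<times> forests ?M (L \<union> B))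
      \<subseteq> {f \<in> forests A B. f ` L \<subseteq> L \<union> B}"
  proof (clarsimp, intro conjI)
    fix g h assume g: "g \<in> forests L B" and h: "h \<in> forests ?M (L \<union> B)"
    let ?f = "\<lambda>a. if a \<in> L then g a else h a"
    show "?f \<in> forests A B"
      unfolding forests_def
    proof (intro CollectI conjI allI impI)
      have "?f a \<in> A \<union> B" if "a \<in> A" for a
        using forests_mem[OF g, of a] forests_mem[OF h, of a] L that by auto
      moreover have "?f a = undefined" if "a \<notin> A" for a
        using that h L by (auto simp: forests_def PiE_def extensional_def)
      ultimately show "?f \<in> A \<rightarrow>\<^sub>E A \<union> B"
        by (simp add: PiE_iff extensional_def)
      fix X assume X: "X \<subseteq> A" "?f ` X \<subseteq> X"
      have "g ` (X \<inter> L) \<subseteq> X \<inter> L"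
      proof
        fix y assume "y \<in> g ` (X \<inter> L)"
        then obtain x where x: "x \<in> X" "x \<in> L" "y = g x" by auto
        hence "y \<in> X" using X(2) by (auto simp: image_subset_iff)
        moreover have "y \<in> L \<union> B" using forests_mem[OF g] x by auto
        ultimately show "y \<in> X \<inter> L" using X(1) AB by auto
      qed
      hence "X \<inter> L = {}" using g by (auto simp: forests_def)
      hence "X \<subseteq> ?M" "h ` X \<subseteq> X" using X by (auto simp: image_subset_iff)
      thus "X = {}" using h by (auto simp: forests_def)
    qed
    show "g ` L \<subseteq> L \<union> B"
      using forests_mem[OF g] by auto
  qed
qed

lemma card_forests_split:
  assumes "A \<inter> B = {}" "L \<subseteq> A"
  shows "card {f \<in> forests A B. f ` L \<subseteq> L \<union> B \<and> P (restrict f L) \<and> Q (restrict f (A - L))}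
       = card {g \<in> forests L B. P g} * card {h \<in> forests (A - L) (L \<union> B). Q h}"
proof -
  let ?s = "\<lambda>f. (restrict f L, restrict f (A - L))"
  let ?D = "{f \<in> forests A B. f ` L \<subseteq> L \<union> B}"
  let ?PQ = "{g \<in> forests L B. P g} \<times> {h \<in> forests (A - L) (L \<union> B). Q h}"
  note bij = forests_split_bij[OF assms]
  have "bij_betw ?s {f \<in> ?D. ?s f \<in> ?PQ} ?PQ"
  proof (rule bij_betw_subset[OF bij])
    show "?s ` {f \<in> ?D. ?s f \<in> ?PQ} = ?PQ"
    proof
      show "?PQ \<subseteq> ?s ` {f \<in> ?D. ?s f \<in> ?PQ}"
      proof
        fix p assume p: "p \<in> ?PQ"
        hence "p \<in> ?s ` ?D" using bij by (auto simp: bij_betw_def)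
        thus "p \<in> ?s ` {f \<in> ?D. ?s f \<in> ?PQ}" using p by blast
      qed
    qed auto
  qed auto
  moreover have "{f \<in> ?D. ?s f \<in> ?PQ}
      = {f \<in> forests A B. f ` L \<subseteq> L \<union> B \<and> P (restrict f L) \<and> Q (restrict f (A - L))}"
    using bij by (force simp: bij_betw_def)
  ultimately have "card {f \<in> forests A B. f ` L \<subseteq> L \<union> B \<and> P (restrict f L) \<and> Q (restrict f (A - L))} = card ?PQ"
    using bij_betw_same_card[of ?s] by simp
  thus ?thesis by (simp only: card_cartesian_product)
qed

lemma sum_Pow_card:
  fixes g :: "nat \<Rightarrow> 'b::comm_semiring_1"
  assumes "finite U"
  shows "(\<Sum>L\<in>Pow U. g (card L)) = (\<Sum>l\<le>card U. of_nat (card U choose l) * g l)"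
proof -
  have "(\<Sum>L\<in>Pow U. g (card L)) = (\<Sum>l\<le>card U. \<Sum>L | L \<in> Pow U \<and> card L = l. g (card L))"
    using assms by (intro sum.group[symmetric]) (auto intro: card_mono)
  also have "\<dots> = (\<Sum>l\<le>card U. of_nat (card U choose l) * g l)"
    using n_subsets[OF assms] by (intro sum.cong) auto
  finally show ?thesis .
qed

text \<open>
  The binomial theorem differentiated with respect to \<open>b\<close>.  The factor \<open>b + c\<close> on the left spares the
  exponent \<open>u - 1\<close>.
\<close>

lemma sum_binomial_weighted:
  "(\<Sum>l\<le>u. (u choose l) * (l * b ^ l * c ^ (u - l))) * (b + c) = u * b * (b + c) ^ u"
  for b c :: nat
proof (cases u)
  case (Suc v)
  have "(\<Sum>l\<le>u. (u choose l) * (l * b ^ l * c ^ (u - l)))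
      = (\<Sum>l\<le>v. (u choose Suc l) * (Suc l * b ^ Suc l * c ^ (v - l)))"
    unfolding Suc by (subst sum.atMost_Suc_shift) simp
  also have "\<dots> = (\<Sum>l\<le>v. u * b * ((v choose l) * b ^ l * c ^ (v - l)))"
  proof (rule sum.cong)
    fix l
    have "(u choose Suc l) * Suc l = u * (v choose l)"
      using Suc_times_binomial_eq[of v l] by (simp add: Suc)
    thus "(u choose Suc l) * (Suc l * b ^ Suc l * c ^ (v - l))
        = u * b * ((v choose l) * b ^ l * c ^ (v - l))"
      by (metis (no_types, opaque_lifting) mult.assoc mult.left_commute power_Suc)
  qed simp
  also have "\<dots> = u * b * (b + c) ^ v"
    by (simp add: binomial_ring sum_distrib_left)
  finally show ?thesis by (simp add: Suc algebra_simps)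
qed simp

text \<open>
  Fixing the layer \<open>L\<close> of vertices attached to \<open>B\<close>, the elements of \<open>L\<close> choose their parents in \<open>B\<close>
  freely, and the rest is a forest whose roots are \<open>L\<close>.
\<close>

lemma card_forests_layer:
  assumes fin: "finite A" "finite B" and AB: "A \<inter> B = {}" and L: "L \<subseteq> A"
  shows "card {f \<in> forests A B. {a \<in> A. f a \<in> B} = L} = card B ^ card L * card (forests (A - L) L)"
proof -
  have "{f \<in> forests A B. {a \<in> A. f a \<in> B} = L}
      = {f \<in> forests A B. f ` L \<subseteq> L \<union> B \<and> restrict f L ` L \<subseteq> B
           \<and> restrict f (A - L) ` (A - L) \<inter> B = {}}"
    using L by (auto simp: image_subset_iff)
  hence "card {f \<in> forests A B. {a \<in> A. f a \<in> B} = L}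
      = card {g \<in> forests L B. g ` L \<subseteq> B} * card {h \<in> forests (A - L) (L \<union> B). h ` (A - L) \<inter> B = {}}"
    using card_forests_split[OF AB L, of "\<lambda>g. g ` L \<subseteq> B" "\<lambda>h. h ` (A - L) \<inter> B = {}"] by simp
  also have "{g \<in> forests L B. g ` L \<subseteq> B} = L \<rightarrow>\<^sub>E B"
  proof
    show "L \<rightarrow>\<^sub>E B \<subseteq> {g \<in> forests L B. g ` L \<subseteq> B}"
    proof
      fix g assume g: "g \<in> L \<rightarrow>\<^sub>E B"
      have "X = {}" if "X \<subseteq> L" "g ` X \<subseteq> X" for X
        using that g L AB by (auto simp: PiE_iff) blast
      thus "g \<in> {g \<in> forests L B. g ` L \<subseteq> B}" using g by (auto simp: forests_def)
    qed
    show "{g \<in> forests L B. g ` L \<subseteq> B} \<subseteq> L \<rightarrow>\<^sub>E B"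
    proof
      fix g assume "g \<in> {g \<in> forests L B. g ` L \<subseteq> B}"
      hence "g \<in> extensional L" "g ` L \<subseteq> B" by (simp_all add: forests_def PiE_def)
      thus "g \<in> L \<rightarrow>\<^sub>E B" by (auto simp: PiE_iff)
    qed
  qed
  also have "{h \<in> forests (A - L) (L \<union> B). h ` (A - L) \<inter> B = {}} = forests (A - L) L"
  proof (rule Set.set_eqI)
    fix h
    have "h \<in> A - L \<rightarrow>\<^sub>E A - L \<union> (L \<union> B) \<and> h ` (A - L) \<inter> B = {} \<longleftrightarrow> h \<in> A - L \<rightarrow>\<^sub>E A - L \<union> L"
      using AB L by (auto simp: PiE_iff)
    thus "h \<in> {h \<in> forests (A - L) (L \<union> B). h ` (A - L) \<inter> B = {}} \<longleftrightarrow> h \<in> forests (A - L) L"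
      unfolding forests_def mem_Collect_eq by blast
  qed
  also have "card (L \<rightarrow>\<^sub>E B) = card B ^ card L"
    using fin L by (simp add: card_PiE finite_subset)
  finally show ?thesis .
qed

lemma card_forests_by_layer:
  assumes fin: "finite A" "finite B" and AB: "A \<inter> B = {}" and U: "U \<subseteq> A"
  shows "card {f \<in> forests A B. {a \<in> A. f a \<in> B} \<subseteq> U}
       = (\<Sum>L\<in>Pow U. card B ^ card L * card (forests (A - L) L))"
proof -
  have "{f \<in> F. l f \<subseteq> U} = (\<Union>L\<in>Pow U. {f \<in> F. l f = L})"
    for F and l :: "('a \<Rightarrow> 'a) \<Rightarrow> 'a set" by auto
  hence "{f \<in> forests A B. {a \<in> A. f a \<in> B} \<subseteq> U}
      = (\<Union>L\<in>Pow U. {f \<in> forests A B. {a \<in> A. f a \<in> B} = L})" .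
  hence "card {f \<in> forests A B. {a \<in> A. f a \<in> B} \<subseteq> U}
      = (\<Sum>L\<in>Pow U. card {f \<in> forests A B. {a \<in> A. f a \<in> B} = L})"
  proof (simp only:, intro card_UN_disjoint)
    show "finite (Pow U)" using fin U by (auto intro: finite_subset)
    show "\<forall>L\<in>Pow U. finite {f \<in> forests A B. {a \<in> A. f a \<in> B} = L}"
      using finite_forests[OF fin] by simp
  qed blast
  also have "\<dots> = (\<Sum>L\<in>Pow U. card B ^ card L * card (forests (A - L) L))"
    using U by (intro sum.cong refl card_forests_layer fin AB) auto
  finally show ?thesis .
qed

text \<open>
  The inductive step of the count, with the induction hypothesis as a premise: it serves both the
  induction for unrestricted forests and, afterwards, the restricted count.  The closed form is
  $u b\, a^{a-1-u} (a+b)^{u-1}$; it is multiplied by $a (a+b)$ to stay within the natural numbers.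
\<close>

lemma card_forests_restricted_aux:
  assumes fin: "finite A" "finite B" and AB: "A \<inter> B = {}" and U: "U \<subseteq> A"
    and IH: "\<And>L. L \<subseteq> A \<Longrightarrow> L \<noteq> {} \<Longrightarrow> card (forests (A - L) L) * card A = card L * card A ^ (card A - card L)"
  shows "card {f \<in> forests A B. {a \<in> A. f a \<in> B} \<subseteq> U} * card A * (card A + card B)
       = card U * card B * card A ^ (card A - card U) * (card A + card B) ^ card U"
proof -
  let ?a = "card A" and ?b = "card B" and ?u = "card U"
  have finU: "finite U" using fin U by (auto intro: finite_subset)
  have u: "?u \<le> ?a" using fin U by (auto intro: card_mono)
  have "card {f \<in> forests A B. {a \<in> A. f a \<in> B} \<subseteq> U} * ?a
      = (\<Sum>L\<in>Pow U. ?b ^ card L * (card (forests (A - L) L) * ?a))"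
    by (simp add: card_forests_by_layer[OF fin AB U] sum_distrib_right mult.assoc)
  also have "\<dots> = (\<Sum>L\<in>Pow U. card L * ?b ^ card L * ?a ^ (?u - card L)) * ?a ^ (?a - ?u)"
    unfolding sum_distrib_right
  proof (rule sum.cong)
    fix L assume L: "L \<in> Pow U"
    have l: "card L \<le> ?u" using finU L by (auto intro: card_mono)
    have "card (forests (A - L) L) * ?a = card L * ?a ^ (?a - card L)"
    proof (cases "L = {}")
      \<comment> \<open>For an empty layer both sides vanish: a nonempty vertex set has no forest without roots.\<close>
      case True thus ?thesis using forests_empty_roots[of A] fin by (cases "A = {}") auto
    qed (use IH L U in auto)
    moreover have "?a ^ (?a - card L) = ?a ^ (?u - card L) * ?a ^ (?a - ?u)"
      using l u by (simp flip: power_add)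
    ultimately show "?b ^ card L * (card (forests (A - L) L) * ?a)
        = card L * ?b ^ card L * ?a ^ (?u - card L) * ?a ^ (?a - ?u)" by (simp only: ac_simps)
  qed simp
  also have "(\<Sum>L\<in>Pow U. card L * ?b ^ card L * ?a ^ (?u - card L))
      = (\<Sum>l\<le>?u. (?u choose l) * (l * ?b ^ l * ?a ^ (?u - l)))"
    using sum_Pow_card[OF finU, of "\<lambda>l. l * ?b ^ l * ?a ^ (?u - l)"] by simp
  finally have "card {f \<in> forests A B. {a \<in> A. f a \<in> B} \<subseteq> U} * ?a * (?a + ?b)
      = (\<Sum>l\<le>?u. (?u choose l) * (l * ?b ^ l * ?a ^ (?u - l))) * (?b + ?a) * ?a ^ (?a - ?u)"
    by (simp only: ac_simps)
  thus ?thesis by (simp only: sum_binomial_weighted) (simp only: ac_simps)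
qed

text \<open>
  Cayley's formula for rooted forests, $b\,(a+b)^{a-1}$.
\<close>

lemma card_forests:
  assumes "finite A" "finite B" "A \<inter> B = {}"
  shows "card (forests A B) * (card A + card B) = card B * (card A + card B) ^ card A"
  using assms
proof (induction "card A" arbitrary: A B rule: less_induct)
  case less
  show ?case
  proof (cases "A = {}")
    case False
    have "card (forests (A - L) L) * card A = card L * card A ^ (card A - card L)"
      if L: "L \<subseteq> A" "L \<noteq> {}" for L
    proof -
      have "finite L" using L less.prems by (auto intro: finite_subset)
      hence c: "card (A - L) = card A - card L" "card L \<le> card A" "card L > 0"
        using L less.prems by (auto simp: card_Diff_subset card_mono card_gt_0_iff)
      thus ?thesis
        using less.hyps[of "A - L" L] less.prems \<open>finite L\<close> by auto
    qed
    from card_forests_restricted_aux[OF less.prems order_refl this]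
    have "card {f \<in> forests A B. {a \<in> A. f a \<in> B} \<subseteq> A} * card A * (card A + card B)
        = card A * card B * (card A + card B) ^ card A" by simp
    moreover have "{f \<in> forests A B. {a \<in> A. f a \<in> B} \<subseteq> A} = forests A B" by auto
    moreover have "card A > 0" using False less.prems by (simp add: card_gt_0_iff)
    ultimately show ?thesis by (simp add: ac_simps)
  qed auto
qed

lemma card_forests_restricted:
  assumes "finite A" "finite B" "A \<inter> B = {}" "U \<subseteq> A"
  shows "card {f \<in> forests A B. {a \<in> A. f a \<in> B} \<subseteq> U} * card A * (card A + card B)
       = card U * card B * card A ^ (card A - card U) * (card A + card B) ^ card U"
proof (rule card_forests_restricted_aux[OF assms])
  fix L assume L: "L \<subseteq> A" "L \<noteq> {}"
  hence "finite L" using assms by (auto intro: finite_subset)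
  thus "card (forests (A - L) L) * card A = card L * card A ^ (card A - card L)"
    using card_forests[of "A - L" L] L assms by (simp add: card_Diff_subset card_mono Diff_Int_distrib2)
qed

section \<open>Trees correspond to parent maps\<close>

definition parent_edges :: "'a set \<Rightarrow> ('a \<Rightarrow> 'a) \<Rightarrow> 'a set set" where
  "parent_edges A f = (\<lambda>v. {v, f v}) ` A"

lemma sym_adj: "sym (adj E)"
  by (auto simp: adj_def sym_def insert_commute)

lemma forests_no_2cycle:
  assumes "f \<in> forests A B" "a \<in> A" "f a \<in> A" shows "f (f a) \<noteq> a"
proof
  assume "f (f a) = a"
  hence "f ` {a, f a} \<subseteq> {a, f a}" "{a, f a} \<subseteq> A" using assms by auto
  thus False using assms(1) unfolding forests_def by blast
qed

lemma forests_neq: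
  assumes "f \<in> forests A B" "a \<in> A" shows "f a \<noteq> a"
proof
  assume "f a = a"
  hence "f ` {a} \<subseteq> {a}" "{a} \<subseteq> A" using assms by auto
  thus False using assms(1) unfolding forests_def by blast
qed

lemma forests_depth:
  assumes f: "f \<in> forests A {r}" and r: "r \<notin> A"
  obtains d :: "_ \<Rightarrow> nat" where "\<And>a. a \<in> A \<Longrightarrow> d a = Suc (d (f a))"
proof
  fix a assume a: "a \<in> A"
  let ?d = "\<lambda>a. LEAST i. (f ^^ i) a = r"
  have "\<exists>i. (f ^^ i) a = r"
    using f a
  proof (induction rule: forests_induct)
    case (step a)
    have "\<exists>i. (f ^^ i) (f a) = r"
    proof (cases "f a = r")
      case True thus ?thesis by (intro exI[of _ 0]) auto
    qed (use step forests_mem[OF f] in auto)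
    then obtain i where "(f ^^ i) (f a) = r" ..
    hence "(f ^^ Suc i) a = r" by (simp add: funpow_swap1)
    thus ?case ..
  qed
  then obtain i where i: "(f ^^ i) a = r" ..
  have "?d a = Suc (LEAST i. (f ^^ Suc i) a = r)"
    by (rule Least_Suc[of "\<lambda>i. (f ^^ i) a = r", OF i]) (use a r in auto)
  also have "\<dots> = Suc (?d (f a))" by (simp add: funpow_swap1)
  finally show "?d a = Suc (?d (f a))" .
qed

text \<open>
  A deepest vertex of a cycle would have both of its neighbours on the cycle as its parent.
\<close>

lemma parent_edges_no_cycle:
  assumes f: "f \<in> forests A {r}" and r: "r \<notin> A"
  shows "\<not> is_cycle (parent_edges A f) c"
proof
  assume c: "is_cycle (parent_edges A f) c"
  define l where "l = length c"
  have l: "l \<ge> 3" "distinct c"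
    and step: "\<And>i. i < l \<Longrightarrow> {c ! i, c ! ((i + 1) mod l)} \<in> parent_edges A f"
    using c by (auto simp: is_cycle_def l_def)
  obtain d :: "nat \<Rightarrow> nat" where d: "\<And>a. a \<in> A \<Longrightarrow> d a = Suc (d (f a))"
    using forests_depth[OF f r] by blast
  have up: "y = f x" if "{x, y} \<in> parent_edges A f" "d y \<le> d x" for x y
    using that d by (auto simp: parent_edges_def doubleton_eq_iff)
  obtain i where i: "i < l" "\<And>j. j < l \<Longrightarrow> d (c ! j) \<le> d (c ! i)"
  proof -
    have "finite ((\<lambda>j. d (c ! j)) ` {..<l})" "(\<lambda>j. d (c ! j)) ` {..<l} \<noteq> {}"
      using l by (auto simp: lessThan_empty_iff)
    from Max_in[OF this] Max_ge[OF this(1)] show ?thesis using that by force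
  qed
  define j where "j = (if i = 0 then l - 1 else i - 1)"
  define k where "k = (if i = l - 1 then 0 else i + 1)"
  have jk: "j < l" "k < l" "j \<noteq> k" "(j + 1) mod l = i" "(i + 1) mod l = k"
    using l i by (auto simp: j_def k_def)
  have "c ! k = f (c ! i)" using up[of "c ! i" "c ! k"] step[of i] i jk by auto
  moreover have "c ! j = f (c ! i)"
    using up[of "c ! i" "c ! j"] step[of j] i jk by (auto simp: insert_commute)
  ultimately have "c ! k = c ! j" by simp
  thus False using l jk by (auto simp: nth_eq_iff_index_eq l_def)
qed

lemma parent_edges_connected:
  assumes f: "f \<in> forests (V - {r}) {r}" and r: "r \<in> V" and v: "v \<in> V"
  shows "(v, r) \<in> (adj (parent_edges (V - {r}) f))\<^sup>*"
proof (cases "v = r")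
  case False
  hence "v \<in> V - {r}" using v by auto
  with f show ?thesis
  proof (induction rule: forests_induct)
    case (step a)
    hence "(a, f a) \<in> adj (parent_edges (V - {r}) f)"
      by (auto simp: adj_def parent_edges_def)
    moreover have "(f a, r) \<in> (adj (parent_edges (V - {r}) f))\<^sup>*"
      using step forests_mem[OF f] by (cases "f a = r") auto
    ultimately show ?case by (rule converse_rtrancl_into_rtrancl)
  qed
qed simp

lemma parent_edges_is_tree:
  assumes f: "f \<in> forests (V - {r}) {r}" and r: "r \<in> V"
  shows "is_tree V (parent_edges (V - {r}) f)"
  unfolding is_tree_def
proof (intro conjI ballI)
  let ?E = "parent_edges (V - {r}) f"
  show "V \<noteq> {}" using r by auto
  show "\<nexists>c. is_cycle ?E c" using parent_edges_no_cycle[OF f] by auto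
  show "(u, v) \<in> (adj ?E)\<^sup>*" if "u \<in> V" "v \<in> V" for u v
  proof -
    have "(r, v) \<in> (adj ?E)\<^sup>*"
      using parent_edges_connected[OF f r that(2)] sym_rtrancl[OF sym_adj] by (auto dest: symD)
    thus ?thesis using parent_edges_connected[OF f r that(1)] by simp
  qed
  fix e assume "e \<in> ?E"
  then obtain v where v: "v \<in> V - {r}" "e = {v, f v}" by (auto simp: parent_edges_def)
  show "e \<subseteq> V" using forests_mem[OF f v(1)] v r by auto
  show "card e = 2" using forests_neq[OF f v(1)] v by (auto simp: card_2_iff)
qed

text \<open>
  Going down from the root: if \<open>{a, f a}\<close> is not the edge from \<open>a\<close> to its parent under \<open>g\<close>, then it is the
  edge from \<open>f a\<close> to its parent under \<open>g\<close>, which by induction is also its parent under \<open>f\<close>; so \<open>a\<close> and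
  \<open>f a\<close> would be each other's parents.
\<close>

lemma parent_edges_inj: "r \<notin> A \<Longrightarrow> inj_on (parent_edges A) (forests A {r})"
proof (rule inj_onI)
  fix f g assume f: "f \<in> forests A {r}" and g: "g \<in> forests A {r}"
    and eq: "parent_edges A f = parent_edges A g"
  have "f a = g a" if "a \<in> A" for a
    using f that
  proof (induction rule: forests_induct)
    case (step a)
    have "{a, f a} \<in> parent_edges A g"
      using step.hyps eq by (auto simp: parent_edges_def)
    then obtain b where b: "b \<in> A" "{a, f a} = {b, g b}" by (auto simp: parent_edges_def)
    show ?case
    proof (cases "b = a")
      case False
      hence "b = f a" "g b = a" using b by (auto simp: doubleton_eq_iff)
      thus ?thesis using step forests_no_2cycle[OF f, of a] b by auto
    qed (use b in \<open>auto simp: doubleton_eq_iff\<close>)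
  qed
  moreover have "f \<in> A \<rightarrow>\<^sub>E A \<union> {r}" "g \<in> A \<rightarrow>\<^sub>E A \<union> {r}"
    using f g by (simp_all add: forests_def)
  ultimately show "f = g" by (intro PiE_ext)
qed

text \<open>
  Cycles are lists of distinct vertices, so connectedness has to be turned into paths without
  repetition: when a walk returns to a vertex, the detour is cut off.
\<close>

lemma rtrancl_adj_path:
  assumes "(u, v) \<in> (adj E)\<^sup>*"
  shows "\<exists>p. p \<noteq> [] \<and> hd p = u \<and> last p = v \<and> distinct p
           \<and> (\<forall>i. Suc i < length p \<longrightarrow> {p ! i, p ! Suc i} \<in> E)"
  using assms
proof (induction rule: rtrancl_induct)
  case base
  show ?case by (intro exI[of _ "[u]"]) auto
next
  case (step y z)
  then obtain p where p: "p \<noteq> []" "hd p = u" "last p = y" "distinct p"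
    and e: "\<And>i. Suc i < length p \<Longrightarrow> {p ! i, p ! Suc i} \<in> E" by auto
  have yz: "{y, z} \<in> E" using step by (simp add: adj_def)
  show ?case
  proof (cases "z \<in> set p")
    case True
    then obtain q s where p': "p = q @ z # s" by (meson split_list)
    have "{(q @ [z]) ! i, (q @ [z]) ! Suc i} \<in> E" if "Suc i < length (q @ [z])" for i
      using e[of i] that by (auto simp: p' nth_append less_Suc_eq split: if_splits)
    moreover have "hd (q @ [z]) = u" using p by (cases q) (auto simp: p')
    ultimately show ?thesis using p by (intro exI[of _ "q @ [z]"]) (auto simp: p')
  next
    case False
    have "{(p @ [z]) ! i, (p @ [z]) ! Suc i} \<in> E" if "Suc i < length (p @ [z])" for i
    proof (cases "Suc i < length p")
      case False
      hence "i = length p - 1" using that by auto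
      thus ?thesis using p yz by (auto simp: nth_append last_conv_nth)
    qed (use e[of i] in \<open>auto simp: nth_append\<close>)
    thus ?thesis using p False by (intro exI[of _ "p @ [z]"]) auto
  qed
qed

text \<open>
  Sending each vertex to a neighbour that is closer to the root gives an acyclic map whose edges
  belong to the tree.  They are all its edges, since they already connect the vertices and any
  further edge would close a cycle.
\<close>

lemma tree_is_parent_edges:
  assumes tree: "is_tree V E" and r: "r \<in> V"
  shows "\<exists>f\<in>forests (V - {r}) {r}. E = parent_edges (V - {r}) f"
proof -
  define d where "d v = (LEAST i. (v, r) \<in> adj E ^^ i)" for v
  have edges: "\<And>e. e \<in> E \<Longrightarrow> e \<subseteq> V \<and> card e = 2" using tree by (auto simp: is_tree_def)
  have "\<exists>u\<in>V. {v, u} \<in> E \<and> d u < d v" if v: "v \<in> V - {r}" for v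
  proof -
    have "(v, r) \<in> (adj E)\<^sup>*" using tree v r by (auto simp: is_tree_def)
    then obtain i where "(v, r) \<in> adj E ^^ i" by (auto simp: rtrancl_power)
    hence dv: "(v, r) \<in> adj E ^^ d v" unfolding d_def by (rule LeastI)
    then obtain m where m: "d v = Suc m" using v by (cases "d v") auto
    then obtain u where u: "(v, u) \<in> adj E" "(u, r) \<in> adj E ^^ m"
      using dv relpow_Suc_D2[of v r m "adj E"] by metis
    hence "d u \<le> m" unfolding d_def by (intro Least_le)
    thus ?thesis using u m edges[of "{v, u}"] by (intro bexI[of _ u]) (auto simp: adj_def)
  qed
  then obtain g where g: "\<And>v. v \<in> V - {r} \<Longrightarrow> g v \<in> V \<and> {v, g v} \<in> E \<and> d (g v) < d v"
    by metis
  define f where "f = restrict g (V - {r})"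
  have f: "f \<in> forests (V - {r}) {r}"
    unfolding forests_def
  proof (intro CollectI conjI allI impI)
    show "f \<in> V - {r} \<rightarrow>\<^sub>E V - {r} \<union> {r}" using g by (auto simp: f_def)
    fix X assume X: "X \<subseteq> V - {r}" "f ` X \<subseteq> X"
    show "X = {}"
    proof (rule ccontr)
      assume "X \<noteq> {}"
      then obtain x where x: "x \<in> X" "\<And>y. y \<in> X \<Longrightarrow> d x \<le> d y"
        using ex_has_least_nat[of "\<lambda>x. x \<in> X" _ d] by blast
      have "f x \<in> X" using X x by auto
      moreover have "f x = g x" "x \<in> V - {r}" using X x by (auto simp: f_def)
      ultimately show False using x(2)[of "g x"] g[of x] by auto
    qed
  qed
  let ?F = "parent_edges (V - {r}) f"
  have sub: "?F \<subseteq> E" using g by (auto simp: parent_edges_def f_def)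
  have "E \<subseteq> ?F"
  proof
    fix e assume e: "e \<in> E"
    obtain u v where uv: "e = {u, v}" "u \<noteq> v" using edges[OF e] by (auto simp: card_2_iff)
    show "e \<in> ?F"
    proof (rule ccontr)
      assume nF: "e \<notin> ?F"
      have "u \<in> V" "v \<in> V" using uv edges[OF e] by auto
      hence "(u, v) \<in> (adj ?F)\<^sup>*"
        using parent_edges_is_tree[OF f r] unfolding is_tree_def by blast
      \<comment> \<open>The edge \<open>e\<close> closes this path to a cycle.\<close>
      from rtrancl_adj_path[OF this] obtain p where
        p: "p \<noteq> []" "hd p = u" "last p = v" "distinct p"
        and step: "\<And>i. Suc i < length p \<Longrightarrow> {p ! i, p ! Suc i} \<in> ?F" by blast
      have ends: "p ! 0 = u" "p ! (length p - 1) = v"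
        using p by (auto simp: hd_conv_nth last_conv_nth)
      have "length p \<noteq> 0" "length p \<noteq> 1" "length p \<noteq> 2"
        using p ends uv step[of 0] nF by auto
      hence "length p \<ge> 3" by linarith
      moreover have "{p ! i, p ! ((i + 1) mod length p)} \<in> E" if "i < length p" for i
      proof (cases "i = length p - 1")
        case True
        hence "(i + 1) mod length p = 0" using \<open>length p \<noteq> 0\<close> by auto
        thus ?thesis using ends True e uv by (simp add: insert_commute)
      next
        case False
        hence "Suc i < length p" using that by auto
        thus ?thesis using step[of i] sub by auto
      qed
      ultimately have "is_cycle E p" using p by (auto simp: is_cycle_def)
      thus False using tree by (auto simp: is_tree_def)
    qed
  qed
  thus ?thesis using f sub by blast
qed

lemma parent_edges_bij:
  assumes "r \<in> V"
  shows "bij_betw (parent_edges (V - {r})) (forests (V - {r}) {r}) {E. is_tree V E}"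
  unfolding bij_betw_def
proof
  show "inj_on (parent_edges (V - {r})) (forests (V - {r}) {r})"
    by (rule parent_edges_inj) simp
  show "parent_edges (V - {r}) ` forests (V - {r}) {r} = {E. is_tree V E}"
    using parent_edges_is_tree[OF _ assms] tree_is_parent_edges[OF _ assms] by blast
qed

section \<open>The exact distribution of the root cluster\<close>

text \<open>
  The root cluster computed from the parent map: the uncovered vertices all of whose ancestors are
  uncovered.
\<close>

inductive_set cluster :: "('a \<Rightarrow> 'a) \<Rightarrow> 'a \<Rightarrow> 'a set \<Rightarrow> 'a set" for f r U where
  root: "r \<in> U \<Longrightarrow> r \<in> cluster f r U"
| step: "v \<in> U \<Longrightarrow> v \<noteq> r \<Longrightarrow> f v \<in> cluster f r U \<Longrightarrow> v \<in> cluster f r U"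

lemma root_cluster_eqI:
  assumes f: "f \<in> forests ({1..n} - {r}) {r}" and k: "k \<le> n"
    and S: "r \<in> S" "S \<subseteq> {1..k}" "f ` (S - {r}) \<subseteq> S"
    and out: "\<And>v. v \<in> {1..k} - S \<Longrightarrow> f v \<notin> S"
  shows "root_cluster k (parent_edges ({1..n} - {r}) f, r) = S"
proof -
  let ?F = "parent_edges ({1..n} - {r}) f"
  let ?I = "adj (induced_edges ?F {1..k})"
  have "v \<in> S" if "(r, v) \<in> ?I\<^sup>*" for v
    using that
  proof (induction rule: rtrancl_induct)
    case (step y z)
    have "(y, z) \<in> ?I" by (rule step.hyps)
    hence "{y, z} \<in> ?F" and yz: "y \<in> {1..k}" "z \<in> {1..k}"
      unfolding adj_def induced_edges_def by blast+
    then obtain a where a: "a \<in> {1..n} - {r}" "{y, z} = {a, f a}"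
      unfolding parent_edges_def by blast
    hence "(y = a \<and> z = f y) \<or> (z = a \<and> y = f z)" by (auto simp: doubleton_eq_iff)
    thus ?case using out[of z] yz step.IH S(3) a by auto
  qed (use S in auto)
  moreover have "(r, v) \<in> ?I\<^sup>*" if "v \<in> S" for v
  proof (cases "v = r")
    case False
    hence "v \<in> {1..n} - {r}" using that S k by fastforce
    with f have "v \<in> S \<longrightarrow> (r, v) \<in> ?I\<^sup>*"
    proof (induction rule: forests_induct)
      case (step a)
      show ?case
      proof
        assume a: "a \<in> S"
        hence fa: "f a \<in> S" using step.hyps S by auto
        hence "f a \<in> {1..n}" using S k by fastforce
        hence "(r, f a) \<in> ?I\<^sup>*" using step.IH fa by (cases "f a = r") auto
        moreover have "(f a, a) \<in> ?I"
          using step.hyps a fa S by (auto simp: adj_def induced_edges_def parent_edges_def)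
        ultimately show "(r, a) \<in> ?I\<^sup>*" by (rule rtrancl_into_rtrancl)
      qed
    qed
    thus ?thesis using that by simp
  qed simp
  ultimately have "S = {v \<in> {1..k}. (r, v) \<in> ?I\<^sup>*}" using S(2) by blast
  thus ?thesis using S(1,2) by (simp add: root_cluster_def subset_iff)
qed

text \<open>
  This local description of the root cluster is what makes it countable: it is a condition on the
  restriction of the parent map to \<open>S\<close> and one on its restriction to the complement.  That it
  determines the cluster is \<open>root_cluster_eqI\<close>; that the cluster satisfies it follows from the existence
  of one set that does, namely \<^const>\<open>cluster\<close>.
\<close>

lemma root_cluster_iff:
  assumes f: "f \<in> forests ({1..n} - {r}) {r}" and k: "k \<le> n"
    and S: "r \<in> S" "S \<subseteq> {1..k}"
  shows "root_cluster k (parent_edges ({1..n} - {r}) f, r) = S \<longleftrightarrow>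
    f ` (S - {r}) \<subseteq> S \<and> (\<forall>v \<in> {1..k} - S. f v \<notin> S)"
proof
  let ?C = "cluster f r {1..k}"
  have C: "r \<in> ?C" "?C \<subseteq> {1..k}" "f ` (?C - {r}) \<subseteq> ?C" "\<And>v. v \<in> {1..k} - ?C \<Longrightarrow> f v \<notin> ?C"
    using S by (auto simp: subset_iff intro: cluster.intros elim: cluster.cases)
      (metis cluster.step[of _ "{Suc 0..k}" r f] cluster.root[of r "{Suc 0..k}" f] atLeastAtMost_iff)
  assume "root_cluster k (parent_edges ({1..n} - {r}) f, r) = S"
  hence "S = ?C" using root_cluster_eqI[OF f k C] by simp
  thus "f ` (S - {r}) \<subseteq> S \<and> (\<forall>v \<in> {1..k} - S. f v \<notin> S)" using C by simp
next
  assume "f ` (S - {r}) \<subseteq> S \<and> (\<forall>v \<in> {1..k} - S. f v \<notin> S)"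
  thus "root_cluster k (parent_edges ({1..n} - {r}) f, r) = S"
    using root_cluster_eqI[OF f k S] by auto
qed

lemma card_trees_rooted_at:
  assumes "r \<in> {1..n}"
  shows "card {E. is_tree {1..n} E} * n = n ^ (n - 1)"
proof -
  have "card {E. is_tree {1..n} E} = card (forests ({1..n} - {r}) {r})"
    using bij_betw_same_card[OF parent_edges_bij[OF assms]] by simp
  moreover have "card ({1..n} - {r}) = n - 1" "n - 1 + 1 = n" using assms by auto
  ultimately show ?thesis
    using card_forests[of "{1..n} - {r}" "{r}"] by simp
qed

lemma card_rooted_trees: "n \<ge> 1 \<Longrightarrow> card (rooted_trees n) = n ^ (n - 1)"
proof -
  assume n: "n \<ge> 1"
  have "rooted_trees n = {E. is_tree {1..n} E} \<times> {1..n}"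
    by (auto simp: rooted_trees_def)
  thus ?thesis using card_trees_rooted_at[of 1 n] n by (simp add: card_cartesian_product)
qed

text \<open>
  A tree with root cluster \<open>S\<close> is a tree on \<open>S\<close>, contributing $m^{m-2}$, and a forest with roots \<open>S\<close> on
  the $n-m$ other vertices whose first layer consists of covered vertices, contributing
  $m (n-k) (n-m)^{k-m-1} n^{n-k-1}$.  The denominators are multiplied out.
\<close>

lemma card_trees_given_cluster:
  assumes k: "k \<le> n" and S: "r \<in> S" "S \<subseteq> {1..k}" and m: "card S = m"
  shows "card {E. is_tree {1..n} E \<and> root_cluster k (E, r) = S} * m * (n - m) * n
       = m ^ m * (n - k) * (n - m) ^ (k - m) * n ^ (n - k)"
proof -
  let ?V = "{1..n}"
  have r: "r \<in> ?V" and SV: "S \<subseteq> ?V" using S k by force+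
  have finS: "finite S" using S by (auto intro: finite_subset)
  have mpos: "m > 0" using S finS m by (auto simp: card_gt_0_iff)
  have mk: "m \<le> k" using card_mono[of "{1..k}" S] S m by auto
  let ?P = "\<lambda>f. f ` (S - {r}) \<subseteq> S \<and> (\<forall>v \<in> {1..k} - S. f v \<notin> S)"
  have bij: "bij_betw (parent_edges (?V - {r})) {f \<in> forests (?V - {r}) {r}. ?P f}
      {E. is_tree ?V E \<and> root_cluster k (E, r) = S}"
  proof (rule bij_betw_subset[OF parent_edges_bij[OF r]])
    show "parent_edges (?V - {r}) ` {f \<in> forests (?V - {r}) {r}. ?P f}
        = {E. is_tree ?V E \<and> root_cluster k (E, r) = S}"
    proof (intro subset_antisym subsetI)
      fix E assume "E \<in> parent_edges (?V - {r}) ` {f \<in> forests (?V - {r}) {r}. ?P f}"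
      then obtain f where "f \<in> forests (?V - {r}) {r}" "?P f" "E = parent_edges (?V - {r}) f"
        by (elim imageE CollectE conjE) simp
      thus "E \<in> {E. is_tree ?V E \<and> root_cluster k (E, r) = S}"
        using root_cluster_iff[OF _ k S, of f] parent_edges_is_tree[OF _ r, of f] by simp
    next
      fix E assume "E \<in> {E. is_tree ?V E \<and> root_cluster k (E, r) = S}"
      hence E: "is_tree ?V E" "root_cluster k (E, r) = S" by simp_all
      then obtain f where f: "f \<in> forests (?V - {r}) {r}" "E = parent_edges (?V - {r}) f"
        using tree_is_parent_edges[OF _ r] by metis
      hence "?P f" using E root_cluster_iff[OF f(1) k S] by simp
      thus "E \<in> parent_edges (?V - {r}) ` {f \<in> forests (?V - {r}) {r}. ?P f}"
        using f by (intro image_eqI[of _ _ f]) simp_all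
    qed
  qed auto
  let ?Q = "\<lambda>h. {v \<in> ?V - S. h v \<in> S} \<subseteq> {k<..n}"
  have VS: "?V - {r} - (S - {r}) = ?V - S" using S by auto
  have eq: "{f \<in> forests (?V - {r}) {r}. ?P f}
      = {f \<in> forests (?V - {r}) {r}. f ` (S - {r}) \<subseteq> (S - {r}) \<union> {r} \<and> True \<and> ?Q (restrict f (?V - {r} - (S - {r})))}"
  proof (rule Collect_cong, rule conj_cong[OF refl])
    fix f assume "f \<in> forests (?V - {r}) {r}"
    have "S - {r} \<union> {r} = S" using S by auto
    moreover have "(\<forall>v \<in> {1..k} - S. f v \<notin> S) \<longleftrightarrow> ?Q (restrict f (?V - S))"
      using k by (auto simp: subset_iff) 
    ultimately show "?P f \<longleftrightarrow> f ` (S - {r}) \<subseteq> (S - {r}) \<union> {r} \<and> True \<and> ?Q (restrict f (?V - {r} - (S - {r})))"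
      unfolding VS by (simp only: simp_thms)
  qed
  have "card {E. is_tree ?V E \<and> root_cluster k (E, r) = S}
      = card {f \<in> forests (?V - {r}) {r}. ?P f}"
    by (rule bij_betw_same_card[OF bij, symmetric])
  also have "\<dots> = card {g \<in> forests (S - {r}) {r}. True}
      * card {h \<in> forests (?V - {r} - (S - {r})) (S - {r} \<union> {r}). ?Q h}"
    unfolding eq by (rule card_forests_split[of "?V - {r}" "{r}" "S - {r}" "\<lambda>_. True" ?Q]) (use SV in blast)+
  also have "S - {r} \<union> {r} = S" using S by auto
  finally have X: "card {E. is_tree ?V E \<and> root_cluster k (E, r) = S}
      = card (forests (S - {r}) {r}) * card {h \<in> forests (?V - S) S. ?Q h}"
    using VS by simp
  have F: "card (forests (S - {r}) {r}) * m = m ^ (m - 1)"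
    using card_forests[of "S - {r}" "{r}"] finS S m mpos by simp
  have W: "card {h \<in> forests (?V - S) S. ?Q h} * (n - m) * n
      = (n - k) * m * (n - m) ^ (k - m) * n ^ (n - k)"
  proof -
    have "card (?V - S) = n - m" using SV finS m by (simp add: card_Diff_subset)
    moreover have "n - m - (n - k) = k - m" "n - m + m = n" using k mk by auto
    moreover have "{k<..n} \<subseteq> ?V - S" using S by auto
    ultimately show ?thesis
      using card_forests_restricted[of "?V - S" S "{k<..n}"] finS m by auto
  qed
  have "card {E. is_tree ?V E \<and> root_cluster k (E, r) = S} * m * (n - m) * n
      = (card (forests (S - {r}) {r}) * m) * (card {h \<in> forests (?V - S) S. ?Q h} * (n - m) * n)"
    unfolding X by (simp only: ac_simps)
  also have "\<dots> = (m ^ (m - 1) * m) * (n - k) * (n - m) ^ (k - m) * n ^ (n - k)"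
    unfolding F W by (simp only: ac_simps)
  also have "m ^ (m - 1) * m = m ^ m" using mpos by (cases m) auto
  finally show ?thesis .
qed

text \<open>
  Summing over the $\binom{k}{m}$ possible clusters and their $m$ possible roots.
\<close>

lemma card_trees_cluster_size:
  assumes k: "k \<le> n" and m: "1 \<le> m" "m \<le> k"
  shows "card {t \<in> rooted_trees n. card (root_cluster k t) = m} * (n - m) * n
       = (k choose m) * m ^ m * (n - k) * (n - m) ^ (k - m) * n ^ (n - k)"
proof -
  let ?c = "m ^ m * (n - k) * (n - m) ^ (k - m) * n ^ (n - k)"
  let ?Ss = "{S. S \<subseteq> {1..k} \<and> card S = m}"
  let ?I = "Sigma ?Ss (\<lambda>S. S)"
  let ?X = "\<lambda>(S, r). (\<lambda>E. (E, r)) ` {E. is_tree {1..n} E \<and> root_cluster k (E, r) = S}"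
  have finSs: "finite ?Ss" by (rule finite_subset[of _ "Pow {1..k}"]) auto
  have finS: "finite S" if "S \<in> ?Ss" for S using that by (auto intro: finite_subset)
  have finE: "finite {E. is_tree {1..n} E \<and> root_cluster k (E, r) = S}" for r S
    by (rule finite_subset[of _ "Pow (Pow {1..n})"]) (auto simp: is_tree_def)
  have "{t \<in> rooted_trees n. card (root_cluster k t) = m} = (\<Union>x\<in>?I. ?X x)"
  proof
    show "(\<Union>x\<in>?I. ?X x) \<subseteq> {t \<in> rooted_trees n. card (root_cluster k t) = m}"
      using k by (force simp: rooted_trees_def)
    show "{t \<in> rooted_trees n. card (root_cluster k t) = m} \<subseteq> (\<Union>x\<in>?I. ?X x)"
    proof
      fix t assume t: "t \<in> {t \<in> rooted_trees n. card (root_cluster k t) = m}"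
      obtain E r where Er: "t = (E, r)" by (cases t)
      let ?S = "root_cluster k t"
      have "?S \<noteq> {}" using t m by auto
      hence "r \<in> ?S" "?S \<subseteq> {1..k}" by (auto simp: root_cluster_def Er split: if_splits)
      hence "(?S, r) \<in> ?I" "t \<in> ?X (?S, r)"
        using t by (auto simp: Er rooted_trees_def)
      thus "t \<in> (\<Union>x\<in>?I. ?X x)" by blast
    qed
  qed
  also have "card \<dots> = (\<Sum>x\<in>?I. card (?X x))"
  proof (rule card_UN_disjoint)
    show "finite ?I" by (intro finite_SigmaI finSs finS)
    show "\<forall>x\<in>?I. finite (?X x)" using finE by auto
    show "\<forall>x\<in>?I. \<forall>y\<in>?I. x \<noteq> y \<longrightarrow> ?X x \<inter> ?X y = {}" by auto
  qed
  also have "\<dots> = (\<Sum>S\<in>?Ss. \<Sum>r\<in>S. card {E. is_tree {1..n} E \<and> root_cluster k (E, r) = S})"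
  proof -
    have "(\<Sum>x\<in>?I. card (?X x))
        = (\<Sum>(S, r)\<in>?I. card {E. is_tree {1..n} E \<and> root_cluster k (E, r) = S})"
      by (intro sum.cong refl) (simp add: split_beta card_image inj_on_def)
    also have "\<dots> = (\<Sum>S\<in>?Ss. \<Sum>r\<in>S. card {E. is_tree {1..n} E \<and> root_cluster k (E, r) = S})"
      by (rule sum.Sigma[symmetric]) (use finSs finS in blast)+
    finally show ?thesis .
  qed
  finally have "card {t \<in> rooted_trees n. card (root_cluster k t) = m} * (n - m) * n * m
      = (\<Sum>S\<in>?Ss. \<Sum>r\<in>S. card {E. is_tree {1..n} E \<and> root_cluster k (E, r) = S} * m * (n - m) * n)"
    by (simp only: sum_distrib_right) (simp only: ac_simps)
  also have "\<dots> = (\<Sum>S\<in>?Ss. \<Sum>r\<in>S. ?c)"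
    by (intro sum.cong refl card_trees_given_cluster k) auto
  also have "\<dots> = (\<Sum>S\<in>?Ss. m * ?c)" by (intro sum.cong) auto
  also have "\<dots> = (k choose m) * (m * ?c)"
    using n_subsets[of "{1..k}" m] by simp
  finally show ?thesis using m by simp
qed

lemma pmf_R: "n \<ge> 1 \<Longrightarrow> pmf (R n k) m
    = real (card {t \<in> rooted_trees n. card (root_cluster k t) = m}) / real (n ^ (n - 1))"
proof -
  assume n: "n \<ge> 1"
  have "rooted_trees n \<inter> (\<lambda>t. card (root_cluster k t)) -` {m}
      = {t \<in> rooted_trees n. card (root_cluster k t) = m}" by auto
  thus ?thesis
    using n by (simp add: R_def pmf_map measure_pmf_of_set rooted_trees_nonempty
        finite_rooted_trees card_rooted_trees)
qed

lemma pmf_root_cluster: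
  assumes n: "n \<ge> 1" and k: "k \<le> n"
  shows "pmf (R n k) m =
          (if m = 0 then 1 - real k / real n
           else if m \<le> k \<and> k < n then
             real m ^ m * (real n - real k) * (real n - real m) powi (int k - int m - 1)
               / real n ^ k * real (k choose m)
           else if m = k \<and> k = n then 1
           else 0)"
proof -
  let ?N = "\<lambda>m. {t \<in> rooted_trees n. card (root_cluster k t) = m}"
  have npos: "real n > 0" using n by simp
  consider "m = 0" | "m > 0" "m \<le> k" "k < n" | "m > 0" "k = n" | "m > k" "k < n" using k by linarith
  thus ?thesis
  proof cases
    case 1
    have "?N 0 = {E. is_tree {1..n} E} \<times> {k<..n}"
    proof -
      have "card (root_cluster k (E, r)) = 0 \<longleftrightarrow> r \<notin> {1..k}" for E r
        by (auto simp: root_cluster_def)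
      thus ?thesis by (auto simp: rooted_trees_def)
    qed
    moreover have "card {E. is_tree {1..n} E} * n = n ^ (n - 1)"
      using card_trees_rooted_at[of 1 n] n by simp
    hence "real (card {E. is_tree {1..n} E}) * real n = real (n ^ (n - 1))"
      by (metis of_nat_mult)
    ultimately show ?thesis using 1 n k
      by (simp add: pmf_R card_cartesian_product of_nat_diff field_simps del: of_nat_power)
  next
    case 2
    have "real (card (?N m) * (n - m) * n)
        = real ((k choose m) * m ^ m * (n - k) * (n - m) ^ (k - m) * n ^ (n - k))"
      using card_trees_cluster_size[of k n m] 2 by simp
    hence eq: "real (card (?N m)) * (real n - real m) * real n
        = real (k choose m) * real m ^ m * (real n - real k) * (real n - real m) ^ (k - m) * real n ^ (n - k)"
      using 2 by (simp add: of_nat_diff)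
    have nm: "real n - real m > 0" using 2 by simp
    have "(real n - real m) powi (int k - int m - 1) = (real n - real m) ^ (k - m) / (real n - real m)"
      using nm 2 by (simp add: power_int_diff power_int_add flip: of_nat_diff)
    moreover have "real n ^ n = real n ^ k * real n ^ (n - k)" using 2 by (simp flip: power_add)
    moreover have "real n ^ n = real n ^ (n - 1) * real n" using n by (simp flip: power_Suc2)
    moreover have "real (card (?N m)) / real n ^ (n - 1) = real (k choose m) * real m ^ m * (real n - real k)
         * ((real n - real m) ^ (k - m) / (real n - real m)) / real n ^ k"
    proof -
      have "real (card (?N m)) * (real n - real m) * real n * real n ^ k
        = real (k choose m) * real m ^ m * (real n - real k) * (real n - real m) ^ (k - m) * (real n ^ (n - 1) * real n)"
        by (simp only: eq) (simp only: calculation(2)[symmetric] calculation(3)[symmetric] mult.assoc mult.commute[of "real n ^ (n - k)"])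
      hence "real n * (real (card (?N m)) * (real n - real m) * real n ^ k)
        = real n * (real (k choose m) * real m ^ m * (real n - real k) * (real n - real m) ^ (k - m) * real n ^ (n - 1))"
        by (simp only: ac_simps)
      hence "real (card (?N m)) * (real n - real m) * real n ^ k
        = real (k choose m) * real m ^ m * (real n - real k) * (real n - real m) ^ (k - m) * real n ^ (n - 1)"
        using npos by (subst (asm) mult_cancel_left) simp
      moreover have "a / b = x * y * z * (q / c) / d" if "a * c * d = x * y * z * q * b" "b > 0" "c > 0" "d > 0"
        for a b c d x y z q :: real
        using that by (simp add: divide_simps ac_simps)
      ultimately show ?thesis using nm npos by simp
    qed
    ultimately show ?thesis using 2 n by (simp add: pmf_R)
  next
    case 3
    have "root_cluster k t = {1..n}" if "t \<in> rooted_trees n" for t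
    proof -
      obtain E r where Er: "t = (E, r)" by (cases t)
      hence tree: "is_tree {1..n} E" "r \<in> {1..n}" using that by (auto simp: rooted_trees_def)
      hence "induced_edges E {1..n} = E" by (auto simp: induced_edges_def is_tree_def)
      thus ?thesis using tree by (auto simp: root_cluster_def Er 3 is_tree_def)
    qed
    hence "?N m = (if m = n then rooted_trees n else {})" by auto
    thus ?thesis using 3 n by (simp add: pmf_R card_rooted_trees)
  next
    case 4
    have "card (root_cluster k t) \<le> k" for t
    proof -
      have "root_cluster k t \<subseteq> {1..k}" by (auto simp: root_cluster_def split: prod.split)
      from card_mono[OF _ this] show ?thesis by simp
    qed
    hence "card (root_cluster k t) \<noteq> m" for t using 4 by (metis not_le)
    hence "?N m = {}" by simp
    hence "card (?N m) = 0" by (simp only: card.empty)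
    hence "pmf (R n k) m = 0" by (simp only: pmf_R[OF n] of_nat_0 div_0)
    thus ?thesis using 4 by auto
  qed
qed

section \<open>The power series of exp (d T)\<close>

unbundle fps_syntax

text \<open>
  The series $\sum_j d (d+j)^{j-1} z^j / j!$, which will turn out to be $e^{d T}$ for the tree function
  $T$.  The exponent $j - 1$ is written as a quotient so that $j = 0$ needs no special treatment.
\<close>

definition abel_fps :: "nat \<Rightarrow> 'a::field_char_0 fps" where
  "abel_fps d = Abs_fps (\<lambda>j. of_nat d * of_nat (d + j) ^ j / (of_nat (d + j) * fact j))"

definition tree_fps :: "'a::field_char_0 fps" where
  "tree_fps = fps_X * abel_fps 1"

lemma abel_fps_nth: "abel_fps d $ j = of_nat d * of_nat (d + j) ^ j / (of_nat (d + j) * fact j)"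
  by (simp add: abel_fps_def)

text \<open>
  The $N$-th finite difference of a polynomial of degree less than $N$ vanishes: up to a factorial the
  sum is the coefficient of $x^i$ in $e^{c x} (e^x - 1)^N$, which has a zero of order $N$.
\<close>

lemma alternating_binomial_sum_power:
  fixes c :: "'a::field_char_0"
  assumes "i < N"
  shows "(\<Sum>j\<le>N. of_nat (N choose j) * (- 1) ^ (N - j) * (c + of_nat j) ^ i) = 0"
proof -
  have "(fps_exp 1 - 1 :: 'a fps) ^ N = (\<Sum>j\<le>N. fps_const (of_nat (N choose j) * (- 1) ^ (N - j)) * fps_exp (of_nat j))"
  proof -
    have m1: "(- 1 :: 'a fps) ^ k = fps_const ((- 1) ^ k)" for k
      by (metis fps_const_1_eq_1 fps_const_neg fps_const_power)
    have "(fps_exp 1 + (- 1) :: 'a fps) ^ N = (\<Sum>j\<le>N. of_nat (N choose j) * fps_exp 1 ^ j * (- 1) ^ (N - j))"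
      by (rule binomial_ring)
    also have "\<dots> = (\<Sum>j\<le>N. fps_const (of_nat (N choose j) * (- 1) ^ (N - j)) * fps_exp (of_nat j))"
      by (intro sum.cong refl) (simp add: m1 fps_exp_power_mult fps_of_nat[symmetric] mult_ac flip: fps_const_mult)
    finally show ?thesis by simp
  qed
  hence "fps_exp c * (fps_exp 1 - 1) ^ N = (\<Sum>j\<le>N. fps_const (of_nat (N choose j) * (- 1) ^ (N - j)) * fps_exp (c + of_nat j))"
    by (simp add: sum_distrib_left fps_exp_add_mult mult_ac)
  hence "(fps_exp c * (fps_exp 1 - 1) ^ N) $ i = (\<Sum>j\<le>N. of_nat (N choose j) * (- 1) ^ (N - j) * (c + of_nat j) ^ i) / fact i"
    by (simp add: fps_sum_nth sum_divide_distrib)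
  moreover have "(fps_exp c * (fps_exp 1 - 1) ^ N) $ i = 0"
  proof -
    have "\<forall>k<N. ((fps_exp 1 - 1 :: 'a fps) ^ N) $ k = 0"
      by (rule startsby_zero_power_prefix) simp
    thus ?thesis using assms by (simp add: fps_mult_nth)
  qed
  ultimately show ?thesis by simp
qed

text \<open>
  Substituting $x e^{-x}$ and multiplying by $e^{-d x}$ gives
  $\sum_j d (d+j)^{j-1} x^j e^{-(d+j) x} / j!$.  After expanding the exponentials, the coefficient of
  $x^N$ is $d / N!$ times an $N$-th finite difference of the polynomial $y^{N-1}$, hence zero for
  $N \ge 1$.
\<close>

lemma abel_fps_compose:
  assumes d: "d > 0"
  shows "abel_fps d oo (fps_X * fps_exp (- 1)) = fps_exp (of_nat d :: 'a::field_char_0)"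
proof -
  define G :: "'a fps" where "G = fps_X * fps_exp (- 1)"
  have G0: "G $ 0 = 0" by (simp add: G_def)
  have "(abel_fps d oo G) * fps_exp (- of_nat d) = 1"
  proof (rule fps_ext)
    fix N
    \<comment> \<open>For the coefficient of order \<open>N\<close> the infinite composition may be cut off after \<open>N\<close> powers.\<close>
    define P :: "'a fps" where "P = (\<Sum>j\<le>N. fps_const (abel_fps d $ j) * G ^ j)"
    have "(abel_fps d oo G) $ i = P $ i" if "i \<le> N" for i
    proof -
      have "P $ i = (\<Sum>j\<le>N. abel_fps d $ j * (G ^ j $ i))"
        by (simp add: P_def fps_sum_nth)
      also have "\<dots> = (\<Sum>j\<in>{0..i}. abel_fps d $ j * (G ^ j $ i))"
        using that startsby_zero_power_prefix[OF G0]
        by (intro sum.mono_neutral_right) auto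
      finally show ?thesis by (simp add: fps_compose_nth)
    qed
    hence "((abel_fps d oo G) * fps_exp (- of_nat d)) $ N = (P * fps_exp (- of_nat d)) $ N"
      by (simp add: fps_mult_nth)
    also have "P * fps_exp (- of_nat d) = (\<Sum>j\<le>N. fps_const (abel_fps d $ j) * (fps_X ^ j * fps_exp (- of_nat (d + j))))"
      unfolding P_def sum_distrib_right
    proof (rule sum.cong)
      fix j
      have "G ^ j * fps_exp (- of_nat d) = fps_X ^ j * (fps_exp (- of_nat j) * fps_exp (- of_nat d))"
        by (simp add: G_def power_mult_distrib fps_exp_power_mult)
      also have "fps_exp (- of_nat j) * fps_exp (- of_nat d) = fps_exp (- of_nat (d + j) :: 'a)"
        by (simp flip: fps_exp_add_mult)
      finally show "fps_const (abel_fps d $ j) * G ^ j * fps_exp (- of_nat d)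
          = fps_const (abel_fps d $ j) * (fps_X ^ j * fps_exp (- of_nat (d + j)))"
        by (simp add: mult.assoc)
    qed simp
    also have "\<dots> $ N = (\<Sum>j\<le>N. abel_fps d $ j * ((- of_nat (d + j)) ^ (N - j) / fact (N - j)))"
      unfolding fps_sum_nth by (intro sum.cong refl) (simp add: fps_X_power_mult_nth)
    also have "\<dots> = (1 :: 'a fps) $ N"
    proof (cases "N = 0")
      case True
      thus ?thesis using d by (simp add: abel_fps_nth)
    next
      case False
      have "abel_fps d $ j * ((- of_nat (d + j)) ^ (N - j) / fact (N - j))
          = of_nat d / fact N * (of_nat (N choose j) * (- 1) ^ (N - j) * (of_nat d + of_nat j) ^ (N - 1) :: 'a)"
        if j: "j \<le> N" for j
      proof -
        have nz: "(of_nat (d + j) :: 'a) \<noteq> 0" using d by (simp flip: of_nat_add)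
        have "(of_nat (d + j) :: 'a) ^ j * of_nat (d + j) ^ (N - j) = of_nat (d + j) * of_nat (d + j) ^ (N - 1)"
          using j False by (simp flip: power_add power_Suc)
        hence pw: "(of_nat (d + j) :: 'a) ^ j * of_nat (d + j) ^ (N - j) / of_nat (d + j) = of_nat (d + j) ^ (N - 1)"
          using nz by (simp add: field_simps)
        have bin: "(of_nat (N choose j) :: 'a) = fact N / (fact j * fact (N - j))"
          using j by (simp add: binomial_fact)
        have "abel_fps d $ j * ((- of_nat (d + j)) ^ (N - j) / fact (N - j))
          = of_nat d * (- 1) ^ (N - j) * (of_nat (d + j) ^ j * of_nat (d + j) ^ (N - j) / of_nat (d + j)) / (fact j * fact (N - j) :: 'a)"
          unfolding abel_fps_nth power_minus[of "of_nat (d + j)"] by (simp add: field_simps)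
        also have "\<dots> = of_nat d / fact N * (of_nat (N choose j) * (- 1) ^ (N - j) * of_nat (d + j) ^ (N - 1))"
          unfolding pw bin by (simp add: field_simps)
        finally show ?thesis by simp
      qed
      hence "(\<Sum>j\<le>N. abel_fps d $ j * ((- of_nat (d + j)) ^ (N - j) / fact (N - j)))
          = of_nat d / fact N * (\<Sum>j\<le>N. of_nat (N choose j) * (- 1) ^ (N - j) * (of_nat d + of_nat j) ^ (N - 1) :: 'a)"
        unfolding sum_distrib_left by (intro sum.cong) auto
      also have "\<dots> = 0"
        using alternating_binomial_sum_power[of "N - 1" N "of_nat d :: 'a"] False by simp
      finally show ?thesis using False by simp
    qed
    finally show "((abel_fps d oo G) * fps_exp (- of_nat d)) $ N = (1 :: 'a fps) $ N" .
  qed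
  hence "(abel_fps d oo G) * (fps_exp (- of_nat d) * fps_exp (of_nat d)) = fps_exp (of_nat d)"
    by (simp add: mult.assoc[symmetric])
  moreover have "fps_exp (- of_nat d) * fps_exp (of_nat d) = (1 :: 'a fps)"
    by (simp flip: fps_exp_add_mult)
  ultimately show ?thesis by (simp add: G_def)
qed

text \<open>
  For $d = 1$ the previous lemma says that $T$ is the compositional inverse of $x e^{-x}$; composing it
  with $T$ gives the claim for every $d$.
\<close>

lemma abel_fps_eq_exp_compose:
  assumes d: "d > 0"
  shows "abel_fps d = fps_exp (of_nat d :: 'a::field_char_0) oo tree_fps"
proof -
  define G :: "'a fps" where "G = fps_X * fps_exp (- 1)"
  have G: "G $ 0 = 0" "G $ 1 \<noteq> 0" by (simp_all add: G_def)
  have I0: "fps_inv G $ 0 = 0" by (simp add: fps_inv_def)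
  have GI: "G oo fps_inv G = fps_X" by (rule fps_inv_right[OF G])
  have TG: "tree_fps oo G = fps_X"
  proof -
    have "tree_fps oo G = (fps_X oo G) * (abel_fps 1 oo G)"
      by (simp add: tree_fps_def fps_compose_mult_distrib[OF G(1)])
    also have "abel_fps 1 oo G = fps_exp 1" using abel_fps_compose[of 1, where 'a = 'a] by (simp add: G_def)
    also have "(fps_X oo G) * fps_exp 1 = fps_X * (fps_exp (- 1) * fps_exp 1)"
      using G by (simp add: G_def mult.assoc)
    also have "fps_exp (- 1) * fps_exp 1 = (1 :: 'a fps)" by (simp flip: fps_exp_add_mult)
    finally show ?thesis by simp
  qed
  have cancel: "F = (F oo G) oo fps_inv G" for F
    using fps_compose_assoc[OF I0 G(1), of F] GI by simp
  have "tree_fps = fps_inv G"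
    using cancel[of tree_fps] TG I0 by simp
  thus ?thesis
    using cancel[of "abel_fps d"] abel_fps_compose[OF d, where 'a = 'a] by (simp add: G_def)
qed

lemma fps_deriv_abel:
  assumes "d > 0"
  shows "fps_deriv (abel_fps d) = fps_const (of_nat d :: 'a::field_char_0) * abel_fps d * fps_deriv tree_fps"
proof -
  have "tree_fps $ 0 = (0 :: 'a)" by (simp add: tree_fps_def)
  from fps_compose_deriv[OF this, of "fps_exp (of_nat d)"] this show ?thesis
    by (simp add: abel_fps_eq_exp_compose[OF assms] fps_compose_mult_distrib)
qed

text \<open>
  Differentiating $T = z e^T$ gives $z T' = T + T \cdot z T'$.  The coefficients of $1 + z T'$ are
  $m^m / m!$, so this evaluates the generating function of the limit law for $k \sim \alpha n$.
\<close>

lemma tree_fps_deriv_identity: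
  "(1 + fps_X * fps_deriv tree_fps) * (1 - tree_fps) = (1 :: 'a::field_char_0 fps)"
proof -
  let ?T = "tree_fps :: 'a fps"
  have "fps_deriv ?T = abel_fps 1 + fps_X * fps_deriv (abel_fps 1)"
    by (simp add: tree_fps_def add.commute)
  also have "\<dots> = abel_fps 1 + (fps_X * abel_fps 1) * fps_deriv ?T"
    by (subst fps_deriv_abel) (simp_all add: mult.assoc)
  finally have "fps_deriv ?T = abel_fps 1 + ?T * fps_deriv ?T" by (simp only: tree_fps_def)
  hence "fps_X * (fps_deriv ?T - ?T * fps_deriv ?T) = fps_X * abel_fps 1"
    by (metis add_diff_cancel_right')
  also have "fps_X * abel_fps 1 = ?T" by (simp only: tree_fps_def)
  finally have T: "fps_X * fps_deriv ?T - fps_X * fps_deriv ?T * ?T = ?T"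
    by (simp only: right_diff_distrib mult_ac)
  have "(1 + fps_X * fps_deriv ?T) * (1 - ?T) = 1 - ?T + (fps_X * fps_deriv ?T - fps_X * fps_deriv ?T * ?T)"
    by (simp add: algebra_simps)
  thus ?thesis unfolding T by simp
qed

section \<open>The tree function on the closed disc of radius 1/e\<close>

lemma power_div_fact_le_exp:
  assumes "(x::real) \<ge> 0"
  shows "x ^ n / fact n \<le> exp x"
proof -
  have s: "(\<lambda>i. x ^ i / fact i) sums exp x"
    using exp_converges[of x] by (simp add: field_simps)
  have "(\<Sum>i\<in>{n}. x ^ i / fact i) \<le> (\<Sum>i. x ^ i / fact i)"
    by (intro sum_le_suminf sums_summable[OF s]) (use assms in auto)
  thus ?thesis by (simp add: sums_unique[OF s, symmetric])
qed

lemma abel_fps_nonneg: "abel_fps d $ j \<ge> (0::real)"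
  by (simp add: abel_fps_nth)

text \<open>
  Since $(d+j)^j / j! \le e^{d+j}$, this gives convergence on the open disc of radius $1/e$ without
  Stirling's formula.
\<close>

lemma abel_fps_le: "abel_fps d $ j \<le> exp (real d) * exp (real j)"
proof -
  have "abel_fps d $ j = real d / real (d + j) * (real (d + j) ^ j / fact j)"
    by (simp add: abel_fps_nth)
  also have "\<dots> \<le> 1 * exp (real (d + j))"
    by (intro mult_mono power_div_fact_le_exp) (auto simp: divide_le_eq_1)
  finally show ?thesis by (simp add: exp_add)
qed

lemma norm_abel_fps: "norm (abel_fps d $ j :: 'a::{banach, real_normed_field}) = abel_fps d $ j"
proof -
  have "(abel_fps d $ j :: 'a) = of_real (abel_fps d $ j)"
    by (simp add: abel_fps_nth)
  thus ?thesis using abel_fps_nonneg[of d j] by (simp del: of_real_divide of_real_mult)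
qed

lemma abel_fps_conv_radius:
  "fps_conv_radius (abel_fps d :: 'a::{banach, real_normed_field} fps) \<ge> ereal (exp (- 1))"
  unfolding fps_conv_radius_def
proof (rule conv_radius_geI_ex')
  fix r :: real assume r: "0 < r" "ereal r < ereal (exp (- 1))"
  have "summable (\<lambda>j. exp (real d) * (exp 1 * r) ^ j)"
    using r by (intro summable_mult summable_geometric) (simp add: exp_minus field_simps)
  thus "summable (\<lambda>j. abel_fps d $ j * (of_real r :: 'a) ^ j)"
  proof (rule summable_comparison_test'[where N = 0])
    fix j :: nat
    have "norm (abel_fps d $ j * (of_real r :: 'a) ^ j) = abel_fps d $ j * r ^ j"
      using r by (simp add: norm_mult norm_power norm_abel_fps)
    also have "\<dots> \<le> exp (real d) * exp (real j) * r ^ j"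
      using r by (intro mult_right_mono abel_fps_le) auto
    also have "exp (real j) = exp 1 ^ j" by (simp flip: exp_of_nat_mult)
    finally show "norm (abel_fps d $ j * (of_real r :: 'a) ^ j) \<le> exp (real d) * (exp 1 * r) ^ j"
      by (simp add: power_mult_distrib mult.assoc)
  qed
qed

lemma tree_fps_conv_radius:
  "fps_conv_radius (tree_fps :: 'a::{banach, real_normed_field} fps) \<ge> ereal (exp (- 1))"
proof -
  have "min (fps_conv_radius (fps_X :: 'a fps)) (fps_conv_radius (abel_fps 1 :: 'a fps)) \<ge> ereal (exp (- 1))"
    using abel_fps_conv_radius[of 1] by simp
  thus ?thesis unfolding tree_fps_def using fps_conv_radius_mult order.trans by blast
qed

lemma norm_less_conv_radius:
  assumes "norm (z :: 'a::{banach, real_normed_field}) < exp (- 1)"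
  shows "ereal (norm z) < fps_conv_radius (abel_fps d :: 'a fps)"
        "ereal (norm z) < fps_conv_radius (tree_fps :: 'a fps)"
        "ereal (norm z) < fps_conv_radius (fps_deriv tree_fps :: 'a fps)"
proof -
  have z: "ereal (norm z) < ereal (exp (- 1))" using assms by simp
  show "ereal (norm z) < fps_conv_radius (abel_fps d :: 'a fps)"
    using z abel_fps_conv_radius by (rule less_le_trans)
  show T: "ereal (norm z) < fps_conv_radius (tree_fps :: 'a fps)"
    using z tree_fps_conv_radius by (rule less_le_trans)
  show "ereal (norm z) < fps_conv_radius (fps_deriv tree_fps :: 'a fps)"
    using T fps_conv_radius_deriv by (rule less_le_trans)
qed

lemma eval_tree_fps:
  assumes "norm (z :: 'a::{banach, real_normed_field}) < exp (- 1)"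
  shows "eval_fps tree_fps z = z * eval_fps (abel_fps 1) z"
  unfolding tree_fps_def using norm_less_conv_radius(1)[OF assms] by (subst eval_fps_mult) simp_all

text \<open>
  The formal identity $E_d' = d\,T' E_d$ makes $E_d e^{-d T}$ constant; this avoids justifying the
  analytic evaluation of a composition of power series.
\<close>

lemma eval_abel_fps:
  assumes d: "d > 0" and z: "norm (z :: 'a::{banach, real_normed_field}) < exp (- 1)"
  shows "eval_fps (abel_fps d) z = exp (of_nat d * eval_fps tree_fps z)"
proof -
  let ?h = "\<lambda>z :: 'a. eval_fps (abel_fps d) z * exp (- (of_nat d * eval_fps tree_fps z))"
  have "(?h has_field_derivative 0) (at u within ball 0 (exp (- 1)))" if "u \<in> ball 0 (exp (- 1))" for u
  proof -
    have u: "norm u < exp (- 1)" using that by simp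
    note conv = norm_less_conv_radius[OF u]
    note [derivative_intros] = has_field_derivative_eval_fps[OF conv(1)] has_field_derivative_eval_fps[OF conv(2)]
    have "eval_fps (fps_deriv (abel_fps d)) u = of_nat d * eval_fps (abel_fps d) u * eval_fps (fps_deriv tree_fps) u"
    proof -
      have "ereal (norm u) < fps_conv_radius (fps_const (of_nat d) * abel_fps d :: 'a fps)"
        using conv(1) fps_conv_radius_mult[of "fps_const (of_nat d)" "abel_fps d :: 'a fps"]
        by (auto intro: less_le_trans)
      thus ?thesis unfolding fps_deriv_abel[OF d] using conv
        by (simp add: eval_fps_mult)
    qed
    thus ?thesis by (auto intro!: derivative_eq_intros simp: algebra_simps)
  qed
  hence "\<exists>c. \<forall>u\<in>ball 0 (exp (- 1)). ?h u = c"
    by (intro has_field_derivative_zero_constant) auto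
  then obtain c where c: "\<And>u. norm u < exp (- 1) \<Longrightarrow> ?h u = c" by auto
  have "c = 1" using c[of 0] d by (simp add: eval_fps_at_0 abel_fps_nth tree_fps_def)
  hence "?h z = 1" using c[OF z] by simp
  thus ?thesis by (simp add: exp_minus field_simps)
qed

lemma eval_tree_fps_identity:
  assumes z: "norm (z :: 'a::{banach, real_normed_field}) < exp (- 1)"
  shows "(1 + z * eval_fps (fps_deriv tree_fps) z) * (1 - eval_fps tree_fps z) = 1"
proof -
  note conv = norm_less_conv_radius[OF z]
  have a: "ereal (norm z) < fps_conv_radius (fps_X * fps_deriv tree_fps :: 'a fps)"
    using conv(3) fps_conv_radius_mult[of fps_X "fps_deriv tree_fps :: 'a fps"]
    by (auto intro: less_le_trans)
  have b: "ereal (norm z) < fps_conv_radius (1 + fps_X * fps_deriv tree_fps :: 'a fps)"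
    using a fps_conv_radius_add[of 1 "fps_X * fps_deriv tree_fps :: 'a fps"]
    by (auto intro: less_le_trans)
  have c: "ereal (norm z) < fps_conv_radius (1 - tree_fps :: 'a fps)"
    using conv(2) fps_conv_radius_diff[of 1 "tree_fps :: 'a fps"]
    by (auto intro: less_le_trans)
  have "eval_fps ((1 + fps_X * fps_deriv tree_fps) * (1 - tree_fps)) z = 1"
    by (simp add: tree_fps_deriv_identity)
  thus ?thesis
    using a b c conv by (simp add: eval_fps_mult eval_fps_add eval_fps_diff)
qed

text \<open>
  For real $r$ the first factor of $(1 + r T'(r)) (1 - T(r)) = 1$ is positive, hence so is the second.
\<close>

lemma eval_tree_fps_less_1:
  assumes r: "0 \<le> r" "r < exp (- 1)"
  shows "0 \<le> eval_fps tree_fps r" "eval_fps tree_fps r < (1::real)"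
proof -
  have z: "norm r < exp (- 1)" using r by simp
  have pos: "eval_fps F r \<ge> 0" if "\<And>i. F $ i \<ge> 0" "ereal (norm r) < fps_conv_radius F" for F :: "real fps"
    unfolding eval_fps_def using that r by (intro suminf_nonneg summable_fps) auto
  have T0: "tree_fps $ i \<ge> (0::real)" for i
    using abel_fps_nonneg by (auto simp: tree_fps_def)
  show "0 \<le> eval_fps tree_fps r"
    using pos[OF T0 norm_less_conv_radius(2)[OF z]] .
  have "0 \<le> eval_fps (fps_deriv tree_fps) r"
    by (intro pos norm_less_conv_radius(3)[OF z]) (use T0 in auto)
  hence "1 + r * eval_fps (fps_deriv tree_fps) r > 0" using r by (simp add: add_pos_nonneg)
  moreover have "(1 + r * eval_fps (fps_deriv tree_fps) r) * (1 - eval_fps tree_fps r) > 0"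
    using eval_tree_fps_identity[OF z] by simp
  ultimately show "eval_fps tree_fps r < (1::real)"
    by (simp add: zero_less_mult_iff)
qed

text \<open>
  By the previous bound the partial sums stay below $e^d$ for all $r < 1/e$, hence also at $r = 1/e$.
  Together with the uniform convergence it implies, this carries $E_d = e^{d T}$ to the boundary
  circle, as is needed for the generating function of the limit law for fixed $d$.
\<close>

lemma summable_abel_boundary:
  assumes d: "d > 0"
  shows "summable (\<lambda>j. abel_fps d $ j * exp (- 1) ^ j :: real)"
proof (rule summableI_nonneg_bounded[where x = "exp (real d)"])
  show "0 \<le> (abel_fps d $ j * exp (- 1) ^ j :: real)" for j using abel_fps_nonneg by simp
  fix N
  have "((\<lambda>r. \<Sum>j<N. abel_fps d $ j * r ^ j :: real) \<longlongrightarrow> (\<Sum>j<N. abel_fps d $ j * exp (- 1) ^ j)) (at_left (exp (- 1)))"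
    by (intro tendsto_intros)
  moreover have "\<forall>\<^sub>F r in at_left (exp (- 1 :: real)). (\<Sum>j<N. abel_fps d $ j * r ^ j) \<le> exp (real d)"
  proof -
    have "\<forall>\<^sub>F r in at_left (exp (- 1 :: real)). r \<in> {0<..<exp (- 1)}"
      by (rule eventually_at_left_real) simp
    thus ?thesis
    proof eventually_elim
      case (elim r)
      hence z: "norm r < exp (- 1)" by simp
      have "(\<Sum>j<N. abel_fps d $ j * r ^ j) \<le> eval_fps (abel_fps d) r"
        unfolding eval_fps_def using elim abel_fps_nonneg norm_less_conv_radius(1)[OF z]
        by (intro sum_le_suminf summable_fps) auto
      also have "\<dots> = exp (real d * eval_fps tree_fps r)"
        by (rule eval_abel_fps[OF d z])
      also have "\<dots> \<le> exp (real d)"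
        using eval_tree_fps_less_1[of r] elim by (simp add: mult_left_le)
      finally show ?case .
    qed
  qed
  ultimately show "(\<Sum>j<N. abel_fps d $ j * exp (- 1) ^ j) \<le> exp (real d)"
    by (intro tendsto_upperbound) auto
qed

text \<open>
  The same sum as \<^const>\<open>eval_fps\<close>, under a name of its own because it is used on the boundary circle,
  outside the open disc of convergence.
\<close>

definition abel_sum :: "nat \<Rightarrow> 'a \<Rightarrow> 'a::{banach, real_normed_field}" where
  "abel_sum d z = (\<Sum>j. abel_fps d $ j * z ^ j)"

lemma norm_abel_term_le:
  assumes "norm (z :: 'a::{banach, real_normed_field}) \<le> exp (- 1)"
  shows "norm (abel_fps d $ j * z ^ j) \<le> abel_fps d $ j * exp (- 1) ^ j"
  using assms abel_fps_nonneg[of d j]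
  by (simp add: norm_mult norm_power norm_abel_fps mult_left_mono power_mono)

lemma abel_sum_sums:
  assumes "d > 0" "norm (z :: 'a::{banach, real_normed_field}) \<le> exp (- 1)"
  shows "(\<lambda>j. abel_fps d $ j * z ^ j) sums abel_sum d z"
  unfolding abel_sum_def
  by (intro summable_sums summable_comparison_test'[OF summable_abel_boundary[OF assms(1)]]
      norm_abel_term_le assms(2))

lemma continuous_on_abel_sum:
  assumes "d > 0"
  shows "continuous_on (cball 0 (exp (- 1))) (abel_sum d :: 'a::{banach, real_normed_field} \<Rightarrow> 'a)"
proof -
  have "uniform_limit (cball 0 (exp (- 1))) (\<lambda>N z. \<Sum>j<N. abel_fps d $ j * z ^ j)
      (abel_sum d :: 'a \<Rightarrow> 'a) sequentially"
    unfolding abel_sum_def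
    by (rule Weierstrass_m_test[OF _ summable_abel_boundary[OF assms]]) (simp add: norm_abel_term_le)
  moreover have "\<forall>\<^sub>F N in sequentially. continuous_on (cball 0 (exp (- 1))) (\<lambda>z :: 'a. \<Sum>j<N. abel_fps d $ j * z ^ j)"
    by (intro always_eventually allI continuous_intros)
  ultimately show ?thesis
    using uniform_limit_theorem trivial_limit_sequentially by metis
qed

lemma abel_sum_eq_exp:
  assumes d: "d > 0" and z: "norm (z :: 'a::{banach, real_normed_field}) \<le> exp (- 1)"
  shows "abel_sum d z = exp (of_nat d * (z * abel_sum 1 z))"
proof -
  have cl: "closure (ball 0 (exp (- 1))) = (cball 0 (exp (- 1)) :: 'a set)"
    by (rule closure_ball) simp
  let ?f = "\<lambda>z :: 'a. abel_sum d z - exp (of_nat d * (z * abel_sum 1 z))"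
  have "continuous_on (cball 0 (exp (- 1))) (abel_sum d :: 'a \<Rightarrow> 'a)"
    "continuous_on (cball 0 (exp (- 1))) (abel_sum 1 :: 'a \<Rightarrow> 'a)"
    by (rule continuous_on_abel_sum, use d in simp)+
  hence "continuous_on (closure (ball 0 (exp (- 1)))) ?f"
    unfolding cl by (intro continuous_on_diff continuous_on_exp continuous_on_mult
        continuous_on_const continuous_on_id)
  moreover have "?f u = 0" if "u \<in> ball 0 (exp (- 1))" for u
  proof -
    from that have u: "norm u < exp (- 1)" by simp
    from eval_abel_fps[OF d u] eval_tree_fps[OF u] show ?thesis
      by (simp add: abel_sum_def eval_fps_def)
  qed
  moreover have "z \<in> closure (ball 0 (exp (- 1)))" using z cl by simp
  ultimately have "?f z = 0" by (rule continuous_constant_on_closure[where f = ?f])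
  thus ?thesis by simp
qed

lemma cayley_T_eq:
  assumes "norm z \<le> exp (- 1)"
  shows "cayley_T z = z * abel_sum 1 z"
proof -
  have "(\<lambda>j. z * (abel_fps 1 $ j * z ^ j)) sums (z * abel_sum 1 z)"
    by (intro sums_mult abel_sum_sums assms) simp
  also have "(\<lambda>j. z * (abel_fps 1 $ j * z ^ j)) = (\<lambda>n. of_nat (Suc n ^ n) / fact (Suc n) * z ^ Suc n)"
    by (simp add: abel_fps_nth mult_ac)
  finally show ?thesis by (simp add: cayley_T_def sums_iff)
qed

lemma cayley_T_of_real:
  assumes "\<bar>x\<bar> \<le> exp (- 1)"
  shows "cayley_T (of_real x) = of_real (x * abel_sum 1 x)"
proof -
  have "(\<lambda>j. complex_of_real (abel_fps 1 $ j * x ^ j)) sums of_real (abel_sum 1 x)"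
    using assms by (intro sums_of_real abel_sum_sums) auto
  hence "abel_sum 1 (complex_of_real x) = of_real (abel_sum 1 x)"
    by (simp add: abel_sum_def abel_fps_nth sums_iff)
  thus ?thesis using assms by (simp add: cayley_T_eq)
qed

text \<open>
  $t = T(1/e)$ satisfies $t = e^{t-1}$, that is $\ln t = t - 1$, and tangency leaves only $t = 1$.
\<close>

lemma cayley_T_boundary: "cayley_T (of_real (exp (- 1))) = 1"
proof -
  define t :: real where "t = exp (- 1) * abel_sum 1 (exp (- 1))"
  have "t = exp (- 1) * exp t"
    using abel_sum_eq_exp[of 1 "exp (- 1) :: real"] by (simp add: t_def)
  hence t: "t = exp (t - 1)" by (simp add: exp_diff exp_minus field_simps)
  hence "t > 0" by (metis exp_gt_zero)
  moreover have "ln t = t - 1" by (subst t) simp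
  ultimately have "t = 1" by (rule ln_eq_minus_one)
  thus ?thesis using cayley_T_of_real[of "exp (- 1)"] by (simp add: t_def)
qed

lemma mult_exp_neg_less:
  assumes "(0::real) < \<alpha>" "\<alpha> < 1"
  shows "\<alpha> * exp (- \<alpha>) < exp (- 1)"
proof -
  have "ln \<alpha> \<noteq> \<alpha> - 1" using ln_eq_minus_one[of \<alpha>] assms by auto
  hence "ln \<alpha> < \<alpha> - 1" using ln_le_minus_one[of \<alpha>] assms by linarith
  hence "exp (ln \<alpha>) < exp (\<alpha> - 1)" by simp
  hence "\<alpha> * exp (- \<alpha>) < exp (\<alpha> - 1) * exp (- \<alpha>)" using assms by simp
  thus ?thesis by (simp flip: exp_add)
qed

lemma ln_minus_id_inj:
  assumes "(0::real) < a" "a \<le> b" "b < 1" "ln b - b = ln a - a"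
  shows "a = b"
proof (rule ccontr)
  assume "a \<noteq> b"
  hence ab: "a < b" using assms by simp
  have "ln (a / b) \<le> a / b - 1" using assms by (intro ln_le_minus_one) auto
  moreover have "ln (a / b) = a - b" using assms by (simp add: ln_div)
  ultimately have "(b - a) / b \<le> b - a" using assms by (simp add: field_simps)
  moreover have "(b - a) * 1 < (b - a) * (1 / b)" using ab assms by (intro mult_strict_left_mono) auto
  ultimately show False by simp
qed

text \<open>
  Both $T(\alpha e^{-\alpha})$ and $\alpha$ solve $t e^{-t} = \alpha e^{-\alpha}$ with $t < 1$, where
  $t e^{-t}$ is injective.
\<close>

lemma cayley_T_mult_exp_neg:
  assumes a: "0 < \<alpha>" "\<alpha> < 1"
  shows "cayley_T (of_real (\<alpha> * exp (- \<alpha>))) = of_real \<alpha>"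
proof -
  define x where "x = \<alpha> * exp (- \<alpha>)"
  have x: "0 < x" "x < exp (- 1)" using a mult_exp_neg_less by (auto simp: x_def)
  define t :: real where "t = x * abel_sum 1 x"
  have "t = eval_fps tree_fps x"
    using eval_tree_fps[of x] x by (simp add: t_def abel_sum_def eval_fps_def)
  hence t1: "t < 1" using eval_tree_fps_less_1[of x] x by simp
  have te: "t = x * exp t" using abel_sum_eq_exp[of 1 x] x by (simp add: t_def)
  hence t0: "t > 0" using x by (metis exp_gt_zero mult_pos_pos)
  have "ln t = ln x + t" using x by (subst te) (simp add: ln_mult)
  moreover have "ln x = ln \<alpha> - \<alpha>" using a by (simp add: x_def ln_mult)
  ultimately have eq: "ln t - t = ln \<alpha> - \<alpha>" by simp
  have "t = \<alpha>"
    using ln_minus_id_inj[of t \<alpha>] ln_minus_id_inj[of \<alpha> t] eq t0 t1 a by linarith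
  moreover have "\<bar>x\<bar> \<le> exp (- 1)" using x by simp
  ultimately show ?thesis using cayley_T_of_real[of x] unfolding x_def[symmetric] t_def[symmetric] by simp
qed

lemma sums_power_self_div_fact:
  assumes z: "norm (z::complex) < exp (- 1)"
  shows "(\<lambda>m. of_nat (m ^ m) / fact m * z ^ m) sums (1 / (1 - cayley_T z))"
proof -
  let ?F = "1 + fps_X * fps_deriv tree_fps :: complex fps"
  note conv = norm_less_conv_radius[OF z]
  have a: "ereal (norm z) < fps_conv_radius (fps_X * fps_deriv tree_fps :: complex fps)"
    using conv(3) fps_conv_radius_mult[of fps_X "fps_deriv tree_fps :: complex fps"]
    by (auto intro: less_le_trans)
  have b: "ereal (norm z) < fps_conv_radius ?F"
    using a fps_conv_radius_add[of 1 "fps_X * fps_deriv tree_fps :: complex fps"]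
    by (auto intro: less_le_trans)
  have "eval_fps ?F z = 1 + z * eval_fps (fps_deriv tree_fps) z"
    using a conv by (simp add: eval_fps_add eval_fps_mult)
  moreover have "eval_fps tree_fps z = cayley_T z"
    using eval_tree_fps[OF z] cayley_T_eq[of z] z by (simp add: abel_sum_def eval_fps_def)
  ultimately have "eval_fps ?F z * (1 - cayley_T z) = 1"
    using eval_tree_fps_identity[OF z] by simp
  hence "eval_fps ?F z = 1 / (1 - cayley_T z)"
    by (metis mult_zero_right nonzero_eq_divide_eq zero_neq_one)
  moreover have "?F $ m = of_nat (m ^ m) / fact m" for m
  proof (cases m)
    case (Suc j)
    have "?F $ m = of_nat m * abel_fps 1 $ j"
      by (simp add: Suc tree_fps_def algebra_simps)
    also have "\<dots> = of_nat m * (of_nat m ^ j / fact m)"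
      by (simp add: Suc abel_fps_nth)
    also have "\<dots> = of_nat (m ^ m) / fact m"
    proof -
      have "m ^ m = m * m ^ j" by (simp add: Suc)
      thus ?thesis by (simp only: of_nat_mult of_nat_power times_divide_eq_right)
    qed
    finally show ?thesis .
  qed simp
  moreover have "(\<lambda>m. ?F $ m * z ^ m) sums eval_fps ?F z" by (rule sums_eval_fps[OF b])
  ultimately show ?thesis by (simp only:)
qed

section \<open>The two discrete limit laws\<close>

lemma pmf_of_sums_1:
  assumes "\<And>i. f i \<ge> 0" "f sums (1::real)"
  shows "\<exists>p :: nat pmf. \<forall>i. pmf p i = f i"
proof -
  have "(\<integral>\<^sup>+ i. ennreal (f i) \<partial>count_space UNIV) = 1"
    unfolding nn_integral_count_space_nat using suminf_ennreal_eq[OF assms] by (simp only: ennreal_1)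
  thus ?thesis using pmf_embed_pmf[of f] assms(1) by blast
qed

lemma subcritical_pmf_exists:
  assumes a: "0 < \<alpha>" "\<alpha> < 1"
  shows "\<exists>p :: nat pmf. (\<forall>m. pmf p m =
              (if m = 0 then 1 - \<alpha>
               else real m ^ m / fact m * (1 - \<alpha>) * \<alpha> ^ m * exp (- \<alpha> * real m))) \<and>
           (\<forall>v :: complex. norm v \<le> 1 \<longrightarrow>
              (\<lambda>m. of_real (pmf p m) * v ^ m) sums
                ((1 - of_real \<alpha>) / (1 - cayley_T (v * of_real (\<alpha> * exp (- \<alpha>))))))"
proof -
  define x where "x = \<alpha> * exp (- \<alpha>)"
  have x: "0 < x" "x < exp (- 1)" using a mult_exp_neg_less by (auto simp: x_def)
  define f where "f m = (1 - \<alpha>) * (real m ^ m / fact m * x ^ m)" for m :: nat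
  have f_eq: "f m = (if m = 0 then 1 - \<alpha>
               else real m ^ m / fact m * (1 - \<alpha>) * \<alpha> ^ m * exp (- \<alpha> * real m))" for m
  proof -
    have "exp (- \<alpha>) ^ m = exp (- \<alpha> * real m)" by (simp add: mult.commute flip: exp_of_nat_mult)
    thus ?thesis by (simp add: f_def x_def power_mult_distrib)
  qed
  have gf: "(\<lambda>m. of_real (f m) * v ^ m) sums ((1 - of_real \<alpha>) / (1 - cayley_T (v * of_real x)))"
    if v: "norm v \<le> 1" for v :: complex
  proof -
    have "norm (v * of_real x) \<le> x" using v x by (simp add: norm_mult mult_left_le_one_le)
    hence "norm (v * of_real x) < exp (- 1)" using x by linarith
    from sums_mult[OF sums_power_self_div_fact[OF this], of "1 - of_real \<alpha>"]
    show ?thesis by (simp add: f_def power_mult_distrib mult_ac)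
  qed
  have "(\<lambda>m. complex_of_real (f m)) sums 1"
    using gf[of 1] cayley_T_mult_exp_neg[OF a] a by (simp add: x_def)
  hence "f sums 1" by (metis of_real_1 sums_of_real_iff)
  moreover have "f m \<ge> 0" for m using a x by (simp add: f_def)
  ultimately obtain p :: "nat pmf" where "\<forall>m. pmf p m = f m" using pmf_of_sums_1 by blast
  thus ?thesis using gf f_eq by (intro exI[of _ p]) (simp add: x_def)
qed

lemma borel_pmf_exists:
  assumes d: "d > 0"
  shows "\<exists>D :: nat pmf.
           (\<forall>j. pmf D j =
              exp (- real d) * (real d * real (d + j) powi (int j - 1) / fact j)
                * exp (- real j)) \<and>
           (\<forall>v :: complex. norm v \<le> 1 \<longrightarrow>
              (\<lambda>j. of_real (pmf D j) * v ^ j) sums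
                exp (of_nat d * (cayley_T (v / of_real (exp 1)) - 1)))"
proof -
  define f where "f j = exp (- real d) * (abel_fps d $ j * exp (- 1) ^ j)" for j :: nat
  have f_eq: "f j = exp (- real d) * (real d * real (d + j) powi (int j - 1) / fact j) * exp (- real j)" for j
  proof -
    have "real (d + j) powi (int j - 1) = real (d + j) ^ j / real (d + j)"
      using d by (simp add: power_int_diff)
    moreover have "exp (- 1 :: real) ^ j = exp (- real j)" by (simp flip: exp_of_nat_mult)
    ultimately show ?thesis by (simp add: f_def abel_fps_nth)
  qed
  have gf: "(\<lambda>j. of_real (f j) * v ^ j) sums exp (of_nat d * (cayley_T (v / of_real (exp 1)) - 1))"
    if v: "norm v \<le> 1" for v :: complex
  proof -
    let ?z = "v / of_real (exp 1)"
    have "norm ?z \<le> exp (- 1)" using v by (simp add: norm_divide exp_minus divide_simps)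
    hence "(\<lambda>j. exp (- of_nat d) * (abel_fps d $ j * ?z ^ j)) sums (exp (- of_nat d) * exp (of_nat d * cayley_T ?z))"
      using d by (intro sums_mult) (metis abel_sum_sums abel_sum_eq_exp cayley_T_eq)
    moreover have "exp (- of_nat d) * exp (of_nat d * cayley_T ?z) = exp (of_nat d * (cayley_T ?z - 1))"
      by (simp add: algebra_simps flip: exp_add)
    moreover have "of_real (f j) * v ^ j = exp (- of_nat d) * (abel_fps d $ j * ?z ^ j)" for j
    proof -
      have "complex_of_real (exp (- real d)) = exp (- of_nat d)"
        by (simp flip: exp_of_real)
      thus ?thesis
        by (simp add: f_def abel_fps_nth power_divide exp_minus field_simps)
    qed
    ultimately show ?thesis by simp
  qed
  have "(\<lambda>j. complex_of_real (f j)) sums 1"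
  proof -
    have "cayley_T (1 / of_real (exp 1)) = 1"
      using cayley_T_boundary by (simp add: exp_minus inverse_eq_divide)
    thus ?thesis using gf[of 1] by simp
  qed
  hence "f sums 1" by (metis of_real_1 sums_of_real_iff)
  moreover have "f j \<ge> 0" for j using abel_fps_nonneg[of d j] by (simp add: f_def)
  ultimately obtain D :: "nat pmf" where "\<forall>j. pmf D j = f j" using pmf_of_sums_1 by blast
  thus ?thesis using gf f_eq by (intro exI[of _ D]) simp
qed

section \<open>Stirling's formula\<close>

definition stirling_approx :: "nat \<Rightarrow> real" where
  "stirling_approx n = sqrt (2 * pi * real n) * (real n / exp 1) ^ n"

text \<open>
  The logarithm of the quotient changes by $O(1/n^2)$ from $n$ to $n + 1$, so it converges.
\<close>

lemma fact_over_sqrt_power_convergent: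
  obtains C where "C > 0" "(\<lambda>n. fact n / (sqrt (real n) * (real n / exp 1) ^ n)) \<longlonglongrightarrow> C"
proof -
  define a :: "nat \<Rightarrow> real" where
    "a n = ln (fact (Suc n)) - (real (Suc n) + 1/2) * ln (real (Suc n)) + real (Suc n)" for n
  have diff: "a (Suc n) - a n = 1 - (real (Suc n) + 1/2) * ln (1 + 1 / real (Suc n))" for n
  proof -
    have h1: "ln (fact (Suc (Suc n)) :: real) = ln (real (Suc (Suc n))) + ln (fact (Suc n))"
      by (subst fact_Suc, subst ln_mult) auto
    have "1 + 1 / real (Suc n) = real (Suc (Suc n)) / real (Suc n)"
      by (simp add: field_simps)
    hence h3: "ln (1 + 1 / real (Suc n)) = ln (real (Suc (Suc n))) - ln (real (Suc n))"
      by (simp add: ln_div)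
    have alg: "lf' - (y + 1/2) * ly + y - (lf - (x + 1/2) * lx + x) = 1 - (x + 1/2) * l"
      if "lf' = ly + lf" "y = x + 1" "l = ly - lx" for lf lf' x y l lx ly :: real
      by (simp add: that field_simps)
    show ?thesis unfolding a_def by (rule alg[OF h1 _ h3]) simp
  qed
  have "(\<lambda>n. a (Suc n) - a n) \<in> O(\<lambda>n. 1 / real (Suc n) ^ 2)"
    unfolding diff by real_asymp
  moreover have "summable (\<lambda>n. norm (1 / real (Suc n) ^ 2))"
    using inverse_power_summable[of 2, where 'a = real]
    by (subst summable_Suc_iff) (simp add: inverse_eq_divide)
  ultimately have "summable (\<lambda>n. a (Suc n) - a n)"
    by (rule summable_comparison_test_bigo[rotated])
  hence "convergent (\<lambda>N. \<Sum>n<N. a (Suc n) - a n)" by (simp add: summable_iff_convergent)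
  hence "convergent (\<lambda>N. a N - a 0)" by (simp add: sum_lessThan_telescope)
  then obtain l where "(\<lambda>N. a N - a 0) \<longlonglongrightarrow> l" by (auto simp: convergent_def)
  from tendsto_add[OF this tendsto_const[of "a 0"]]
  have "(\<lambda>n. exp (a n)) \<longlonglongrightarrow> exp (l + a 0)" by (intro tendsto_exp) simp
  also have "(\<lambda>n. exp (a n)) = (\<lambda>n. fact (Suc n) / (sqrt (real (Suc n)) * (real (Suc n) / exp 1) ^ Suc n))"
  proof
    fix n
    let ?m = "Suc n"
    have "exp (a n) = fact ?m / (sqrt (real ?m) * (real ?m / exp 1) ^ ?m)"
      if "real ?m = x" "x > 0" for x
    proof -
      have "exp ((x + 1/2) * ln x) = exp (real ?m * ln x) * exp (ln x / 2)"
        unfolding that(1) by (simp add: distrib_right exp_add)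
      moreover have "exp (ln x / 2) = sqrt x"
        using that by (simp flip: ln_sqrt)
      moreover have "exp (real ?m * ln x) = x ^ ?m"
        unfolding exp_of_nat_mult exp_ln[OF that(2)] ..
      moreover have "exp x = exp 1 ^ ?m"
        unfolding that(1)[symmetric] using exp_of_nat_mult[of ?m "1::real"] by (simp only: mult_1_right)
      ultimately show ?thesis
        unfolding a_def that(1) exp_add exp_diff power_divide by (simp del: fact_Suc)
    qed
    thus "exp (a n) = fact ?m / (sqrt (real ?m) * (real ?m / exp 1) ^ ?m)" by simp
  qed
  finally have "(\<lambda>n. fact n / (sqrt (real n) * (real n / exp 1) ^ n)) \<longlonglongrightarrow> exp (l + a 0)"
    by (subst (asm) filterlim_sequentially_Suc)
  thus ?thesis by (intro that[of "exp (l + a 0)"]) auto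
qed

lemma wallis_product_fact:
  "(\<Prod>k=1..n. (4 * real k ^ 2) / (4 * real k ^ 2 - 1))
     = (2 ^ n * fact n) ^ 4 / ((fact (2 * n)) ^ 2 * (2 * real n + 1))"
proof (induction n)
  case (Suc n)
  let ?c = "real n + 1" and ?e = "2 * real n + 1" and ?g = "2 * real n + 3"
  have sq: "4 * real (Suc n) ^ 2 - 1 = ?e * ?g"
    by (simp add: algebra_simps power2_eq_square)
  have f: "(fact (2 * Suc n) :: real) = (2 * ?c) * (?e * fact (2 * n))"
    by (simp add: algebra_simps)
  have p: "(2 ^ Suc n * fact (Suc n) :: real) = (2 * ?c) * (2 ^ n * fact n)"
    by (simp add: algebra_simps)
  have alg: "r ^ 4 / (f ^ 2 * e) * (4 * c ^ 2 / (e * g)) = ((2 * c) * r) ^ 4 / (((2 * c) * (e * f)) ^ 2 * g)"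
    if "c > 0" "e > 0" "f > 0" "g > 0" for c e f g r :: real
    using that by (simp add: divide_simps) (simp add: power2_eq_square power4_eq_xxxx)
  have "(\<Prod>k=1..Suc n. (4 * real k ^ 2) / (4 * real k ^ 2 - 1))
      = (\<Prod>k=1..n. (4 * real k ^ 2) / (4 * real k ^ 2 - 1)) * (4 * real (Suc n) ^ 2 / (4 * real (Suc n) ^ 2 - 1))"
    by (subst prod.cl_ivl_Suc) simp
  also have "\<dots> = (2 ^ n * fact n) ^ 4 / (fact (2 * n) ^ 2 * ?e) * (4 * ?c ^ 2 / (?e * ?g))"
    unfolding Suc.IH sq by (simp add: add.commute)
  also have "\<dots> = (2 ^ Suc n * fact (Suc n)) ^ 4 / (fact (2 * Suc n) ^ 2 * ?g)"
    unfolding f p by (rule alg) auto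
  also have "?g = 2 * real (Suc n) + 1" by simp
  finally show ?case .
qed simp

text \<open>
  The constant is found by inserting the approximation into Wallis's product, where it survives as
  $C^4 / C^2 \cdot 1/4 = \pi / 2$.
\<close>

lemma stirling: "(\<lambda>n. fact n / stirling_approx n) \<longlonglongrightarrow> 1"
proof -
  define s :: "nat \<Rightarrow> real" where "s n = fact n / (sqrt (real n) * (real n / exp 1) ^ n)" for n
  obtain C where C: "C > 0" "s \<longlonglongrightarrow> C"
    unfolding s_def using fact_over_sqrt_power_convergent by blast
  have "(\<lambda>n. s (2 * n)) \<longlonglongrightarrow> C"
    using C(2) by (rule filterlim_compose) (auto intro!: filterlim_subseq strict_monoI)
  hence "(\<lambda>n. s n ^ 4 / s (2 * n) ^ 2) \<longlonglongrightarrow> C ^ 4 / C ^ 2"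
    using C by (intro tendsto_divide tendsto_power) auto
  moreover have "(\<lambda>n. real n / (2 * (2 * real n + 1))) \<longlonglongrightarrow> 1 / 4" by real_asymp
  ultimately have "(\<lambda>n. s n ^ 4 / s (2 * n) ^ 2 * (real n / (2 * (2 * real n + 1)))) \<longlonglongrightarrow> C ^ 4 / C ^ 2 * (1 / 4)"
    by (rule tendsto_mult)
  moreover have "\<forall>\<^sub>F n in sequentially. s n ^ 4 / s (2 * n) ^ 2 * (real n / (2 * (2 * real n + 1)))
      = (\<Prod>k=1..n. (4 * real k ^ 2) / (4 * real k ^ 2 - 1))"
    using eventually_gt_at_top[of 0]
  proof eventually_elim
    case (elim n)
    define E where "E = (real n / exp 1) ^ n"
    have Epos: "E > 0" using elim by (simp add: E_def)
    have four: "(4::real) ^ n = 2 ^ n * 2 ^ n" by (simp flip: power_mult_distrib)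
    have E2: "(real (2 * n) / exp 1) ^ (2 * n) = 4 ^ n * E ^ 2"
      by (simp add: E_def four power_mult power_divide power_mult_distrib field_simps power2_eq_square)
    have sq: "sqrt (real n) ^ 4 = real n ^ 2" "sqrt (real (2 * n)) ^ 2 = 2 * real n"
      using elim by (simp_all add: power4_eq_xxxx power2_eq_square)
    have "s n = fact n / (sqrt (real n) * E)" by (simp only: s_def E_def)
    hence "s n ^ 4 = fact n ^ 4 / (real n ^ 2 * E ^ 4)"
      by (simp only: power_divide power_mult_distrib sq)
    moreover have "s (2 * n) ^ 2 = fact (2 * n) ^ 2 / (2 * real n * (4 ^ n * E ^ 2) ^ 2)"
      unfolding s_def E2 by (simp only: power_divide power_mult_distrib sq)
    moreover have "(2 ^ n * fact n :: real) ^ 4 = (4 ^ n) ^ 2 * fact n ^ 4"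
    proof -
      have "((2::real) ^ n) ^ 4 = (4 ^ n) ^ 2"
        by (simp add: four power2_eq_square power4_eq_xxxx)
      thus ?thesis by (simp add: power_mult_distrib)
    qed
    moreover have "a / (r ^ 2 * e ^ 4) / (b ^ 2 / (2 * r * (q * e ^ 2) ^ 2)) * (r / (2 * (2 * r + 1)))
        = q ^ 2 * a / (b ^ 2 * (2 * r + 1))" if "r > 0" "e > 0" "b > 0" "q > 0" for a b r e q :: real
    proof -
      have "2 * r + 1 \<noteq> 0" using that by simp
      thus ?thesis using that by (simp add: divide_simps) (simp add: power2_eq_square power4_eq_xxxx)
    qed
    note this[of "real n" E "fact (2 * n)" "4 ^ n" "fact n ^ 4"]
    ultimately show ?case
      unfolding wallis_product_fact using elim Epos by simp
  qed
  ultimately have "(\<lambda>n. \<Prod>k=1..n. (4 * real k ^ 2) / (4 * real k ^ 2 - 1)) \<longlonglongrightarrow> C ^ 4 / C ^ 2 * (1 / 4)"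
    by (rule Lim_transform_eventually)
  with wallis have "C ^ 4 / C ^ 2 * (1 / 4) = pi / 2"
    by (rule LIMSEQ_unique[rotated])
  hence "C ^ 2 = 2 * pi" using C(1) by (simp add: field_simps power2_eq_square power4_eq_xxxx)
  hence C_eq: "C = sqrt (2 * pi)" using C(1) by (metis less_imp_le real_sqrt_unique)
  have "(\<lambda>n. s n / sqrt (2 * pi)) \<longlonglongrightarrow> C / sqrt (2 * pi)"
    by (intro tendsto_divide C tendsto_const) auto
  moreover have "s n / sqrt (2 * pi) = fact n / stirling_approx n" for n
    by (simp add: s_def stirling_approx_def real_sqrt_mult)
  ultimately show ?thesis by (simp add: C_eq)
qed

section \<open>Local limits of the root cluster size\<close>

lemma deriv_ln_quotient:
  assumes "(y::real) > 0"
  shows "((\<lambda>y. ln (1 + y) / y) has_real_derivative (y / (1 + y) - ln (1 + y)) / y ^ 2) (at y)"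
proof -
  have "((\<lambda>y. ln (1 + y)) has_real_derivative 1 / (1 + y)) (at y)"
    using assms by (auto intro!: derivative_eq_intros)
  from DERIV_divide[OF this DERIV_ident] assms show ?thesis
    by (simp add: power2_eq_square)
qed

text \<open>
  With $h(y) = \ln (1 + y) / y$ the expression is $d\,(h(d/K) - h(d/J))$.  The mean value theorem gives
  $-d\,(d/J - d/K)\,h'(\xi)$ with $\xi \to 0$, and $h'(\xi) \to -1/2$.  Working with the difference, rather
  than expanding each term, is essential: separately the terms have errors of order $d^3 / n^2$, which
  need not be small.
\<close>

lemma exponent_limit:
  fixes d J K :: "nat \<Rightarrow> real"
  assumes pos: "\<forall>\<^sub>F n in sequentially. 0 < d n \<and> 0 < J n \<and> J n < K n"
    and small: "(\<lambda>n. d n / J n) \<longlonglongrightarrow> 0"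
    and L: "(\<lambda>n. d n ^ 2 * (1 / J n - 1 / K n) / 2) \<longlonglongrightarrow> L"
  shows "(\<lambda>n. K n * ln (1 + d n / K n) - J n * ln (1 + d n / J n)) \<longlonglongrightarrow> L"
proof -
  let ?h = "\<lambda>y::real. ln (1 + y) / y"
  let ?h' = "\<lambda>y::real. (y / (1 + y) - ln (1 + y)) / y ^ 2"
  have "\<exists>\<xi>. 0 < d n \<and> 0 < J n \<and> J n < K n \<longrightarrow>
      d n / K n < \<xi> \<and> \<xi> < d n / J n \<and> ?h (d n / J n) - ?h (d n / K n) = (d n / J n - d n / K n) * ?h' \<xi>" for n
  proof (cases "0 < d n \<and> 0 < J n \<and> J n < K n")
    case True
    hence "d n / K n < d n / J n" "d n / K n > 0" by (auto intro: divide_strict_left_mono)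
    hence "\<exists>\<xi>>d n / K n. \<xi> < d n / J n \<and> ?h (d n / J n) - ?h (d n / K n) = (d n / J n - d n / K n) * ?h' \<xi>"
      by (intro MVT2 deriv_ln_quotient) auto
    thus ?thesis by blast
  qed auto
  then obtain \<xi> where \<xi>: "\<And>n. 0 < d n \<and> 0 < J n \<and> J n < K n \<Longrightarrow>
      d n / K n < \<xi> n \<and> \<xi> n < d n / J n \<and> ?h (d n / J n) - ?h (d n / K n) = (d n / J n - d n / K n) * ?h' (\<xi> n)"
    by metis
  have \<xi>pos: "\<forall>\<^sub>F n in sequentially. 0 < \<xi> n"
    using pos by eventually_elim (use \<xi> in \<open>smt (verit) divide_pos_pos\<close>)
  have "\<xi> \<longlonglongrightarrow> 0"
  proof (rule tendsto_sandwich[OF _ _ tendsto_const small])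
    show "\<forall>\<^sub>F n in sequentially. 0 \<le> \<xi> n" using \<xi>pos by eventually_elim simp
    show "\<forall>\<^sub>F n in sequentially. \<xi> n \<le> d n / J n"
      using pos by eventually_elim (use \<xi> in fastforce)
  qed
  hence "filterlim \<xi> (at_right 0) sequentially"
    using \<xi>pos by (auto simp: filterlim_at elim: eventually_mono)
  moreover have "(?h' \<longlongrightarrow> - 1 / 2) (at_right 0)" by real_asymp
  ultimately have "(\<lambda>n. ?h' (\<xi> n)) \<longlonglongrightarrow> - 1 / 2" by (rule filterlim_compose[rotated])
  from tendsto_mult[OF tendsto_mult[OF tendsto_const[of "-2"] L] this]
  have "(\<lambda>n. - 2 * (d n ^ 2 * (1 / J n - 1 / K n) / 2) * ?h' (\<xi> n)) \<longlonglongrightarrow> L" by simp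
  moreover have "\<forall>\<^sub>F n in sequentially. - 2 * (d n ^ 2 * (1 / J n - 1 / K n) / 2) * ?h' (\<xi> n)
      = K n * ln (1 + d n / K n) - J n * ln (1 + d n / J n)"
    using pos
  proof eventually_elim
    case (elim n)
    have "- 2 * (d n ^ 2 * (1 / J n - 1 / K n) / 2) * c = - d n * ((d n / J n - d n / K n) * c)" for c
      using elim by (simp add: field_simps power2_eq_square)
    hence "- 2 * (d n ^ 2 * (1 / J n - 1 / K n) / 2) * ?h' (\<xi> n)
        = - d n * ((d n / J n - d n / K n) * ?h' (\<xi> n))" .
    also have "(d n / J n - d n / K n) * ?h' (\<xi> n) = ?h (d n / J n) - ?h (d n / K n)"
      using \<xi>[OF elim] by simp
    also have "- d n * \<dots> = K n * ln (1 + d n / K n) - J n * ln (1 + d n / J n)"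
      using elim by (simp add: algebra_simps)
    finally show ?case .
  qed
  ultimately show ?thesis by (rule Lim_transform_eventually)
qed

text \<open>
  The mass function with each factorial replaced by Stirling's approximation times a correction; the
  powers of $e$ cancel because $K = m + J$.
\<close>

lemma pmf_R_stirling_form:
  assumes d: "1 \<le> d" and m: "1 \<le> m" and dm: "d + m < n"
  defines "K \<equiv> n - d" and "J \<equiv> n - d - m"
  shows "pmf (R n (n - d)) m =
      (fact K / stirling_approx K) / ((fact m / stirling_approx m) * (fact J / stirling_approx J))
      * (real d * sqrt (real K / (real m * real J)) / (real n - real m))
      * exp (- (real K * ln (1 + real d / real K) - real J * ln (1 + real d / real J))) / sqrt (2 * pi)"
proof -
  have nat: "n = K + d" "K = m + J" "J \<ge> 1" "n - m = J + d" "K \<ge> 1" "K < n" "m \<le> K" "K - m = J" "n \<ge> 1" "K \<le> n" "K \<noteq> n"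
    using assms by (auto simp: K_def J_def)
  have pos: "real K > 0" "real m > 0" "real J > 0" "real d > 0" using nat d m by auto
  have "(real n - real m) powi (int K - int m - 1) = (real J + real d) ^ J / (real J + real d)"
  proof -
    have "int K - int m - 1 = int J - 1" "real n - real m = real J + real d" using nat by auto
    moreover have "real J + real d \<noteq> 0" using pos by linarith
    ultimately show ?thesis by (simp add: power_int_diff)
  qed
  moreover have "real (K choose m) = fact K / (fact m * fact J)"
    using nat by (simp add: binomial_fact)
  ultimately have pmf: "pmf (R n (n - d)) m
      = real m ^ m * real d * ((real J + real d) ^ J / (real J + real d)) / (real K + real d) ^ K
        * (fact K / (fact m * fact J))"
    using pmf_root_cluster[of n K m] nat m by (simp add: K_def[symmetric])
  have e: "exp (real N * ln (1 + real d / real N)) = (real N + real d) ^ N / real N ^ N" if "N \<ge> 1" for N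
  proof -
    have "1 + real d / real N = (real N + real d) / real N" using that by (simp add: field_simps)
    moreover have "(real N + real d) / real N > 0" using that d by simp
    ultimately show ?thesis by (subst exp_of_nat_mult) (simp add: power_divide)
  qed
  have E: "exp (- (real K * ln (1 + real d / real K) - real J * ln (1 + real d / real J)))
      = ((real J + real d) ^ J / real J ^ J) / ((real K + real d) ^ K / real K ^ K)"
    using e[of K] e[of J] nat by (simp add: exp_diff)
  have st: "stirling_approx K / (stirling_approx m * stirling_approx J)
      = sqrt (real K / (real m * real J)) * (real K ^ K / (real m ^ m * real J ^ J)) / sqrt (2 * pi)"
  proof -
    have "(exp 1 :: real) ^ K = exp 1 ^ m * exp 1 ^ J" using nat by (simp add: power_add)
    thus ?thesis
      by (simp add: stirling_approx_def real_sqrt_mult real_sqrt_divide power_divide)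
  qed
  have stpos: "stirling_approx K > 0" "stirling_approx m > 0" "stirling_approx J > 0"
    using pos by (simp_all add: stirling_approx_def)
  have "(fact K / stirling_approx K) / ((fact m / stirling_approx m) * (fact J / stirling_approx J))
      = fact K / (fact m * fact J) / (stirling_approx K / (stirling_approx m * stirling_approx J))"
    by simp
  also have "\<dots> = fact K / (fact m * fact J) * sqrt (2 * pi)
      / (sqrt (real K / (real m * real J)) * (real K ^ K / (real m ^ m * real J ^ J)))"
    unfolding st by simp
  finally have ratio: "(fact K / stirling_approx K) / ((fact m / stirling_approx m) * (fact J / stirling_approx J))
      = fact K / (fact m * fact J) * sqrt (2 * pi)
      / (sqrt (real K / (real m * real J)) * (real K ^ K / (real m ^ m * real J ^ J)))" .
  have nm: "real n - real m = real J + real d" using nat by auto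
  have sqpos: "sqrt (real K / (real m * real J)) > 0" using pos by simp
  have pws: "real K ^ K > 0" "real m ^ m > 0" "real J ^ J > 0" "(real K + real d) ^ K > 0"
    "real J + real d > 0" using pos by auto
  have alg: "mm * dd * (jd / jdd) / kd * c = c * q / (s * (kk / (mm * jj))) * (dd * s / jdd) * ((jd / jj) / (kd / kk)) / q"
    if "s > 0" "q > 0" "mm > 0" "jj > 0" "kk > 0" "kd > 0" "jdd > 0" for mm dd jd jdd kd c q s kk jj :: real
    using that by (simp add: divide_simps)
  show ?thesis
    unfolding pmf ratio E nm by (rule alg) (use sqpos pws in auto)
qed

lemma pmf_R_local_limit:
  fixes d m :: "nat \<Rightarrow> nat" and s :: "nat \<Rightarrow> real"
  assumes ev: "\<forall>\<^sub>F n in sequentially. 1 \<le> d n \<and> 1 \<le> m n \<and> d n + m n < n"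
    and m_inf: "filterlim m at_top sequentially"
    and J_inf: "filterlim (\<lambda>n. n - d n - m n) at_top sequentially"
    and small: "(\<lambda>n. real (d n) / (real n - real (d n) - real (m n))) \<longlonglongrightarrow> 0"
    and L: "(\<lambda>n. real (d n) ^ 2 * real (m n) / (2 * (real n - real (d n) - real (m n)) * (real n - real (d n)))) \<longlonglongrightarrow> L"
    and A: "(\<lambda>n. real (d n) * sqrt ((real n - real (d n)) / (real (m n) * (real n - real (d n) - real (m n))))
               / (real n - real (m n)) / s n) \<longlonglongrightarrow> A"
  shows "(\<lambda>n. pmf (R n (n - d n)) (m n) / s n) \<longlonglongrightarrow> A * exp (- L) / sqrt (2 * pi)"
proof -
  let ?K = "\<lambda>n. n - d n" and ?J = "\<lambda>n. n - d n - m n"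
  let ?rK = "\<lambda>n. real n - real (d n)" and ?rJ = "\<lambda>n. real n - real (d n) - real (m n)"
  let ?st = "\<lambda>N. fact N / stirling_approx N :: real"
  have K_inf: "filterlim ?K at_top sequentially"
    by (rule filterlim_at_top_mono[OF J_inf]) (intro always_eventually allI diff_le_self)
  have real: "\<forall>\<^sub>F n in sequentially. real (?K n) = ?rK n \<and> real (?J n) = ?rJ n"
    using ev by eventually_elim auto
  have s1: "(\<lambda>n. ?st (?K n) / (?st (m n) * ?st (?J n))) \<longlonglongrightarrow> 1 / (1 * 1)"
    by (intro tendsto_divide tendsto_mult filterlim_compose[OF stirling] K_inf m_inf J_inf) auto
  have s2: "(\<lambda>n. ?rK n * ln (1 + real (d n) / ?rK n) - ?rJ n * ln (1 + real (d n) / ?rJ n)) \<longlonglongrightarrow> L"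
  proof (rule exponent_limit[OF _ small])
    show "\<forall>\<^sub>F n in sequentially. 0 < real (d n) \<and> 0 < ?rJ n \<and> ?rJ n < ?rK n"
      using ev by eventually_elim auto
    have "\<forall>\<^sub>F n in sequentially. real (d n) ^ 2 * real (m n) / (2 * ?rJ n * ?rK n)
        = real (d n) ^ 2 * (1 / ?rJ n - 1 / ?rK n) / 2"
      using ev
    proof eventually_elim
      case (elim n)
      have alg: "a ^ 2 * b / (2 * j * k) = a ^ 2 * (1 / j - 1 / k) / 2" if "j > 0" "k = j + b" "b > 0" for a b j k :: real
        using that by (simp add: field_simps)
      show ?case by (rule alg) (use elim in auto)
    qed
    with L show "(\<lambda>n. real (d n) ^ 2 * (1 / ?rJ n - 1 / ?rK n) / 2) \<longlonglongrightarrow> L"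
      by (rule Lim_transform_eventually)
  qed
  have "sqrt (2 * pi) \<noteq> 0" by simp
  from tendsto_divide[OF tendsto_mult[OF tendsto_mult[OF s1 A] tendsto_exp[OF tendsto_minus[OF s2]]] tendsto_const this]
  have lim: "(\<lambda>n. ?st (?K n) / (?st (m n) * ?st (?J n))
      * (real (d n) * sqrt (?rK n / (real (m n) * ?rJ n)) / (real n - real (m n)) / s n)
      * exp (- (?rK n * ln (1 + real (d n) / ?rK n) - ?rJ n * ln (1 + real (d n) / ?rJ n))) / sqrt (2 * pi))
      \<longlonglongrightarrow> A * exp (- L) / sqrt (2 * pi)" by (simp only: mult_1 div_by_1)
  show ?thesis
  proof (rule Lim_transform_eventually[OF lim])
    show "\<forall>\<^sub>F n in sequentially. ?st (?K n) / (?st (m n) * ?st (?J n))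
      * (real (d n) * sqrt (?rK n / (real (m n) * ?rJ n)) / (real n - real (m n)) / s n)
      * exp (- (?rK n * ln (1 + real (d n) / ?rK n) - ?rJ n * ln (1 + real (d n) / ?rJ n))) / sqrt (2 * pi)
      = pmf (R n (n - d n)) (m n) / s n"
      using ev real
    proof eventually_elim
      case (elim n)
      have "pmf (R n (n - d n)) (m n) = ?st (?K n) / (?st (m n) * ?st (?J n))
        * (real (d n) * sqrt (?rK n / (real (m n) * ?rJ n)) / (real n - real (m n)))
        * exp (- (?rK n * ln (1 + real (d n) / ?rK n) - ?rJ n * ln (1 + real (d n) / ?rJ n))) / sqrt (2 * pi)"
      proof -
        have "1 \<le> d n" "1 \<le> m n" "d n + m n < n"
          and eqs: "real (n - d n) = ?rK n" "real (n - d n - m n) = ?rJ n" using elim by auto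
        from pmf_R_stirling_form[OF this(1-3)] show ?thesis unfolding eqs .
      qed
      thus ?case by simp
    qed
  qed
qed

section \<open>From local limits to weak convergence\<close>

text \<open>
  The density of \<open>s (X + U)\<close> for \<open>X\<close> with distribution \<open>p\<close> and \<open>U\<close> independent and uniform on $[0, 1)$: the
  lattice distribution smeared out over its cells.
\<close>

definition step_density :: "nat pmf \<Rightarrow> real \<Rightarrow> real \<Rightarrow> real" where
  "step_density p s x = (if x \<ge> 0 then pmf p (nat \<lfloor>x / s\<rfloor>) / s else 0)"

lemma step_density_measurable [measurable]: "step_density p s \<in> borel_measurable borel"
  unfolding step_density_def by measurable

lemma nn_integral_step_density:
  assumes s: "s > 0"
  shows "(\<integral>\<^sup>+ x. ennreal (step_density p s x) * indicator {x. nat \<lfloor>x / s\<rfloor> \<in> S} x \<partial>lborel)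
       = emeasure (measure_pmf p) S"
proof -
  let ?I = "\<lambda>m. {s * real m..<s * (real m + 1)}"
  let ?c = "\<lambda>m. ennreal (pmf p m / s) * indicator S m"
  have "ennreal (step_density p s x) * indicator {x. nat \<lfloor>x / s\<rfloor> \<in> S} x
      = (\<Sum>m. ?c m * indicator (?I m) x)" for x
  proof (cases "x \<ge> 0")
    case True
    define k where "k = nat \<lfloor>x / s\<rfloor>"
    have fl: "real k \<le> x / s" "x / s < real k + 1" using True s by (auto simp: k_def)
    have "x \<in> ?I m \<longleftrightarrow> m = k" for m
    proof -
      have "x \<in> ?I m \<longleftrightarrow> real m \<le> x / s \<and> x / s < real m + 1"
        using s by (auto simp: field_simps)
      also have "\<dots> \<longleftrightarrow> m = k" using fl by auto
      finally show ?thesis .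
    qed
    hence "(\<Sum>m. ?c m * indicator (?I m) x) = (\<Sum>m\<in>{k}. ?c m * indicator (?I m) x)"
      by (intro suminf_finite) auto
    also have "\<dots> = ?c k" using \<open>\<And>m. x \<in> ?I m \<longleftrightarrow> m = k\<close> by (simp add: indicator_def)
    finally show ?thesis using True by (simp add: step_density_def k_def indicator_def)
  next
    case False
    have "x \<notin> ?I m" for m
    proof -
      have "s * real m \<ge> 0" using s by simp
      thus ?thesis using False by auto
    qed
    hence z: "?c m * indicator (?I m) x = 0" for m by (simp add: indicator_def)
    show ?thesis using False unfolding z by (simp add: step_density_def)
  qed
  hence "(\<integral>\<^sup>+ x. ennreal (step_density p s x) * indicator {x. nat \<lfloor>x / s\<rfloor> \<in> S} x \<partial>lborel)
      = (\<integral>\<^sup>+ x. (\<Sum>m. ?c m * indicator (?I m) x) \<partial>lborel)" by simp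
  also have "\<dots> = (\<Sum>m. \<integral>\<^sup>+ x. ?c m * indicator (?I m) x \<partial>lborel)"
    by (intro nn_integral_suminf) measurable
  also have "\<dots> = (\<Sum>m. ennreal (pmf p m) * indicator S m)"
  proof (rule arg_cong[where f = suminf], rule ext)
    fix m
    have "(\<integral>\<^sup>+ x. ?c m * indicator (?I m) x \<partial>lborel) = ?c m * emeasure lborel (?I m)"
      by (rule nn_integral_cmult_indicator) simp
    also have "emeasure lborel (?I m) = ennreal s"
      using s by (simp add: algebra_simps)
    also have "?c m * ennreal s = ennreal (pmf p m / s) * ennreal s * indicator S m"
      by (simp only: mult_ac)
    also have "ennreal (pmf p m / s) * ennreal s = ennreal (pmf p m / s * s)"
      using s by (intro ennreal_mult[symmetric]) auto
    finally show "(\<integral>\<^sup>+ x. ?c m * indicator (?I m) x \<partial>lborel) = ennreal (pmf p m) * indicator S m"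
      using s by simp
  qed
  also have "\<dots> = (\<integral>\<^sup>+ m. indicator S m \<partial>measure_pmf p)"
    by (simp add: nn_integral_measure_pmf nn_integral_count_space_nat)
  also have "\<dots> = emeasure (measure_pmf p) S" by simp
  finally show ?thesis .
qed

lemma cdf_law: "cdf (law p g) x = measure (measure_pmf p) {m. g m \<le> x}"
  unfolding cdf_def law_def by (subst measure_distr) (auto simp: vimage_def)

lemma weak_conv_m_cong:
  assumes "\<forall>\<^sub>F n in sequentially. M n = N n" "weak_conv_m N L"
  shows "weak_conv_m M L"
proof -
  have "(\<lambda>n. cdf (M n) x) \<longlonglongrightarrow> y" if "(\<lambda>n. cdf (N n) x) \<longlonglongrightarrow> y" for x y
    by (rule Lim_transform_eventually[OF that]) (use assms(1) in \<open>eventually_elim, simp\<close>)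
  thus ?thesis using assms(2) by (simp add: weak_conv_m_def weak_conv_def)
qed

lemma law_map_pmf:
  assumes "\<And>m. m \<in> set_pmf p \<Longrightarrow> g m = f (h m)"
  shows "law p g = law (map_pmf h p) f"
proof -
  have "law (map_pmf h p) f = distr (measure_pmf p) borel (f \<circ> h)"
    unfolding law_def map_pmf_rep_eq by (subst distr_distr) auto
  also have "\<dots> = law p g"
    unfolding law_def using assms
    by (intro distr_cong_AE) (auto simp: AE_measure_pmf_iff)
  finally show ?thesis by simp
qed

lemma weak_conv_m_discrete:
  assumes "\<And>m. (\<lambda>n. pmf (p n) m) \<longlonglongrightarrow> pmf q m"
  shows "weak_conv_m (\<lambda>n. law (p n) real) (law q real)"
  unfolding weak_conv_m_def weak_conv_def cdf_law
proof (intro allI impI)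
  fix x
  have fin: "finite {m. real m \<le> x}"
    by (rule finite_subset[of _ "{..nat \<lfloor>x\<rfloor>}"]) (auto simp: le_nat_floor)
  have "(\<lambda>n. \<Sum>m | real m \<le> x. pmf (p n) m) \<longlonglongrightarrow> (\<Sum>m | real m \<le> x. pmf q m)"
    by (intro tendsto_sum assms)
  thus "(\<lambda>n. measure (measure_pmf (p n)) {m. real m \<le> x}) \<longlonglongrightarrow> measure (measure_pmf q) {m. real m \<le> x}"
    using fin by (simp add: measure_measure_pmf_finite)
qed

lemma real_distribution_law_density:
  assumes "f \<in> borel_measurable borel" "(\<integral>\<^sup>+ x. ennreal (f x) \<partial>lborel) = 1"
  shows "real_distribution (law_density f)"
proof -
  have "emeasure (law_density f) (space (law_density f)) = 1"
    using assms by (simp add: law_density_def emeasure_density)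
  thus ?thesis
    by (intro real_distribution.intro real_distribution_axioms.intro prob_spaceI)
       (simp_all add: law_density_def)
qed

text \<open>
  By Scheffe's lemma the smeared densities converge in $L^1$ to \<open>f\<close>.  The distribution function of the
  lattice variable at \<open>x\<close> is the smeared mass of a union of cells that lies between $(-\infty, x]$ and
  $(-\infty, x + s]$, so it differs from that of \<open>f\<close> by the $L^1$ error and an increment over an interval
  of vanishing length.
\<close>

lemma weak_conv_m_lattice:
  fixes p :: "nat \<Rightarrow> nat pmf" and s :: "nat \<Rightarrow> real"
  assumes f[measurable]: "f \<in> borel_measurable borel" and f0: "\<And>x. f x \<ge> 0" "\<And>x. x \<le> 0 \<Longrightarrow> f x = 0"
    and int1: "(\<integral>\<^sup>+ x. ennreal (f x) \<partial>lborel) = 1"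
    and s: "\<forall>\<^sub>F n in sequentially. s n > 0" "s \<longlonglongrightarrow> 0"
    and lim: "\<And>x. x > 0 \<Longrightarrow> (\<lambda>n. pmf (p n) (nat \<lfloor>x / s n\<rfloor>) / s n) \<longlonglongrightarrow> f x"
  shows "weak_conv_m (\<lambda>n. law (p n) (\<lambda>m. s n * real m)) (law_density f)"
proof -
  interpret L: real_distribution "law_density f"
    by (rule real_distribution_law_density[OF f int1])
  have f_int: "integrable lborel f"
    using int1 f0 by (intro integrableI_nonneg) auto
  \<comment> \<open>The scale is positive only eventually; \<open>t\<close> repairs the remaining indices.\<close>
  define t where "t n = (if s n > 0 then s n else 1)" for n
  have t: "t n > 0" for n by (simp add: t_def)
  have ts: "\<forall>\<^sub>F n in sequentially. t n = s n" using s(1) by eventually_elim (simp add: t_def)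
  define F where "F n = step_density (p n) (t n)" for n
  have F0: "F n x \<ge> 0" for n x using t[of n] by (simp add: F_def step_density_def)
  have Fm[measurable]: "F n \<in> borel_measurable borel" for n by (simp add: F_def)
  have F1: "(\<integral>\<^sup>+ x. ennreal (F n x) \<partial>lborel) = 1" for n
    using nn_integral_step_density[OF t[of n], of "p n" UNIV]
    by (simp add: F_def measure_pmf.emeasure_space_1[simplified])
  have F_int: "integrable lborel (F n)" for n
    using F1[of n] F0 by (intro integrableI_nonneg) auto
  have conv: "(\<lambda>n. \<integral>\<^sup>+ x. norm (F n x - f x) \<partial>lborel) \<longlonglongrightarrow> 0"
  proof (rule Scheffe_lemma2)
    have "(\<lambda>n. F n x) \<longlonglongrightarrow> f x" if "x \<noteq> 0" for x
    proof (cases "x > 0")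
      case True
      show ?thesis
        by (rule Lim_transform_eventually[OF lim[OF True]])
           (use ts in \<open>eventually_elim, use True in \<open>simp add: F_def step_density_def\<close>\<close>)
    next
      case False
      thus ?thesis using that f0(2)[of x] by (simp add: F_def step_density_def)
    qed
    moreover have "AE x in lborel. x \<noteq> (0::real)" by (rule AE_lborel_singleton)
    ultimately show "AE x in lborel. (\<lambda>n. F n x) \<longlonglongrightarrow> f x" by auto
    show "(\<integral>\<^sup>+ x. norm (F n x) \<partial>lborel) \<le> (\<integral>\<^sup>+ x. norm (f x) \<partial>lborel)" for n
      using F1[of n] int1 F0 f0 by simp
  qed (use f_int in auto)
  define \<epsilon> where "\<epsilon> n = (\<integral>x. norm (F n x - f x) \<partial>lborel)" for n
  have "(\<integral>\<^sup>+ x. norm (F n x - f x) \<partial>lborel) = ennreal (\<epsilon> n)" for n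
    unfolding \<epsilon>_def using F_int f_int by (intro nn_integral_eq_integral integrable_norm) auto
  hence "(\<lambda>n. ennreal (\<epsilon> n)) \<longlonglongrightarrow> ennreal 0" using conv by simp
  hence eps: "\<epsilon> \<longlonglongrightarrow> 0"
    by (subst (asm) tendsto_ennreal_iff) (auto simp: \<epsilon>_def)
  have cdf0: "cdf (law_density f) x = 0" if "x < 0" for x
  proof -
    have "emeasure (law_density f) {..x} = (\<integral>\<^sup>+ y. ennreal (f y) * indicator {..x} y \<partial>lborel)"
      by (simp add: law_density_def emeasure_density)
    also have "\<dots> = nn_integral lborel (\<lambda>_::real. 0)"
      using that by (intro nn_integral_cong) (auto simp: indicator_def f0)
    finally show ?thesis by (simp add: cdf_def measure_def)
  qed
  show ?thesis
    unfolding weak_conv_m_def weak_conv_def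
  proof (intro allI impI)
    fix x
    show "(\<lambda>n. cdf (law (p n) (\<lambda>m. s n * real m)) x) \<longlonglongrightarrow> cdf (law_density f) x"
    proof (cases "x < 0")
      case True
      have "\<forall>\<^sub>F n in sequentially. 0 = cdf (law (p n) (\<lambda>m. s n * real m)) x"
        using s(1)
      proof eventually_elim
        case (elim n)
        have "\<not> s n * real m \<le> x" for m
        proof -
          have "s n * real m \<ge> 0" using elim by simp
          thus ?thesis using True by linarith
        qed
        hence "{m. s n * real m \<le> x} = {}" by auto
        thus ?case by (simp add: cdf_law)
      qed
      from Lim_transform_eventually[OF tendsto_const this] show ?thesis using cdf0[OF True] by simp
    next
      case False
      \<comment> \<open>The union of the cells that start at or below \<open>x\<close>.\<close>
      define A where "A n = {y. nat \<lfloor>y / t n\<rfloor> \<le> nat \<lfloor>x / t n\<rfloor>}" for n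
      have Am[measurable]: "A n \<in> sets borel" for n
      proof -
        have "A n = {..<t n * (real (nat \<lfloor>x / t n\<rfloor>) + 1)}"
        proof -
          have "nat \<lfloor>y / t n\<rfloor> \<le> M \<longleftrightarrow> y < t n * (real M + 1)" for y M
          proof -
            have "nat \<lfloor>y / t n\<rfloor> \<le> M \<longleftrightarrow> \<lfloor>y / t n\<rfloor> \<le> int M" by (rule nat_le_iff)
            also have "\<dots> \<longleftrightarrow> y / t n < real M + 1" by (simp add: floor_le_iff)
            finally show ?thesis using t[of n] by (simp add: field_simps)
          qed
          thus ?thesis by (auto simp: A_def)
        qed
        thus ?thesis by simp
      qed
      have P_eq: "\<forall>\<^sub>F n in sequentially. cdf (law (p n) (\<lambda>m. s n * real m)) x = (\<integral>y. F n y * indicator (A n) y \<partial>lborel)"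
        using ts
      proof eventually_elim
        case (elim n)
        have "{m. s n * real m \<le> x} = {..nat \<lfloor>x / t n\<rfloor>}"
        proof -
          have "s n * real m \<le> x \<longleftrightarrow> m \<le> nat \<lfloor>x / t n\<rfloor>" for m
          proof -
            have "s n * real m \<le> x \<longleftrightarrow> real m \<le> x / t n" using t[of n] elim by (simp add: field_simps)
            also have "\<dots> \<longleftrightarrow> int m \<le> \<lfloor>x / t n\<rfloor>" by (simp add: le_floor_iff)
            also have "\<dots> \<longleftrightarrow> m \<le> nat \<lfloor>x / t n\<rfloor>" using False t[of n] by (simp add: le_nat_iff)
            finally show ?thesis .
          qed
          thus ?thesis by auto
        qed
        hence "cdf (law (p n) (\<lambda>m. s n * real m)) x = measure (measure_pmf (p n)) {..nat \<lfloor>x / t n\<rfloor>}"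
          by (simp add: cdf_law)
        also have "\<dots> = enn2real (\<integral>\<^sup>+ y. ennreal (F n y) * indicator (A n) y \<partial>lborel)"
          using nn_integral_step_density[OF t[of n], of "p n" "{..nat \<lfloor>x / t n\<rfloor>}"]
          by (simp add: measure_def F_def A_def)
        also have "\<dots> = (\<integral>y. F n y * indicator (A n) y \<partial>lborel)"
        proof -
          have "(\<integral>y. F n y * indicator (A n) y \<partial>lborel) = enn2real (\<integral>\<^sup>+ y. ennreal (F n y * indicator (A n) y) \<partial>lborel)"
            using F0 by (intro integral_eq_nn_integral) auto
          also have "(\<integral>\<^sup>+ y. ennreal (F n y * indicator (A n) y) \<partial>lborel) = (\<integral>\<^sup>+ y. ennreal (F n y) * indicator (A n) y \<partial>lborel)"
            by (intro nn_integral_cong) (auto simp: indicator_def)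
          finally show ?thesis by simp
        qed
        finally show ?case .
      qed
      have mu: "(\<integral>y. f y * indicator B y \<partial>lborel) = measure (law_density f) B" if [measurable]: "B \<in> sets borel" for B
      proof -
        have "(\<integral>y. f y * indicator B y \<partial>lborel) = enn2real (\<integral>\<^sup>+ y. ennreal (f y * indicator B y) \<partial>lborel)"
          using f0 by (intro integral_eq_nn_integral) auto
        also have "(\<integral>\<^sup>+ y. ennreal (f y * indicator B y) \<partial>lborel) = (\<integral>\<^sup>+ y. ennreal (f y) * indicator B y \<partial>lborel)"
          by (intro nn_integral_cong) (auto simp: indicator_def)
        also have "\<dots> = emeasure (law_density f) B"
          by (simp add: law_density_def emeasure_density)
        finally show ?thesis by (simp add: measure_def)
      qed
      have diff: "\<bar>(\<integral>y. F n y * indicator (A n) y \<partial>lborel) - measure (law_density f) (A n)\<bar> \<le> \<epsilon> n" for n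
      proof -
        have i1: "integrable lborel (\<lambda>y. F n y * indicator (A n) y)"
          by (intro integrable_real_mult_indicator F_int) simp
        have i2: "integrable lborel (\<lambda>y. f y * indicator (A n) y)"
          by (intro integrable_real_mult_indicator f_int) simp
        have "(\<integral>y. F n y * indicator (A n) y \<partial>lborel) - measure (law_density f) (A n)
            = (\<integral>y. F n y * indicator (A n) y - f y * indicator (A n) y \<partial>lborel)"
          using i1 i2 by (simp add: mu[OF Am, symmetric])
        also have "\<bar>\<dots>\<bar> \<le> \<epsilon> n"
          unfolding \<epsilon>_def real_norm_def[symmetric]
          by (rule Bochner_Integration.integral_norm_bound_integral)
             (use i1 i2 F_int f_int in \<open>auto simp: indicator_def\<close>)
        finally show ?thesis .
      qed
      have lower: "cdf (law_density f) x \<le> measure (law_density f) (A n)" for n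
        unfolding cdf_def
      proof (rule L.finite_measure_mono)
        show "{..x} \<subseteq> A n"
          using t[of n] by (auto simp: A_def intro!: nat_mono floor_mono divide_right_mono)
      qed simp
      have upper: "measure (law_density f) (A n) \<le> cdf (law_density f) (x + t n)" for n
        unfolding cdf_def
      proof (rule L.finite_measure_mono)
        show "A n \<subseteq> {..x + t n}"
        proof
          fix y assume "y \<in> A n"
          hence "\<lfloor>y / t n\<rfloor> \<le> \<lfloor>x / t n\<rfloor>"
            using False t[of n] by (auto simp: A_def nat_le_iff)
          hence "y / t n < x / t n + 1" by linarith
          thus "y \<in> {..x + t n}" using t[of n] by (simp add: field_simps)
        qed
      qed simp
      have t0: "t \<longlonglongrightarrow> 0"
        by (rule Lim_transform_eventually[OF s(2)]) (use ts in \<open>eventually_elim, simp\<close>)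
      have "filterlim (\<lambda>n. x + t n) (at_right x) sequentially"
      proof -
        have "t n \<noteq> 0" for n using t[of n] by simp
        thus ?thesis using tendsto_add[OF tendsto_const t0, of x] t by (simp add: filterlim_at)
      qed
      moreover have "(cdf (law_density f) \<longlongrightarrow> cdf (law_density f) x) (at_right x)"
        using L.cdf_is_right_cont[of x] by (simp add: continuous_within)
      ultimately have up: "(\<lambda>n. cdf (law_density f) (x + t n)) \<longlonglongrightarrow> cdf (law_density f) x"
        by (rule filterlim_compose[rotated])
      have mid: "(\<lambda>n. measure (law_density f) (A n)) \<longlonglongrightarrow> cdf (law_density f) x"
        by (rule tendsto_sandwich[OF _ _ tendsto_const up]) (use lower upper in auto)
      have "(\<lambda>n. (\<integral>y. F n y * indicator (A n) y \<partial>lborel) - measure (law_density f) (A n)) \<longlonglongrightarrow> 0"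
        by (rule Lim_null_comparison[OF _ eps]) (use diff in auto)
      from tendsto_add[OF this mid]
      have "(\<lambda>n. \<integral>y. F n y * indicator (A n) y \<partial>lborel) \<longlonglongrightarrow> cdf (law_density f) x" by simp
      thus ?thesis
        by (rule Lim_transform_eventually) (use P_eq in \<open>eventually_elim, simp\<close>)
    qed
  qed
qed

section \<open>The three limit densities\<close>

lemma nn_integral_FTC_open:
  fixes a b :: ereal and g F :: "real \<Rightarrow> real"
  assumes ab: "a < b"
    and F: "\<And>x. a < ereal x \<Longrightarrow> ereal x < b \<Longrightarrow> DERIV F x :> g x"
    and g: "\<And>x. a < ereal x \<Longrightarrow> ereal x < b \<Longrightarrow> isCont g x"
    and g0: "\<And>x. a < ereal x \<Longrightarrow> ereal x < b \<Longrightarrow> 0 \<le> g x"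
    and lims: "((F \<circ> real_of_ereal) \<longlongrightarrow> A) (at_right a)" "((F \<circ> real_of_ereal) \<longlongrightarrow> B) (at_left b)"
  shows "(\<integral>\<^sup>+ x. ennreal (if a < ereal x \<and> ereal x < b then g x else 0) \<partial>lborel) = ennreal (B - A)"
proof -
  have nn: "AE x in lborel. a < ereal x \<longrightarrow> ereal x < b \<longrightarrow> 0 \<le> g x" using g0 by simp
  note FTC = interval_integral_FTC_nonneg[OF ab F g nn lims]
  have eq: "indicator (einterval a b) x *\<^sub>R g x = (if a < ereal x \<and> ereal x < b then g x else 0)" for x
    by (simp add: einterval_iff indicator_def)
  have "integrable lborel (\<lambda>x. if a < ereal x \<and> ereal x < b then g x else 0)"
    using FTC(1) unfolding set_integrable_def eq .
  moreover have "(\<integral>x. (if a < ereal x \<and> ereal x < b then g x else 0) \<partial>lborel) = B - A"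
    using FTC(2) less_imp_le[OF ab] unfolding interval_lebesgue_integral_def set_lebesgue_integral_def eq
    by (simp only: if_True)
  ultimately show ?thesis
    using nn_integral_eq_integral[of lborel "\<lambda>x. if a < ereal x \<and> ereal x < b then g x else 0"] g0
    by auto
qed

text \<open>
  The error function.
\<close>

definition gauss_prob :: "real \<Rightarrow> real" where
  "gauss_prob t = 2 / sqrt pi * (LBINT u=0..t. exp (- u\<^sup>2))"

text \<open>
  The distribution function of $Z^2$ for a standard normal $Z$.  Each of the three densities is, up to
  sign, the derivative of a monotone substitution into it.
\<close>

definition chi_cdf :: "real \<Rightarrow> real" where
  "chi_cdf y = gauss_prob (sqrt (y / 2))"

lemma gauss_prob_deriv_within:
  assumes "0 \<le> t" "t \<le> b"
  shows "(gauss_prob has_real_derivative 2 / sqrt pi * exp (- t\<^sup>2)) (at t within {0..b})"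
proof -
  have "((\<lambda>u. LBINT y=(0::real)..u. exp (- y\<^sup>2)) has_vector_derivative exp (- t\<^sup>2)) (at t within {0..b})"
    using assms by (intro interval_integral_FTC2 continuous_intros) auto
  hence "((\<lambda>u. LBINT y=0..u. exp (- y\<^sup>2)) has_real_derivative exp (- t\<^sup>2)) (at t within {0..b})"
    by (simp add: has_real_derivative_iff_has_vector_derivative zero_ereal_def)
  thus ?thesis unfolding gauss_prob_def by (rule DERIV_cmult)
qed

lemma gauss_prob_deriv: "t > 0 \<Longrightarrow> DERIV gauss_prob t :> 2 / sqrt pi * exp (- t\<^sup>2)"
  using gauss_prob_deriv_within[of t "t + 1"] by (simp add: at_within_Icc_at)

lemma gauss_prob_0: "(gauss_prob \<longlongrightarrow> 0) (at_right 0)"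
proof -
  have "continuous (at 0 within {0..1}) gauss_prob"
    using gauss_prob_deriv_within[of 0 1] by (intro DERIV_continuous) auto
  hence "(gauss_prob \<longlongrightarrow> gauss_prob 0) (at_right 0)"
    by (simp add: continuous_within at_within_Icc_at_right)
  moreover have "gauss_prob 0 = 0"
    by (simp add: gauss_prob_def zero_ereal_def)
  ultimately show ?thesis by simp
qed

lemma gauss_prob_top: "(gauss_prob \<longlongrightarrow> 1) at_top"
proof -
  let ?f = "\<lambda>x::real. indicator {0..} x *\<^sub>R exp (- x\<^sup>2) :: real"
  have "((\<lambda>y. \<integral>x. indicator {..y} x *\<^sub>R ?f x \<partial>lborel) \<longlongrightarrow> (\<integral>x. ?f x \<partial>lborel)) at_top"
    using gaussian_moment_0 by (intro tendsto_integral_at_top) (auto simp: has_bochner_integral_iff)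
  also have "(\<integral>x. ?f x \<partial>lborel) = sqrt pi / 2"
    by (rule has_bochner_integral_integral_eq[OF gaussian_moment_0])
  finally have "((\<lambda>y. 2 / sqrt pi * (\<integral>x. indicator {..y} x *\<^sub>R ?f x \<partial>lborel)) \<longlongrightarrow> 2 / sqrt pi * (sqrt pi / 2)) at_top"
    by (rule tendsto_mult[OF tendsto_const])
  moreover have "2 / sqrt pi * (sqrt pi / 2) = 1" by simp
  ultimately have "((\<lambda>y. 2 / sqrt pi * (\<integral>x. indicator {..y} x *\<^sub>R ?f x \<partial>lborel)) \<longlongrightarrow> 1) at_top"
    by (simp only:)
  moreover have "\<forall>\<^sub>F y in at_top. 2 / sqrt pi * (\<integral>x. indicator {..y} x *\<^sub>R ?f x \<partial>lborel) = gauss_prob y"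
    using eventually_ge_at_top[of "0::real"]
  proof eventually_elim
    case (elim y)
    have "(LBINT u=ereal 0..ereal y. exp (- u\<^sup>2)) = (LBINT u:{0..y}. exp (- u\<^sup>2))"
      by (rule interval_integral_Icc[OF elim])
    also have "\<dots> = (\<integral>x. indicator {..y} x *\<^sub>R ?f x \<partial>lborel)"
      unfolding set_lebesgue_integral_def by (intro Bochner_Integration.integral_cong) (auto simp: indicator_def)
    finally show ?case by (simp add: gauss_prob_def zero_ereal_def)
  qed
  ultimately show ?thesis by (rule Lim_transform_eventually)
qed

lemma chi_cdf_deriv:
  assumes y: "y > 0"
  shows "DERIV chi_cdf y :> 1 / sqrt (2 * pi * y) * exp (- y / 2)"
proof -
  have "DERIV (\<lambda>y::real. y / 2) y :> 1 / 2" by (auto intro!: derivative_eq_intros)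
  from DERIV_chain2[OF DERIV_real_sqrt[of "y / 2"] this] y
  have "DERIV (\<lambda>y. sqrt (y / 2)) y :> inverse (sqrt (y / 2)) / 2 * (1 / 2)" by simp
  from DERIV_chain2[OF gauss_prob_deriv this]
  have "DERIV chi_cdf y :> 2 / sqrt pi * exp (- (sqrt (y / 2))\<^sup>2) * (inverse (sqrt (y / 2)) / 2 * (1 / 2))"
    using y unfolding chi_cdf_def by simp
  also have "2 / sqrt pi * exp (- (sqrt (y / 2))\<^sup>2) * (inverse (sqrt (y / 2)) / 2 * (1 / 2))
      = 1 / sqrt (2 * pi * y) * exp (- y / 2)"
  proof -
    have "sqrt 2 * sqrt 2 = (2::real)" by simp
    thus ?thesis using y
      by (simp add: real_sqrt_mult real_sqrt_divide inverse_eq_divide field_simps)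
  qed
  finally show ?thesis .
qed

lemma chi_cdf_0: "(chi_cdf \<longlongrightarrow> 0) (at_right 0)"
proof -
  have "filterlim (\<lambda>y::real. sqrt (y / 2)) (at_right 0) (at_right 0)" by real_asymp
  thus ?thesis unfolding chi_cdf_def by (rule filterlim_compose[OF gauss_prob_0])
qed

lemma chi_cdf_top: "(chi_cdf \<longlongrightarrow> 1) at_top"
proof -
  have "filterlim (\<lambda>y::real. sqrt (y / 2)) at_top at_top" by real_asymp
  thus ?thesis unfolding chi_cdf_def by (rule filterlim_compose[OF gauss_prob_top])
qed

lemma gamma_density_half:
  assumes "x > 0"
  shows "gamma_density (1/2) (1/2) x = 1 / sqrt (2 * pi * x) * exp (- x / 2)"
proof -
  have "x powr (1 / 2 - 1) = 1 / sqrt x"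
    using assms by (simp add: powr_minus powr_half_sqrt inverse_eq_divide)
  moreover have "(1 / 2 :: real) powr (1 / 2) = 1 / sqrt 2"
    by (simp add: powr_half_sqrt real_sqrt_divide)
  ultimately show ?thesis
    using assms by (simp add: gamma_density_def Gamma_one_half_real real_sqrt_mult)
qed

lemma nn_integral_gamma_density: "(\<integral>\<^sup>+ x. ennreal (gamma_density (1/2) (1/2) x) \<partial>lborel) = 1"
proof -
  let ?g = "\<lambda>x::real. 1 / sqrt (2 * pi * x) * exp (- x / 2)"
  have "(\<integral>\<^sup>+ x. ennreal (if ereal 0 < ereal x \<and> ereal x < \<infinity> then ?g x else 0) \<partial>lborel) = ennreal (1 - 0)"
  proof (rule nn_integral_FTC_open)
    show "DERIV chi_cdf x :> ?g x" if "ereal 0 < ereal x" for x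
      using that by (intro chi_cdf_deriv) simp
    show "isCont ?g x" if "ereal 0 < ereal x" for x
      using that by (intro continuous_intros) auto
    show "((chi_cdf \<circ> real_of_ereal) \<longlongrightarrow> 0) (at_right (ereal 0))"
      unfolding ereal_tendsto_simps by (rule chi_cdf_0)
    show "((chi_cdf \<circ> real_of_ereal) \<longlongrightarrow> 1) (at_left \<infinity>)"
      unfolding ereal_tendsto_simps by (rule chi_cdf_top)
  qed auto
  moreover have "(if ereal 0 < ereal x \<and> ereal x < \<infinity> then ?g x else 0) = gamma_density (1/2) (1/2) x" for x
  proof (cases "x > 0")
    case True thus ?thesis using gamma_density_half[OF True] by simp
  qed (simp add: gamma_density_def)
  ultimately show ?thesis by simp
qed

lemma levy_density_eq:
  assumes "x > 0"
  shows "levy_density x = sqrt (1 / x) / x * exp (- (1 / (2 * x))) / sqrt (2 * pi)"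
proof -
  have "x powr (3 / 2) = x powr (1 + 1 / 2)" by simp
  also have "\<dots> = x * sqrt x" using assms by (subst powr_add) (simp add: powr_half_sqrt)
  finally show ?thesis using assms by (simp add: levy_density_def real_sqrt_divide field_simps)
qed

lemma nn_integral_levy_density: "(\<integral>\<^sup>+ x. ennreal (levy_density x) \<partial>lborel) = 1"
proof -
  let ?g = "\<lambda>x::real. sqrt (1 / x) / x * exp (- (1 / (2 * x))) / sqrt (2 * pi)"
  have "(\<integral>\<^sup>+ x. ennreal (if ereal 0 < ereal x \<and> ereal x < \<infinity> then ?g x else 0) \<partial>lborel) = ennreal (0 - (- 1))"
  proof (rule nn_integral_FTC_open)
    show "DERIV (\<lambda>x. - chi_cdf (1 / x)) x :> ?g x" if "ereal 0 < ereal x" for x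
    proof -
      have x: "x > 0" using that by simp
      have "DERIV (\<lambda>x. 1 / x) x :> - (1 / x\<^sup>2)"
        using DERIV_inverse[of x UNIV] x by (simp add: inverse_eq_divide power2_eq_square)
      from DERIV_minus[OF DERIV_chain2[OF chi_cdf_deriv this]] x
      have "DERIV (\<lambda>x. - chi_cdf (1 / x)) x :> - (1 / sqrt (2 * pi * (1 / x)) * exp (- (1 / x) / 2) * (- (1 / x\<^sup>2)))"
        by simp
      also have "- (1 / sqrt (2 * pi * (1 / x)) * exp (- (1 / x) / 2) * (- (1 / x\<^sup>2))) = ?g x"
      proof -
        have s: "sqrt x * sqrt x = x" using x by simp
        have "1 / sqrt (2 * pi * (1 / x)) * (1 / x\<^sup>2) = sqrt x / x / x / sqrt (2 * pi)"
          by (simp add: real_sqrt_mult real_sqrt_divide power2_eq_square)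
        also have "sqrt x / x = sqrt (1 / x)"
          using x s by (simp add: real_sqrt_divide divide_simps)
        finally have e: "1 / sqrt (2 * pi * (1 / x)) * (1 / x\<^sup>2) = sqrt (1 / x) / x / sqrt (2 * pi)" .
        have ex: "exp (- (1 / x) / 2) = exp (- (1 / (2 * x)))" by (simp add: mult.commute)
        have "- (1 / sqrt (2 * pi * (1 / x)) * exp (- (1 / x) / 2) * (- (1 / x\<^sup>2)))
            = (1 / sqrt (2 * pi * (1 / x)) * (1 / x\<^sup>2)) * exp (- (1 / x) / 2)"
          by (simp only: mult_minus_right minus_minus mult_ac)
        also have "\<dots> = ?g x" unfolding e ex by simp
        finally show ?thesis .
      qed
      finally show ?thesis .
    qed
    show "isCont ?g x" if "ereal 0 < ereal x" for x
      using that by (intro continuous_intros) auto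
    have "filterlim (\<lambda>x::real. 1 / x) at_top (at_right 0)" by real_asymp
    hence "((\<lambda>x. - chi_cdf (1 / x)) \<longlongrightarrow> - 1) (at_right 0)"
      by (intro tendsto_minus filterlim_compose[OF chi_cdf_top])
    thus "(((\<lambda>x. - chi_cdf (1 / x)) \<circ> real_of_ereal) \<longlongrightarrow> - 1) (at_right (ereal 0))"
      unfolding ereal_tendsto_simps .
    have "filterlim (\<lambda>x::real. 1 / x) (at_right 0) at_top" by real_asymp
    hence "((\<lambda>x. - chi_cdf (1 / x)) \<longlongrightarrow> - 0) at_top"
      by (intro tendsto_minus filterlim_compose[OF chi_cdf_0])
    thus "(((\<lambda>x. - chi_cdf (1 / x)) \<circ> real_of_ereal) \<longlongrightarrow> 0) (at_left \<infinity>)"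
      unfolding ereal_tendsto_simps by simp
  qed auto
  moreover have "(if ereal 0 < ereal x \<and> ereal x < \<infinity> then ?g x else 0) = levy_density x" for x
  proof (cases "x > 0")
    case True thus ?thesis using levy_density_eq[OF True] by simp
  qed (simp add: levy_density_def)
  ultimately show ?thesis by simp
qed

lemma giant_fraction_density_eq:
  assumes "0 < x" "x < 1"
  shows "giant_fraction_density c x
    = c * sqrt (1 / (x * (1 - x))) / (1 - x) * exp (- (c\<^sup>2 * x / (2 * (1 - x)))) / sqrt (2 * pi)"
proof -
  have "(1 - x) powr (3 / 2) = (1 - x) powr (1 + 1 / 2)" by simp
  also have "\<dots> = (1 - x) * sqrt (1 - x)" using assms by (subst powr_add) (simp add: powr_half_sqrt)
  finally have p: "(1 - x) powr (3 / 2) = (1 - x) * sqrt (1 - x)" .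
  show ?thesis using assms
    unfolding giant_fraction_density_def p by (simp add: real_sqrt_mult real_sqrt_divide mult_ac)
qed

lemma nn_integral_giant_fraction_density:
  assumes c: "c > 0"
  shows "(\<integral>\<^sup>+ x. ennreal (giant_fraction_density c x) \<partial>lborel) = 1"
proof -
  let ?g = "\<lambda>x::real. c * sqrt (1 / (x * (1 - x))) / (1 - x) * exp (- (c\<^sup>2 * x / (2 * (1 - x)))) / sqrt (2 * pi)"
  let ?y = "\<lambda>x::real. c\<^sup>2 * x / (1 - x)"
  have "(\<integral>\<^sup>+ x. ennreal (if ereal 0 < ereal x \<and> ereal x < ereal 1 then ?g x else 0) \<partial>lborel) = ennreal (1 - 0)"
  proof (rule nn_integral_FTC_open)
    show "DERIV (\<lambda>x. chi_cdf (?y x)) x :> ?g x" if "ereal 0 < ereal x" "ereal x < ereal 1" for x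
    proof -
      have x: "x > 0" "x < 1" using that by auto
      have "DERIV ?y x :> (c\<^sup>2 * (1 - x) - c\<^sup>2 * x * (- 1)) / ((1 - x) * (1 - x))"
        using x by (intro DERIV_divide) (auto intro!: derivative_eq_intros)
      also have "(c\<^sup>2 * (1 - x) - c\<^sup>2 * x * (- 1)) = c\<^sup>2" by (simp add: algebra_simps)
      finally have "DERIV ?y x :> c\<^sup>2 / ((1 - x) * (1 - x))" .
      from DERIV_chain2[OF chi_cdf_deriv this] x c
      have "DERIV (\<lambda>x. chi_cdf (?y x)) x :> 1 / sqrt (2 * pi * ?y x) * exp (- ?y x / 2) * (c\<^sup>2 / ((1 - x) * (1 - x)))"
        by simp
      also have "1 / sqrt (2 * pi * ?y x) * exp (- ?y x / 2) * (c\<^sup>2 / ((1 - x) * (1 - x))) = ?g x"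
      proof -
        have s: "sqrt (1 - x) * sqrt (1 - x) = 1 - x" using x by simp
        have "1 / sqrt (2 * pi * ?y x) * (c\<^sup>2 / ((1 - x) * (1 - x)))
            = c * (sqrt (1 - x) / (1 - x)) / (sqrt x * (1 - x)) / sqrt (2 * pi)"
          using x c by (simp add: real_sqrt_mult real_sqrt_divide power2_eq_square divide_simps)
        also have "sqrt (1 - x) / (1 - x) = 1 / sqrt (1 - x)"
          using x s by (simp add: divide_simps)
        also have "c * (1 / sqrt (1 - x)) / (sqrt x * (1 - x)) / sqrt (2 * pi)
            = c * sqrt (1 / (x * (1 - x))) / (1 - x) / sqrt (2 * pi)"
          by (simp add: real_sqrt_mult real_sqrt_divide)
        finally have e: "1 / sqrt (2 * pi * ?y x) * (c\<^sup>2 / ((1 - x) * (1 - x)))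
            = c * sqrt (1 / (x * (1 - x))) / (1 - x) / sqrt (2 * pi)" .
        have "- ?y x / 2 = - (c\<^sup>2 * x / (2 * (1 - x)))" by simp
        hence "1 / sqrt (2 * pi * ?y x) * exp (- ?y x / 2) * (c\<^sup>2 / ((1 - x) * (1 - x)))
            = (1 / sqrt (2 * pi * ?y x) * (c\<^sup>2 / ((1 - x) * (1 - x)))) * exp (- (c\<^sup>2 * x / (2 * (1 - x))))"
          by (simp only: mult_ac)
        thus ?thesis unfolding e by simp
      qed
      finally show ?thesis .
    qed
    show "isCont ?g x" if "ereal 0 < ereal x" "ereal x < ereal 1" for x
      using that by (intro continuous_intros) auto
    show "0 \<le> ?g x" if "ereal 0 < ereal x" "ereal x < ereal 1" for x
      using that c by simp
    have "filterlim ?y (at_right 0) (at_right 0)" using c by real_asymp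
    hence "((\<lambda>x. chi_cdf (?y x)) \<longlongrightarrow> 0) (at_right 0)"
      by (intro filterlim_compose[OF chi_cdf_0])
    thus "(((\<lambda>x. chi_cdf (?y x)) \<circ> real_of_ereal) \<longlongrightarrow> 0) (at_right (ereal 0))"
      unfolding ereal_tendsto_simps .
    have "filterlim ?y at_top (at_left 1)" using c by real_asymp
    hence "((\<lambda>x. chi_cdf (?y x)) \<longlongrightarrow> 1) (at_left 1)"
      by (intro filterlim_compose[OF chi_cdf_top])
    thus "(((\<lambda>x. chi_cdf (?y x)) \<circ> real_of_ereal) \<longlongrightarrow> 1) (at_left (ereal 1))"
      unfolding ereal_tendsto_simps .
  qed auto
  moreover have "(if ereal 0 < ereal x \<and> ereal x < ereal 1 then ?g x else 0) = giant_fraction_density c x" for x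
  proof (cases "x > 0 \<and> x < 1")
    case True thus ?thesis using giant_fraction_density_eq[of x c] by simp
  next
    case False thus ?thesis by (auto simp: giant_fraction_density_def)
  qed
  ultimately show ?thesis by simp
qed

lemma density_measurable [measurable]:
  "gamma_density a b \<in> borel_measurable borel"
  "levy_density \<in> borel_measurable borel"
  "giant_fraction_density c \<in> borel_measurable borel"
  unfolding gamma_density_def levy_density_def giant_fraction_density_def by measurable

section \<open>Limits in the discrete regimes\<close>

lemma set_pmf_R:
  assumes "n \<ge> 1" "k \<le> n"
  shows "set_pmf (R n k) \<subseteq> {..k}"
proof
  fix m assume "m \<in> set_pmf (R n k)"
  hence "pmf (R n k) m \<noteq> 0" by (simp add: set_pmf_iff)
  thus "m \<in> {..k}" using pmf_root_cluster[OF assms, of m] by (auto split: if_splits)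
qed

text \<open>
  Two of the limit theorems speak about $n - R$ or $k - R$; subtraction on the natural numbers is
  harmless on the support.
\<close>

lemma pmf_map_diff:
  fixes p :: "nat pmf"
  assumes "set_pmf p \<subseteq> {..N}" "j \<le> N"
  shows "pmf (map_pmf (\<lambda>m. N - m) p) j = pmf p (N - j)"
proof -
  have "N - m = j \<longleftrightarrow> m = N - j" if "m \<in> set_pmf p" for m
  proof -
    have "m \<le> N" using that assms(1) by auto
    thus ?thesis using assms(2) by arith
  qed
  hence "measure (measure_pmf p) ((\<lambda>m. N - m) -` {j}) = measure (measure_pmf p) {N - j}"
    by (intro measure_pmf.finite_measure_eq_AE) (auto simp: AE_measure_pmf_iff)
  thus ?thesis by (simp add: pmf_map measure_pmf_single)
qed

lemma binomial_over_power_limit: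
  fixes k :: "nat \<Rightarrow> nat"
  assumes "(\<lambda>n. real (k n) / real n) \<longlonglongrightarrow> \<alpha>"
  shows "(\<lambda>n. real (k n choose m) / real n ^ m) \<longlonglongrightarrow> \<alpha> ^ m / fact m"
proof -
  have "(\<lambda>n. (real (k n) - real i) / real n) \<longlonglongrightarrow> \<alpha>" for i
  proof -
    have "(\<lambda>n. real i / real n) \<longlonglongrightarrow> 0" by real_asymp
    from tendsto_diff[OF assms this] show ?thesis by (simp add: diff_divide_distrib)
  qed
  hence "(\<lambda>n. (\<Prod>i = 0..<m. (real (k n) - real i) / real n) / fact m) \<longlonglongrightarrow> (\<Prod>i = 0..<m. \<alpha>) / fact m"
    by (intro tendsto_divide tendsto_prod tendsto_const) auto
  moreover have "(\<Prod>i = 0..<m. (real (k n) - real i) / real n) / fact m = real (k n choose m) / real n ^ m" for n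
    by (simp add: binomial_gbinomial gbinomial_prod_rev prod_dividef)
  ultimately show ?thesis by simp
qed

text \<open>
  For fixed $m$ the mass is $m^m \cdot \binom{k}{m} n^{-m} \cdot \frac{1 - k/n}{1 - m/n} \cdot (1 - m/n)^{k-m}$,
  and the factors have the limits $m^m$, $\alpha^m / m!$, $1 - \alpha$ and $e^{-\alpha m}$.
\<close>

lemma pmf_R_limit_proportional:
  fixes k :: "nat \<Rightarrow> nat"
  assumes a: "0 < \<alpha>" "\<alpha> < 1" and k: "(\<lambda>n. real (k n) / real n) \<longlonglongrightarrow> \<alpha>"
  shows "(\<lambda>n. pmf (R n (k n)) m) \<longlonglongrightarrow> (if m = 0 then 1 - \<alpha>
               else real m ^ m / fact m * (1 - \<alpha>) * \<alpha> ^ m * exp (- \<alpha> * real m))"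
proof -
  have kn: "\<forall>\<^sub>F n in sequentially. n \<ge> 1 \<and> k n < n"
    using order_tendstoD(2)[OF k a(2)] eventually_ge_at_top[of 1]
    by eventually_elim (auto simp: divide_simps)
  show ?thesis
  proof (cases "m = 0")
    case True
    have "(\<lambda>n. 1 - real (k n) / real n) \<longlonglongrightarrow> 1 - \<alpha>"
      by (intro tendsto_diff tendsto_const k)
    moreover have "\<forall>\<^sub>F n in sequentially. 1 - real (k n) / real n = pmf (R n (k n)) m"
      using kn by eventually_elim (simp add: pmf_root_cluster True)
    ultimately show ?thesis using True by (simp add: Lim_transform_eventually)
  next
    case False
    have mk: "\<forall>\<^sub>F n in sequentially. m \<le> k n"
    proof -
      have "filterlim (\<lambda>n. real (k n) / real n * real n) at_top sequentially"
        by (rule filterlim_tendsto_pos_mult_at_top[OF k a(1) filterlim_real_sequentially])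
      hence "\<forall>\<^sub>F n in sequentially. real m \<le> real (k n) / real n * real n"
        by (simp add: filterlim_at_top)
      thus ?thesis using kn by eventually_elim simp
    qed
    have "(\<lambda>n. (real (k n) / real n - real m / real n) * (real n * ln (1 - real m / real n))) \<longlonglongrightarrow> (\<alpha> - 0) * (- real m)"
    proof (intro tendsto_mult tendsto_diff k)
      show "(\<lambda>n. real m / real n) \<longlonglongrightarrow> 0" by real_asymp
      show "(\<lambda>n. real n * ln (1 - real m / real n)) \<longlonglongrightarrow> - real m" using False by real_asymp
    qed
    hence 1: "(\<lambda>n. exp ((real (k n) / real n - real m / real n) * (real n * ln (1 - real m / real n)))) \<longlonglongrightarrow> exp (- \<alpha> * real m)"
      by (intro tendsto_exp) simp
    have "(\<lambda>n. real m / real n) \<longlonglongrightarrow> 0" by real_asymp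
    hence 2: "(\<lambda>n. (1 - real (k n) / real n) / (1 - real m / real n)) \<longlonglongrightarrow> (1 - \<alpha>) / (1 - 0)"
      by (intro tendsto_divide tendsto_diff tendsto_const k) auto
    have "(\<lambda>n. real m ^ m * (real (k n choose m) / real n ^ m) * ((1 - real (k n) / real n) / (1 - real m / real n))
        * exp ((real (k n) / real n - real m / real n) * (real n * ln (1 - real m / real n))))
      \<longlonglongrightarrow> real m ^ m * (\<alpha> ^ m / fact m) * ((1 - \<alpha>) / (1 - 0)) * exp (- \<alpha> * real m)"
      by (intro tendsto_mult tendsto_const 1 2 binomial_over_power_limit k)
    moreover have "\<forall>\<^sub>F n in sequentially. real m ^ m * (real (k n choose m) / real n ^ m) * ((1 - real (k n) / real n) / (1 - real m / real n))
        * exp ((real (k n) / real n - real m / real n) * (real n * ln (1 - real m / real n))) = pmf (R n (k n)) m"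
      using kn mk
    proof eventually_elim
      case (elim n)
      have pos: "real n > 0" "real n - real m > 0" using elim by auto
      have "real (k n) / real n - real m / real n = real (k n - m) / real n"
        using elim by (simp add: of_nat_diff diff_divide_distrib)
      hence e0: "(real (k n) / real n - real m / real n) * (real n * ln (1 - real m / real n))
          = real (k n - m) * ln (1 - real m / real n)" using pos by simp
      have y: "1 - real m / real n = (real n - real m) / real n" using pos by (simp add: field_simps)
      have e: "exp ((real (k n) / real n - real m / real n) * (real n * ln (1 - real m / real n)))
          = (real n - real m) ^ (k n - m) / real n ^ (k n - m)"
        unfolding e0 unfolding y using pos by (simp add: exp_of_nat_mult power_divide)
      have p: "(real n - real m) powi (int (k n) - int m - 1) = (real n - real m) ^ (k n - m) / (real n - real m)"
      proof -
        have "int (k n) - int m - 1 = int (k n - m) - 1" using elim by simp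
        moreover have "(real n - real m) powi (int i - 1) = (real n - real m) ^ i / (real n - real m)" for i
          using pos by (simp add: power_int_diff)
        ultimately show ?thesis by (simp only:)
      qed
      have n: "real n ^ k n = real n ^ m * real n ^ (k n - m)"
        using elim by (simp flip: power_add)
      have "(1 - real (k n) / real n) / (1 - real m / real n) = (real n - real (k n)) / (real n - real m)"
        using pos by (simp add: field_simps)
      moreover have "pmf (R n (k n)) m = real m ^ m * (real n - real (k n)) * (real n - real m) powi (int (k n) - int m - 1)
               / real n ^ k n * real (k n choose m)"
        using pmf_root_cluster[of n "k n" m] elim False by simp
      ultimately show ?case unfolding e unfolding p n by (simp add: mult_ac)
    qed
    ultimately have "(\<lambda>n. pmf (R n (k n)) m) \<longlonglongrightarrow> real m ^ m * (\<alpha> ^ m / fact m) * ((1 - \<alpha>) / (1 - 0)) * exp (- \<alpha> * real m)"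
      by (rule Lim_transform_eventually)
    thus ?thesis using False by (simp add: mult_ac)
  qed
qed

text \<open>
  With $m = n - d - j$ the mass is
  $(m/n)^m \cdot \binom{n-d}{j} n^{-j} \cdot d (d+j)^{j-1}$, where $m/n = 1 - (d+j)/n$.
\<close>

lemma pmf_R_limit_constant:
  assumes d: "d > 0"
  shows "(\<lambda>n. pmf (map_pmf (\<lambda>m. (n - d) - m) (R n (n - d))) j)
    \<longlonglongrightarrow> exp (- real d) * (real d * real (d + j) powi (int j - 1) / fact j) * exp (- real j)"
proof -
  let ?a = "real (d + j)"
  have "(\<lambda>n. real (n - d) / real n) \<longlonglongrightarrow> 1"
  proof -
    have "(\<lambda>n. (real n - real d) / real n) \<longlonglongrightarrow> 1" by real_asymp
    moreover have "\<forall>\<^sub>F n in sequentially. (real n - real d) / real n = real (n - d) / real n"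
      using eventually_ge_at_top[of d] by eventually_elim simp
    ultimately show ?thesis by (rule Lim_transform_eventually)
  qed
  from binomial_over_power_limit[OF this, of j]
  have 1: "(\<lambda>n. real (n - d choose j) / real n ^ j) \<longlonglongrightarrow> 1 / fact j" by simp
  have "(\<lambda>n. (real n - ?a) * ln (1 - ?a / real n)) \<longlonglongrightarrow> - ?a" using d by real_asymp
  hence 2: "(\<lambda>n. exp ((real n - ?a) * ln (1 - ?a / real n))) \<longlonglongrightarrow> exp (- ?a)"
    by (intro tendsto_exp)
  have "(\<lambda>n. exp ((real n - ?a) * ln (1 - ?a / real n)) * (real (n - d choose j) / real n ^ j) * (real d * ?a powi (int j - 1)))
      \<longlonglongrightarrow> exp (- ?a) * (1 / fact j) * (real d * ?a powi (int j - 1))"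
    by (intro tendsto_mult tendsto_const 1 2)
  moreover have "\<forall>\<^sub>F n in sequentially. exp ((real n - ?a) * ln (1 - ?a / real n)) * (real (n - d choose j) / real n ^ j) * (real d * ?a powi (int j - 1))
      = pmf (map_pmf (\<lambda>m. (n - d) - m) (R n (n - d))) j"
    using eventually_gt_at_top[of "d + j"]
  proof eventually_elim
    case (elim n)
    define m where "m = n - d - j"
    have m: "n - d = m + j" "n = m + (d + j)" "m > 0" "real m = real n - ?a"
      using elim by (auto simp: m_def)
    have "pmf (map_pmf (\<lambda>m. (n - d) - m) (R n (n - d))) j = pmf (R n (n - d)) m"
      unfolding m_def using elim by (intro pmf_map_diff set_pmf_R) auto
    also have "\<dots> = real m ^ m * real d * ?a powi (int j - 1) / real n ^ (m + j) * real (n - d choose m)"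
    proof -
      have e: "real n - real m = ?a" "real n - real (n - d) = real d" "int (n - d) - int m - 1 = int j - 1"
        using m elim by auto
      have c: "(m = 0) = False" "m \<le> n - d" "n - d < n" using m d elim by auto
      have "pmf (R n (n - d)) m = real m ^ m * (real n - real (n - d)) * (real n - real m) powi (int (n - d) - int m - 1)
          / real n ^ (n - d) * real (n - d choose m)"
        using pmf_root_cluster[of n "n - d" m] c by simp
      thus ?thesis unfolding e unfolding m(1) .
    qed
    also have "n - d choose m = (n - d choose j)"
      using binomial_symmetric[of j "n - d"] elim unfolding m_def by simp
    also have "real m ^ m * real d * ?a powi (int j - 1) / real n ^ (m + j) * real (n - d choose j)
        = (real m / real n) ^ m * (real (n - d choose j) / real n ^ j) * (real d * ?a powi (int j - 1))"
      by (simp add: power_add power_divide)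
    also have "(real m / real n) ^ m = exp ((real n - ?a) * ln (1 - ?a / real n))"
    proof -
      have "1 - ?a / real n = real m / real n" using m elim by (simp add: field_simps)
      moreover have "real m / real n > 0" using m elim by simp
      ultimately show ?thesis unfolding m(4)[symmetric] by (simp add: exp_of_nat_mult)
    qed
    finally show ?case by simp
  qed
  ultimately have "(\<lambda>n. pmf (map_pmf (\<lambda>m. (n - d) - m) (R n (n - d))) j)
      \<longlonglongrightarrow> exp (- ?a) * (1 / fact j) * (real d * ?a powi (int j - 1))"
    by (rule Lim_transform_eventually)
  moreover have "exp (- ?a) = exp (- real d) * exp (- real j)" by (simp flip: exp_add)
  ultimately show ?thesis by (simp add: mult_ac)
qed

lemma R_tendsto_0:
  fixes k :: "nat \<Rightarrow> nat"
  assumes k: "(\<lambda>n. real (k n)) \<in> o(\<lambda>n. real n)"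
  shows "tendsto_in_prob_const (\<lambda>n. law (R n (k n)) real) 0"
  unfolding tendsto_in_prob_const_def
proof (intro allI impI)
  fix \<epsilon> :: real assume \<epsilon>: "\<epsilon> > 0"
  have lim: "(\<lambda>n. real (k n) / real n) \<longlonglongrightarrow> 0" using smalloD_tendsto[OF k] .
  have ev: "\<forall>\<^sub>F n in sequentially. n \<ge> 1 \<and> k n \<le> n"
    using order_tendstoD(2)[OF lim zero_less_one] eventually_ge_at_top[of 1]
    by eventually_elim (auto simp: divide_simps)
  show "(\<lambda>n. measure (law (R n (k n)) real) {x. \<epsilon> < \<bar>x - 0\<bar>}) \<longlonglongrightarrow> 0"
  proof (rule tendsto_sandwich[OF _ _ tendsto_const lim])
    show "\<forall>\<^sub>F n in sequentially. measure (law (R n (k n)) real) {x. \<epsilon> < \<bar>x - 0\<bar>} \<le> real (k n) / real n"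
      using ev
    proof eventually_elim
      case (elim n)
      have "measure (law (R n (k n)) real) {x. \<epsilon> < \<bar>x - 0\<bar>} = measure (measure_pmf (R n (k n))) {m. \<epsilon> < real m}"
        unfolding law_def by (subst measure_distr) (auto simp: vimage_def)
      also have "\<dots> \<le> measure (measure_pmf (R n (k n))) (UNIV - {0})"
        using \<epsilon> by (intro measure_pmf.finite_measure_mono) auto
      also have "\<dots> = 1 - pmf (R n (k n)) 0"
        using measure_pmf.prob_compl[of "{0}" "R n (k n)"] by (simp add: measure_pmf_single)
      also have "\<dots> = real (k n) / real n" using elim by (simp add: pmf_root_cluster)
      finally show ?case .
    qed
  qed auto
qed

section \<open>Limits in the continuous regimes\<close>

lemma lattice_floor:
  fixes s :: "nat \<Rightarrow> real"
  assumes s: "\<forall>\<^sub>F n in sequentially. s n > 0" "s \<longlonglongrightarrow> 0" and x: "x > 0"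
  shows "(\<lambda>n. s n * real (nat \<lfloor>x / s n\<rfloor>)) \<longlonglongrightarrow> x"
    and "filterlim (\<lambda>n. nat \<lfloor>x / s n\<rfloor>) at_top sequentially"
proof -
  have b: "\<forall>\<^sub>F n in sequentially. x - s n \<le> s n * real (nat \<lfloor>x / s n\<rfloor>) \<and> s n * real (nat \<lfloor>x / s n\<rfloor>) \<le> x"
    using s(1)
  proof eventually_elim
    case (elim n)
    have "real (nat \<lfloor>x / s n\<rfloor>) = of_int \<lfloor>x / s n\<rfloor>" using elim x by simp
    hence "x / s n - 1 \<le> real (nat \<lfloor>x / s n\<rfloor>)" "real (nat \<lfloor>x / s n\<rfloor>) \<le> x / s n" by linarith+
    thus ?case using elim by (simp add: field_simps)
  qed
  have "(\<lambda>n. x - s n) \<longlonglongrightarrow> x" using tendsto_diff[OF tendsto_const s(2), of x] by simp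
  thus "(\<lambda>n. s n * real (nat \<lfloor>x / s n\<rfloor>)) \<longlonglongrightarrow> x"
    by (rule tendsto_sandwich[rotated 2, OF _ tendsto_const]) (use b in \<open>eventually_elim, simp\<close>)+
  have "filterlim s (at_right 0) sequentially"
    using s by (auto simp: filterlim_at elim: eventually_mono)
  hence "filterlim (\<lambda>n. inverse (s n)) at_top sequentially"
    by (rule filterlim_compose[OF filterlim_inverse_at_top_right])
  from filterlim_tendsto_pos_mult_at_top[OF tendsto_const x this]
  have "filterlim (\<lambda>n. x / s n) at_top sequentially" by (simp add: divide_inverse)
  thus "filterlim (\<lambda>n. nat \<lfloor>x / s n\<rfloor>) at_top sequentially"
    by (intro filterlim_compose[OF filterlim_nat_sequentially] filterlim_compose[OF filterlim_floor_sequentially])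
qed

lemma filterlim_nat_real:
  fixes f :: "nat \<Rightarrow> nat"
  assumes "filterlim g at_top sequentially" "\<forall>\<^sub>F n in sequentially. g n = real (f n)"
  shows "filterlim f at_top sequentially"
  unfolding filterlim_sequentially_iff_filterlim_real
  using filterlim_cong[OF refl refl assms(2)] assms(1) by simp

lemma tendsto_eventually_eq:
  assumes "(f \<longlongrightarrow> a) F" "\<forall>\<^sub>F x in F. f x = g x" "a = b"
  shows "(g \<longlongrightarrow> b) F"
  using Lim_transform_eventually[OF assms(1,2)] assms(3) by simp

text \<open>
  The local limit for clusters that leave a positive fraction of the tree, $m/n \to \xi < 1$, in terms
  of the proportions $u = d/n$ and $v = m/n$.  It covers the regimes $d \gg \sqrt n$ (with $\xi = 0$) and
  $d \sim c \sqrt n$; for smaller $d$ the cluster is almost everything and $\xi = 1$.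
\<close>

lemma pmf_R_local_limit_linear:
  fixes d m :: "nat \<Rightarrow> nat" and s u v :: "nat \<Rightarrow> real"
  assumes d1: "\<forall>\<^sub>F n in sequentially. 1 \<le> d n" and m_inf: "filterlim m at_top sequentially"
    and u_def: "\<And>n. u n = real (d n) / real n" and v_def: "\<And>n. v n = real (m n) / real n"
    and u: "u \<longlonglongrightarrow> 0" and v: "v \<longlonglongrightarrow> \<xi>" and \<xi>: "\<xi> < 1"
    and l: "(\<lambda>n. real n * u n ^ 2 * v n) \<longlonglongrightarrow> l"
    and a: "(\<lambda>n. u n * sqrt (1 / (real n * v n)) / s n) \<longlonglongrightarrow> a"
  shows "(\<lambda>n. pmf (R n (n - d n)) (m n) / s n)
    \<longlonglongrightarrow> (a * sqrt (1 / (1 - \<xi>)) / (1 - \<xi>)) * exp (- (l / (2 * (1 - \<xi>)))) / sqrt (2 * pi)"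
proof -
  have \<xi>1: "1 - \<xi> > 0" using \<xi> by simp
  have uv: "(\<lambda>n. 1 - u n - v n) \<longlonglongrightarrow> 1 - \<xi>" using tendsto_diff[OF tendsto_diff[OF tendsto_const u] v, of 1] by simp
  have u1: "(\<lambda>n. 1 - u n) \<longlonglongrightarrow> 1" using tendsto_diff[OF tendsto_const u, of 1] by simp
  have v1: "(\<lambda>n. 1 - v n) \<longlonglongrightarrow> 1 - \<xi>" by (intro tendsto_diff tendsto_const v)
  have m1: "\<forall>\<^sub>F n in sequentially. m n \<ge> 1" using m_inf by (simp add: filterlim_at_top)
  have ev: "\<forall>\<^sub>F n in sequentially. real n > 0 \<and> 1 - u n - v n > 0 \<and> 1 \<le> d n \<and> 1 \<le> m n
      \<and> real (d n) = real n * u n \<and> real (m n) = real n * v n \<and> v n > 0"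
    using d1 order_tendstoD(1)[OF uv \<xi>1] m1 eventually_gt_at_top[of 0]
    by eventually_elim (simp add: u_def v_def)
  have rescale: "\<forall>\<^sub>F n in sequentially. real n > 0 \<and> v n > 0
      \<and> real n - real (d n) - real (m n) = real n * (1 - u n - v n)
      \<and> real n - real (d n) = real n * (1 - u n) \<and> real n - real (m n) = real n * (1 - v n)
      \<and> real (d n) = real n * u n \<and> real (m n) = real n * v n"
    using ev by eventually_elim (simp add: algebra_simps)
  have small: "\<forall>\<^sub>F n in sequentially. 1 \<le> d n \<and> 1 \<le> m n \<and> d n + m n < n"
    using ev
  proof eventually_elim
    case (elim n)
    hence "real n * (1 - u n - v n) > 0" by simp
    hence "real (d n) + real (m n) < real n" using elim by (simp add: algebra_simps)
    thus ?case using elim by linarith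
  qed
  show ?thesis
  proof (rule pmf_R_local_limit[OF small m_inf])
    show "filterlim (\<lambda>n. n - d n - m n) at_top sequentially"
    proof (rule filterlim_nat_real)
      show "filterlim (\<lambda>n. (1 - u n - v n) * real n) at_top sequentially"
        by (rule filterlim_tendsto_pos_mult_at_top[OF uv \<xi>1 filterlim_real_sequentially])
      show "\<forall>\<^sub>F n in sequentially. (1 - u n - v n) * real n = real (n - d n - m n)"
        using ev small
      proof eventually_elim
        case (elim n)
        hence "real (n - d n - m n) = real n - real (d n) - real (m n)" by simp
        thus ?case using elim by (simp add: algebra_simps)
      qed
    qed
    have "(\<lambda>n. u n / (1 - u n - v n)) \<longlonglongrightarrow> 0 / (1 - \<xi>)" using \<xi>1 by (intro tendsto_divide u uv) simp
    moreover have "\<forall>\<^sub>F n in sequentially. u n / (1 - u n - v n) = real (d n) / (real n - real (d n) - real (m n))"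
      using rescale
    proof eventually_elim
      case (elim n)
      hence e: "real n - real (d n) - real (m n) = real n * (1 - u n - v n)" "real (d n) = real n * u n" by blast+
      show ?case unfolding e(1) unfolding e(2) using elim by simp
    qed
    ultimately show "(\<lambda>n. real (d n) / (real n - real (d n) - real (m n))) \<longlonglongrightarrow> 0"
      by (rule tendsto_eventually_eq) simp
    have "(\<lambda>n. real n * u n ^ 2 * v n / (2 * (1 - u n - v n) * (1 - u n))) \<longlonglongrightarrow> l / (2 * (1 - \<xi>) * 1)"
      using \<xi>1 by (intro tendsto_divide tendsto_mult tendsto_const l uv u1) simp
    moreover have "\<forall>\<^sub>F n in sequentially. real n * u n ^ 2 * v n / (2 * (1 - u n - v n) * (1 - u n))
        = real (d n) ^ 2 * real (m n) / (2 * (real n - real (d n) - real (m n)) * (real n - real (d n)))"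
      using rescale
    proof eventually_elim
      case (elim n)
      hence e: "real n - real (d n) - real (m n) = real n * (1 - u n - v n)" "real n - real (d n) = real n * (1 - u n)"
        "real (d n) = real n * u n" "real (m n) = real n * v n" and n0: "real n > 0" by blast+
      have alg: "N * U ^ 2 * V / (2 * b * c) = (N * U) ^ 2 * (N * V) / (2 * (N * b) * (N * c))" if "N > 0" for N U V b c :: real
        using that by (simp add: power2_eq_square mult_ac)
      show ?case unfolding e(1) unfolding e(2) unfolding e(3,4) by (rule alg[OF n0])
    qed
    ultimately show "(\<lambda>n. real (d n) ^ 2 * real (m n) / (2 * (real n - real (d n) - real (m n)) * (real n - real (d n))))
        \<longlonglongrightarrow> l / (2 * (1 - \<xi>))"
      by (rule tendsto_eventually_eq) simp
    have "(\<lambda>n. u n * sqrt (1 / (real n * v n)) / s n * sqrt ((1 - u n) / (1 - u n - v n)) / (1 - v n))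
        \<longlonglongrightarrow> a * sqrt (1 / (1 - \<xi>)) / (1 - \<xi>)"
      using \<xi>1 by (intro tendsto_divide tendsto_mult tendsto_real_sqrt a uv u1 v1) auto
    moreover have "\<forall>\<^sub>F n in sequentially. u n * sqrt (1 / (real n * v n)) / s n * sqrt ((1 - u n) / (1 - u n - v n)) / (1 - v n)
        = real (d n) * sqrt ((real n - real (d n)) / (real (m n) * (real n - real (d n) - real (m n)))) / (real n - real (m n)) / s n"
      using rescale
    proof eventually_elim
      case (elim n)
      hence e: "real n - real (d n) - real (m n) = real n * (1 - u n - v n)" "real n - real (d n) = real n * (1 - u n)"
        "real n - real (m n) = real n * (1 - v n)" "real (d n) = real n * u n" "real (m n) = real n * v n"
        and n0: "real n > 0" by blast+
      have "(real n * (1 - u n)) / (real n * v n * (real n * (1 - u n - v n))) = 1 / (real n * v n) * ((1 - u n) / (1 - u n - v n))"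
        using n0 by simp
      hence sq: "sqrt ((real n * (1 - u n)) / (real n * v n * (real n * (1 - u n - v n))))
          = sqrt (1 / (real n * v n)) * sqrt ((1 - u n) / (1 - u n - v n))" by (simp only: real_sqrt_mult)
      have alg: "U * S / t * r / w = N * U * (S * r) / (N * w) / t" if "N > 0" for U S t r w N :: real
        using that by (simp add: mult_ac)
      show ?case unfolding e(1) unfolding e(2,3) unfolding e(4,5) sq by (rule alg[OF n0])
    qed
    ultimately show "(\<lambda>n. real (d n) * sqrt ((real n - real (d n)) / (real (m n) * (real n - real (d n) - real (m n)))) / (real n - real (m n)) / s n)
        \<longlonglongrightarrow> a * sqrt (1 / (1 - \<xi>)) / (1 - \<xi>)"
      by (rule tendsto_eventually_eq) simp
  qed
qed

text \<open>
  Here $m \approx x n^2 / d^2$ is $o(n)$ because $d$ dominates $\sqrt n$.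
\<close>

lemma R_weak_conv_gamma:
  fixes d :: "nat \<Rightarrow> nat"
  assumes d1: "(\<lambda>n. real (d n)) \<in> \<omega>(\<lambda>n. sqrt (real n))" and d2: "(\<lambda>n. real (d n)) \<in> o(\<lambda>n. real n)"
  shows "weak_conv_m (\<lambda>n. law (R n (n - d n)) (\<lambda>m. (real (d n) / real n)\<^sup>2 * real m))
           (law_density (gamma_density (1/2) (1/2)))"
proof -
  define s where "s n = (real (d n) / real n)\<^sup>2" for n
  define u where "u n = real (d n) / real n" for n
  have u: "u \<longlonglongrightarrow> 0" unfolding u_def using smalloD_tendsto[OF d2] .
  have dpos: "\<forall>\<^sub>F n in sequentially. n \<ge> 1 \<and> d n \<ge> 1"
  proof -
    have "\<forall>\<^sub>F n in sequentially. norm (sqrt (real n)) \<le> 1 * norm (real (d n))"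
      using landau_o.smallD[OF d1[unfolded smallomega_iff_smallo], of 1] by simp
    thus ?thesis using eventually_ge_at_top[of 1]
    proof eventually_elim
      case (elim n)
      have "sqrt (real n) \<ge> 1" "sqrt (real n) \<le> real (d n)" using elim by simp_all
      hence "real (d n) \<ge> 1" by linarith
      thus ?case using elim by simp
    qed
  qed
  have spos: "\<forall>\<^sub>F n in sequentially. s n > 0"
    using dpos by eventually_elim (simp add: s_def)
  have "s = (\<lambda>n. u n ^ 2)" by (simp add: s_def u_def fun_eq_iff)
  hence s0: "s \<longlonglongrightarrow> 0" using tendsto_power[OF u, of 2] by simp
  have sn: "(\<lambda>n. 1 / (s n * real n)) \<longlonglongrightarrow> 0"
  proof -
    have "(\<lambda>n. (sqrt (real n) / real (d n)) ^ 2) \<longlonglongrightarrow> 0 ^ 2"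
      by (intro tendsto_power smalloD_tendsto) (use d1 in \<open>simp add: smallomega_iff_smallo\<close>)
    moreover have "\<forall>\<^sub>F n in sequentially. (sqrt (real n) / real (d n)) ^ 2 = 1 / (s n * real n)"
      using dpos by eventually_elim (simp add: s_def power_divide field_simps power2_eq_square)
    ultimately have "(\<lambda>n. 1 / (s n * real n)) \<longlonglongrightarrow> 0 ^ 2" by (rule Lim_transform_eventually)
    thus ?thesis by simp
  qed
  have "weak_conv_m (\<lambda>n. law (R n (n - d n)) (\<lambda>m. s n * real m)) (law_density (gamma_density (1/2) (1/2)))"
  proof (rule weak_conv_m_lattice[OF _ _ _ nn_integral_gamma_density spos s0])
    fix x :: real assume x: "x > 0"
    define m where "m n = nat \<lfloor>x / s n\<rfloor>" for n
    define v where "v n = real (m n) / real n" for n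
    have ms: "(\<lambda>n. s n * real (m n)) \<longlonglongrightarrow> x" and m_inf: "filterlim m at_top sequentially"
      unfolding m_def using lattice_floor[OF spos s0 x] by simp_all
    have v: "v \<longlonglongrightarrow> 0"
    proof -
      have "(\<lambda>n. s n * real (m n) * (1 / (s n * real n))) \<longlonglongrightarrow> x * 0" by (intro tendsto_mult ms sn)
      moreover have "\<forall>\<^sub>F n in sequentially. s n * real (m n) * (1 / (s n * real n)) = v n"
        using spos by eventually_elim (simp add: v_def)
      ultimately have "v \<longlonglongrightarrow> x * 0" by (rule Lim_transform_eventually)
      thus ?thesis by simp
    qed
    have "(\<lambda>n. pmf (R n (n - d n)) (m n) / s n)
        \<longlonglongrightarrow> (1 / sqrt x * sqrt (1 / (1 - 0)) / (1 - 0)) * exp (- (x / (2 * (1 - 0)))) / sqrt (2 * pi)"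
    proof (rule pmf_R_local_limit_linear[OF _ m_inf u_def v_def u v])
      show "\<forall>\<^sub>F n in sequentially. 1 \<le> d n" using dpos by eventually_elim simp
      have "\<forall>\<^sub>F n in sequentially. s n * real (m n) = real n * u n ^ 2 * v n"
        using eventually_gt_at_top[of 0] by eventually_elim (simp add: s_def u_def v_def)
      with ms show "(\<lambda>n. real n * u n ^ 2 * v n) \<longlonglongrightarrow> x"
        by (rule Lim_transform_eventually)
      have "(\<lambda>n. 1 / sqrt (s n * real (m n))) \<longlonglongrightarrow> 1 / sqrt x"
        using x by (intro tendsto_divide tendsto_real_sqrt ms tendsto_const) auto
      moreover have "\<forall>\<^sub>F n in sequentially. 1 / sqrt (s n * real (m n)) = u n * sqrt (1 / (real n * v n)) / s n"
        using dpos
      proof eventually_elim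
        case (elim n)
        have "s n = u n * u n" "u n > 0" "real n * v n = real (m n)"
          using elim by (simp_all add: s_def u_def v_def power2_eq_square)
        thus ?case by (simp add: real_sqrt_mult real_sqrt_divide)
      qed
      ultimately show "(\<lambda>n. u n * sqrt (1 / (real n * v n)) / s n) \<longlonglongrightarrow> 1 / sqrt x"
        by (rule Lim_transform_eventually)
    qed simp
    hence "(\<lambda>n. pmf (R n (n - d n)) (m n) / s n) \<longlonglongrightarrow> (1 / sqrt x) * exp (- (x / 2)) / sqrt (2 * pi)"
      by simp
    moreover have "(1 / sqrt x) * exp (- (x / 2)) / sqrt (2 * pi) = gamma_density (1/2) (1/2) x"
      using gamma_density_half[OF x] by (simp add: real_sqrt_mult)
    ultimately show "(\<lambda>n. pmf (R n (n - d n)) (nat \<lfloor>x / s n\<rfloor>) / s n) \<longlonglongrightarrow> gamma_density (1/2) (1/2) x"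
      by (simp add: m_def)
  qed (auto simp: gamma_density_def Gamma_one_half_real)
  thus ?thesis by (simp add: s_def)
qed

lemma R_weak_conv_giant_fraction:
  fixes d :: "nat \<Rightarrow> nat"
  assumes c: "c > 0" and d: "(\<lambda>n. real (d n)) \<sim>[sequentially] (\<lambda>n. c * sqrt (real n))"
  shows "weak_conv_m (\<lambda>n. law (R n (n - d n)) (\<lambda>m. 1 / real n * real m))
             (law_density (giant_fraction_density c))"
proof -
  define \<delta> where "\<delta> n = real (d n) / sqrt (real n)" for n
  define u where "u n = real (d n) / real n" for n
  have \<delta>: "\<delta> \<longlonglongrightarrow> c"
  proof -
    have "(\<lambda>n. real (d n) / sqrt (real n)) \<sim>[sequentially] (\<lambda>n. c * sqrt (real n) / sqrt (real n))"
      by (intro asymp_equiv_divide d asymp_equiv_refl)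
    moreover have "(\<lambda>n. c * sqrt (real n) / sqrt (real n)) \<longlonglongrightarrow> c"
    proof (rule Lim_transform_eventually[OF tendsto_const])
      show "\<forall>\<^sub>F n in sequentially. c = c * sqrt (real n) / sqrt (real n)"
        using eventually_gt_at_top[of 0] by eventually_elim simp
    qed
    ultimately show ?thesis unfolding \<delta>_def by (subst tendsto_asymp_equiv_cong)
  qed
  have u: "u \<longlonglongrightarrow> 0"
  proof -
    have "(\<lambda>n. 1 / sqrt (real n)) \<longlonglongrightarrow> 0" by real_asymp
    from tendsto_mult[OF \<delta> this] have "(\<lambda>n. \<delta> n * (1 / sqrt (real n))) \<longlonglongrightarrow> 0" by simp
    moreover have "\<delta> n * (1 / sqrt (real n)) = u n" for n
      by (simp add: \<delta>_def u_def real_sqrt_mult[symmetric])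
    ultimately show ?thesis by simp
  qed
  have dpos: "\<forall>\<^sub>F n in sequentially. n \<ge> 1 \<and> d n \<ge> 1"
    using order_tendstoD(1)[OF \<delta> c] eventually_ge_at_top[of 1]
    by eventually_elim (auto simp: \<delta>_def Suc_le_eq intro!: gr0I)
  have spos: "\<forall>\<^sub>F n in sequentially. 1 / real n > 0"
    using eventually_gt_at_top[of 0] by eventually_elim simp
  have s0: "(\<lambda>n. 1 / real n) \<longlonglongrightarrow> 0" by real_asymp
  show ?thesis
  proof (rule weak_conv_m_lattice[OF _ _ _ nn_integral_giant_fraction_density[OF c] spos s0])
    fix x :: real assume x: "x > 0"
    define m where "m n = nat \<lfloor>x / (1 / real n)\<rfloor>" for n
    define v where "v n = real (m n) / real n" for n
    have v: "v \<longlonglongrightarrow> x" and m_inf: "filterlim m at_top sequentially"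
      unfolding v_def m_def using lattice_floor[OF spos s0 x] by simp_all
    \<comment> \<open>For \<open>x \<ge> 1\<close> the value \<open>m n \<ge> n\<close> exceeds the number of uncovered vertices.\<close>
    have "(\<lambda>n. pmf (R n (n - d n)) (m n) / (1 / real n)) \<longlonglongrightarrow> giant_fraction_density c x"
    proof (cases "x < 1")
      case True
      have "(\<lambda>n. pmf (R n (n - d n)) (m n) / (1 / real n))
          \<longlonglongrightarrow> (c * sqrt (1 / x) * sqrt (1 / (1 - x)) / (1 - x)) * exp (- (c\<^sup>2 * x / (2 * (1 - x)))) / sqrt (2 * pi)"
      proof (rule pmf_R_local_limit_linear[OF _ m_inf u_def v_def u v True])
        show "\<forall>\<^sub>F n in sequentially. 1 \<le> d n" using dpos by eventually_elim simp
        have "(\<lambda>n. \<delta> n ^ 2 * v n) \<longlonglongrightarrow> c\<^sup>2 * x" by (intro tendsto_mult tendsto_power \<delta> v)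
        moreover have "\<forall>\<^sub>F n in sequentially. \<delta> n ^ 2 * v n = real n * u n ^ 2 * v n"
          using eventually_gt_at_top[of 0]
          by eventually_elim (simp add: \<delta>_def u_def power_divide power2_eq_square)
        ultimately show "(\<lambda>n. real n * u n ^ 2 * v n) \<longlonglongrightarrow> c\<^sup>2 * x"
          by (rule Lim_transform_eventually)
        have "(\<lambda>n. \<delta> n * sqrt (1 / v n)) \<longlonglongrightarrow> c * sqrt (1 / x)"
          using x by (intro tendsto_mult tendsto_real_sqrt tendsto_divide tendsto_const \<delta> v) auto
        moreover have "\<forall>\<^sub>F n in sequentially. \<delta> n * sqrt (1 / v n) = u n * sqrt (1 / (real n * v n)) / (1 / real n)"
          using eventually_gt_at_top[of 0]
          by eventually_elim (simp add: \<delta>_def u_def real_sqrt_mult real_sqrt_divide)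
        ultimately show "(\<lambda>n. u n * sqrt (1 / (real n * v n)) / (1 / real n)) \<longlonglongrightarrow> c * sqrt (1 / x)"
          by (rule Lim_transform_eventually)
      qed
      thus ?thesis using giant_fraction_density_eq[OF x True, of c]
        by (simp add: real_sqrt_mult real_sqrt_divide mult.assoc)
    next
      case False
      have "\<forall>\<^sub>F n in sequentially. 0 = pmf (R n (n - d n)) (m n) / (1 / real n)"
        using dpos
      proof eventually_elim
        case (elim n)
        have "real n \<le> x / (1 / real n)" using elim False by simp
        hence "n \<le> m n" unfolding m_def by (rule le_nat_floor)
        hence "m n \<notin> set_pmf (R n (n - d n))"
          using set_pmf_R[of n "n - d n"] elim by force
        thus ?case by (simp add: set_pmf_iff)
      qed
      from Lim_transform_eventually[OF tendsto_const this] show ?thesis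
        using False by (simp add: giant_fraction_density_def)
    qed
    thus "(\<lambda>n. pmf (R n (n - d n)) (nat \<lfloor>x / (1 / real n)\<rfloor>) / (1 / real n)) \<longlonglongrightarrow> giant_fraction_density c x"
      by (simp add: m_def)
  qed (use c in \<open>auto simp: giant_fraction_density_def\<close>)
qed

text \<open>
  In terms of the complement $j = n - m \approx x d^2$ one has $J = j - d \sim x d^2$, as $d \to \infty$, while
  $k$ and $m$ are asymptotic to $n$.
\<close>

lemma R_weak_conv_levy:
  fixes d :: "nat \<Rightarrow> nat"
  assumes d1: "(\<lambda>n. real (d n)) \<in> \<omega>(\<lambda>_. 1)" and d2: "(\<lambda>n. real (d n)) \<in> o(\<lambda>n. sqrt (real n))"
  shows "weak_conv_m (\<lambda>n. law (R n (n - d n)) (\<lambda>m. 1 / (real (d n))\<^sup>2 * (real n - real m)))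
           (law_density levy_density)"
proof -
  define s where "s n = 1 / (real (d n))\<^sup>2" for n
  define u where "u n = real (d n) / real n" for n
  define w where "w n = real (d n) / sqrt (real n)" for n
  have d_inf: "filterlim (\<lambda>n. real (d n)) at_top sequentially"
    using smallomegaD_filterlim_at_top_norm[OF d1] by simp
  have dpos: "\<forall>\<^sub>F n in sequentially. n \<ge> 1 \<and> d n \<ge> 1"
  proof -
    have "\<forall>\<^sub>F n in sequentially. 1 \<le> real (d n)" using d_inf unfolding filterlim_at_top by blast
    thus ?thesis using eventually_ge_at_top[of 1] by eventually_elim simp
  qed
  have id: "(\<lambda>n. 1 / real (d n)) \<longlonglongrightarrow> 0"
    using tendsto_inverse_0_at_top[OF d_inf] by (simp add: inverse_eq_divide)
  have w: "w \<longlonglongrightarrow> 0" unfolding w_def using smalloD_tendsto[OF d2] .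
  have w2: "(\<lambda>n. (real (d n))\<^sup>2 / real n) \<longlonglongrightarrow> 0"
    using tendsto_power[OF w, of 2] by (simp add: w_def power_divide)
  have u: "u \<longlonglongrightarrow> 0"
  proof -
    have "(\<lambda>n. 1 / sqrt (real n)) \<longlonglongrightarrow> 0" by real_asymp
    from tendsto_mult[OF w this] have "(\<lambda>n. w n * (1 / sqrt (real n))) \<longlonglongrightarrow> 0" by simp
    moreover have "w n * (1 / sqrt (real n)) = u n" for n
      by (simp add: w_def u_def real_sqrt_mult[symmetric])
    ultimately show ?thesis by simp
  qed
  have spos: "\<forall>\<^sub>F n in sequentially. s n > 0"
    using dpos by eventually_elim (simp add: s_def)
  have "s = (\<lambda>n. (1 / real (d n)) ^ 2)" by (simp add: s_def power_divide fun_eq_iff)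
  hence s0: "s \<longlonglongrightarrow> 0" using tendsto_power[OF id, of 2] by simp
  have conv: "weak_conv_m (\<lambda>n. law (map_pmf (\<lambda>m. n - m) (R n (n - d n))) (\<lambda>j. s n * real j)) (law_density levy_density)"
  proof (rule weak_conv_m_lattice[OF _ _ _ nn_integral_levy_density spos s0])
    fix x :: real assume x: "x > 0"
    define j where "j n = nat \<lfloor>x / s n\<rfloor>" for n
    define m where "m n = n - j n" for n
    define v where "v n = real (j n) / real n" for n
    define y where "y n = s n * real (j n)" for n
    have y: "y \<longlonglongrightarrow> x"
      unfolding y_def j_def by (rule lattice_floor(1)[OF spos s0 x])
    have v: "v \<longlonglongrightarrow> 0"
    proof -
      have "(\<lambda>n. y n * ((real (d n))\<^sup>2 / real n)) \<longlonglongrightarrow> x * 0" by (intro tendsto_mult y w2)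
      moreover have "\<forall>\<^sub>F n in sequentially. y n * ((real (d n))\<^sup>2 / real n) = v n"
        using dpos by eventually_elim (simp add: v_def y_def s_def)
      ultimately have "v \<longlonglongrightarrow> x * 0" by (rule Lim_transform_eventually)
      thus ?thesis by simp
    qed
    have u1: "(\<lambda>n. 1 - u n) \<longlonglongrightarrow> 1" using tendsto_diff[OF tendsto_const u, of 1] by simp
    have v1: "(\<lambda>n. 1 - v n) \<longlonglongrightarrow> 1" using tendsto_diff[OF tendsto_const v, of 1] by simp
    have J: "(\<lambda>n. y n - 1 / real (d n)) \<longlonglongrightarrow> x" using tendsto_diff[OF y id] by simp
    have ev: "\<forall>\<^sub>F n in sequentially. real n > 0 \<and> real (d n) > 0 \<and> 1 - v n > 0 \<and> y n - 1 / real (d n) > 0 \<and> y n > 0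
        \<and> 1 - u n > 0 \<and> real (d n) = real n * u n \<and> real (j n) = real n * v n \<and> real (j n) = (real (d n))\<^sup>2 * y n"
      using dpos order_tendstoD(1)[OF v1 zero_less_one] order_tendstoD(1)[OF u1 zero_less_one]
        order_tendstoD(1)[OF J x] order_tendstoD(1)[OF y x]
      by eventually_elim (simp add: u_def v_def y_def s_def)
    have ev2: "\<forall>\<^sub>F n in sequentially. real (m n) = real n * (1 - v n) \<and> j n < n
        \<and> real n - real (d n) - real (m n) = (real (d n))\<^sup>2 * (y n - 1 / real (d n)) \<and> real n - real (m n) = (real (d n))\<^sup>2 * y n"
      using ev
    proof eventually_elim
      case (elim n)
      hence "real n * (1 - v n) > 0" by simp
      hence jn: "real (j n) < real n" using elim by (simp add: algebra_simps)
      hence mr: "real (m n) = real n - real (j n)" by (simp add: m_def)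
      have jd: "real (j n) = (real (d n))\<^sup>2 * y n" and d0: "real (d n) > 0" using elim by blast+
      have "real (m n) = real n * (1 - v n)" using elim mr by (simp add: algebra_simps)
      moreover have "real n - real (d n) - real (m n) = (real (d n))\<^sup>2 * (y n - 1 / real (d n))"
      proof -
        have "real n - real (d n) - real (m n) = (real (d n))\<^sup>2 * y n - real (d n)" using mr jd by simp
        also have "\<dots> = (real (d n))\<^sup>2 * (y n - 1 / real (d n))"
          using d0 by (simp add: right_diff_distrib power2_eq_square)
        finally show ?thesis .
      qed
      moreover have "real n - real (m n) = (real (d n))\<^sup>2 * y n" using mr jd by simp
      ultimately show ?case using jn by simp
    qed
    have d2_inf: "filterlim (\<lambda>n. (real (d n))\<^sup>2) at_top sequentially"
      using filterlim_at_top_mult_at_top[OF d_inf d_inf] by (simp add: power2_eq_square)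
    have m_inf: "filterlim m at_top sequentially"
    proof (rule filterlim_nat_real)
      show "filterlim (\<lambda>n. (1 - v n) * real n) at_top sequentially"
        by (rule filterlim_tendsto_pos_mult_at_top[OF v1 zero_less_one filterlim_real_sequentially])
      show "\<forall>\<^sub>F n in sequentially. (1 - v n) * real n = real (m n)"
        using ev2 by eventually_elim simp
    qed
    have ev3: "\<forall>\<^sub>F n in sequentially. 1 \<le> d n \<and> 1 \<le> m n \<and> d n + m n < n"
      using ev ev2
    proof eventually_elim
      case (elim n)
      have pos: "real (d n) > 0" "y n - 1 / real (d n) > 0" and jn: "j n < n"
        and e: "real n - real (d n) - real (m n) = (real (d n))\<^sup>2 * (y n - 1 / real (d n))"
        using elim by blast+
      have "(real (d n))\<^sup>2 * (y n - 1 / real (d n)) > 0" using pos by (intro mult_pos_pos) simp_all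
      hence "real (d n) + real (m n) < real n" using e by linarith
      moreover have "m n \<ge> 1" using jn by (simp add: m_def)
      ultimately show ?case using pos by simp
    qed
    have "(\<lambda>n. pmf (R n (n - d n)) (m n) / s n) \<longlonglongrightarrow> (sqrt (1 / x) / x) * exp (- (1 / (2 * x))) / sqrt (2 * pi)"
    proof (rule pmf_R_local_limit[OF ev3 m_inf])
      show "filterlim (\<lambda>n. n - d n - m n) at_top sequentially"
      proof (rule filterlim_nat_real)
        show "filterlim (\<lambda>n. (y n - 1 / real (d n)) * (real (d n))\<^sup>2) at_top sequentially"
          by (rule filterlim_tendsto_pos_mult_at_top[OF J x d2_inf])
        show "\<forall>\<^sub>F n in sequentially. (y n - 1 / real (d n)) * (real (d n))\<^sup>2 = real (n - d n - m n)"
          using ev2 ev3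
        proof eventually_elim
          case (elim n)
          have lt: "d n + m n < n"
            and e: "real n - real (d n) - real (m n) = (real (d n))\<^sup>2 * (y n - 1 / real (d n))"
            using elim by blast+
          have "real (n - d n - m n) = real n - real (d n) - real (m n)" using lt by simp
          thus ?case unfolding e by (simp only: mult.commute)
        qed
      qed
      have "(\<lambda>n. 1 / real (d n) / (y n - 1 / real (d n))) \<longlonglongrightarrow> 0 / x" using x by (intro tendsto_divide[OF id J]) simp
      moreover have "\<forall>\<^sub>F n in sequentially. 1 / real (d n) / (y n - 1 / real (d n)) = real (d n) / (real n - real (d n) - real (m n))"
        using ev ev2
      proof eventually_elim
        case (elim n)
        have e: "real n - real (d n) - real (m n) = (real (d n))\<^sup>2 * (y n - 1 / real (d n))"
          using elim by blast
        have alg: "1 / a / b = a / (a\<^sup>2 * b)" if "a > 0" for a b :: real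
          using that by (simp add: power2_eq_square)
        show ?case unfolding e by (rule alg) (use elim in blast)
      qed
      ultimately show "(\<lambda>n. real (d n) / (real n - real (d n) - real (m n))) \<longlonglongrightarrow> 0"
        by (rule tendsto_eventually_eq) simp
      have "(\<lambda>n. (1 - v n) / (2 * (y n - 1 / real (d n)) * (1 - u n))) \<longlonglongrightarrow> 1 / (2 * x * 1)"
        using x by (intro tendsto_divide tendsto_mult tendsto_const u1 v1 J) simp
      moreover have "\<forall>\<^sub>F n in sequentially. (1 - v n) / (2 * (y n - 1 / real (d n)) * (1 - u n))
          = real (d n) ^ 2 * real (m n) / (2 * (real n - real (d n) - real (m n)) * (real n - real (d n)))"
        using ev ev2
      proof eventually_elim
        case (elim n)
        have e: "real n - real (d n) - real (m n) = (real (d n))\<^sup>2 * (y n - 1 / real (d n))"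
          "real (m n) = real n * (1 - v n)" using elim by blast+
        have e2: "real n - real (d n) = real n * (1 - u n)" using elim by (simp add: algebra_simps)
        have alg: "a / (2 * b * c) = D * (N * a) / (2 * (D * b) * (N * c))" if "D > 0" "N > 0" for a b c D N :: real
          using that by simp
        show ?case unfolding e(1) unfolding e(2) e2 by (rule alg) (use elim in auto)
      qed
      ultimately show "(\<lambda>n. real (d n) ^ 2 * real (m n) / (2 * (real n - real (d n) - real (m n)) * (real n - real (d n)))) \<longlonglongrightarrow> 1 / (2 * x)"
        by (rule tendsto_eventually_eq) simp
      have "(\<lambda>n. sqrt ((1 - u n) / ((1 - v n) * (y n - 1 / real (d n)))) / y n) \<longlonglongrightarrow> sqrt (1 / (1 * x)) / x"
        using x by (intro tendsto_divide tendsto_mult tendsto_real_sqrt u1 v1 J y) auto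
      moreover have "\<forall>\<^sub>F n in sequentially. sqrt ((1 - u n) / ((1 - v n) * (y n - 1 / real (d n)))) / y n
          = real (d n) * sqrt ((real n - real (d n)) / (real (m n) * (real n - real (d n) - real (m n)))) / (real n - real (m n)) / s n"
        using ev ev2
      proof eventually_elim
        case (elim n)
        have e: "real n - real (d n) - real (m n) = (real (d n))\<^sup>2 * (y n - 1 / real (d n))"
          "real n - real (m n) = (real (d n))\<^sup>2 * y n"
          "real (m n) = real n * (1 - v n)" using elim by blast+
        have e2: "real n - real (d n) = real n * (1 - u n)" using elim by (simp add: algebra_simps)
        have "(real n * (1 - u n)) / (real n * (1 - v n) * ((real (d n))\<^sup>2 * (y n - 1 / real (d n))))
            = (1 - u n) / ((1 - v n) * (y n - 1 / real (d n))) / (real (d n))\<^sup>2"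
          using elim by simp
        hence sq: "sqrt ((real n * (1 - u n)) / (real n * (1 - v n) * ((real (d n))\<^sup>2 * (y n - 1 / real (d n)))))
            = sqrt ((1 - u n) / ((1 - v n) * (y n - 1 / real (d n)))) / real (d n)"
          by (simp only: real_sqrt_divide real_sqrt_abs abs_of_nat)
        have alg: "S / Y = D * (S / D) / (D\<^sup>2 * Y) / (1 / D\<^sup>2)" if "D > 0" for S Y D :: real
          using that by simp
        show ?case unfolding e(1,2) unfolding e(3) e2 sq s_def by (rule alg) (use elim in auto)
      qed
      ultimately show "(\<lambda>n. real (d n) * sqrt ((real n - real (d n)) / (real (m n) * (real n - real (d n) - real (m n)))) / (real n - real (m n)) / s n) \<longlonglongrightarrow> sqrt (1 / x) / x"
        by (rule tendsto_eventually_eq) simp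
    qed
    hence lim: "(\<lambda>n. pmf (R n (n - d n)) (m n) / s n) \<longlonglongrightarrow> levy_density x"
      using levy_density_eq[OF x] by simp
    show "(\<lambda>n. pmf (map_pmf (\<lambda>m. n - m) (R n (n - d n))) (nat \<lfloor>x / s n\<rfloor>) / s n) \<longlonglongrightarrow> levy_density x"
    proof (rule Lim_transform_eventually[OF lim])
      show "\<forall>\<^sub>F n in sequentially. pmf (R n (n - d n)) (m n) / s n = pmf (map_pmf (\<lambda>m. n - m) (R n (n - d n))) (nat \<lfloor>x / s n\<rfloor>) / s n"
        using dpos ev2
      proof eventually_elim
        case (elim n)
        have "set_pmf (R n (n - d n)) \<subseteq> {..n}" using set_pmf_R[of n "n - d n"] elim by force
        from pmf_map_diff[OF this, of "j n"] show ?case using elim by (simp add: m_def j_def)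
      qed
    qed
  qed (auto simp: levy_density_def)
  show ?thesis
  proof (rule weak_conv_m_cong[OF _ conv])
    show "\<forall>\<^sub>F n in sequentially. law (R n (n - d n)) (\<lambda>m. 1 / (real (d n))\<^sup>2 * (real n - real m))
        = law (map_pmf (\<lambda>m. n - m) (R n (n - d n))) (\<lambda>j. s n * real j)"
      using eventually_ge_at_top[of 1]
    proof eventually_elim
      case (elim n)
      show ?case
      proof (rule law_map_pmf)
        fix m assume "m \<in> set_pmf (R n (n - d n))"
        hence "m \<le> n" using set_pmf_R[of n "n - d n"] elim by force
        thus "1 / (real (d n))\<^sup>2 * (real n - real m) = s n * real (n - m)" by (simp add: s_def)
      qed
    qed
  qed
qed

lemma R_limit_law_proportional:
  assumes a: "0 < \<alpha>" "\<alpha> < 1"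
  shows "\<exists>R\<^sub>\<alpha> :: nat pmf.
           (\<forall>m. pmf R\<^sub>\<alpha> m =
              (if m = 0 then 1 - \<alpha>
               else real m ^ m / fact m * (1 - \<alpha>) * \<alpha> ^ m * exp (- \<alpha> * real m))) \<and>
           (\<forall>v :: complex. norm v \<le> 1 \<longrightarrow>
              (\<lambda>m. of_real (pmf R\<^sub>\<alpha> m) * v ^ m) sums
                ((1 - of_real \<alpha>) / (1 - cayley_T (v * of_real (\<alpha> * exp (- \<alpha>)))))) \<and>
           (\<forall>k :: nat \<Rightarrow> nat.
              ((\<lambda>n. real (k n)) \<sim>[sequentially] (\<lambda>n. \<alpha> * real n)) \<longrightarrow>
              weak_conv_m (\<lambda>n. law (R n (k n)) real) (law R\<^sub>\<alpha> real))"
proof -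
  from subcritical_pmf_exists[OF a] show ?thesis
  proof (elim exE conjE, intro exI conjI)
    fix p :: "nat pmf"
    assume p: "\<forall>m. pmf p m = (if m = 0 then 1 - \<alpha>
               else real m ^ m / fact m * (1 - \<alpha>) * \<alpha> ^ m * exp (- \<alpha> * real m))"
    show "\<forall>k :: nat \<Rightarrow> nat. ((\<lambda>n. real (k n)) \<sim>[sequentially] (\<lambda>n. \<alpha> * real n)) \<longrightarrow>
              weak_conv_m (\<lambda>n. law (R n (k n)) real) (law p real)"
    proof (intro allI impI weak_conv_m_discrete)
      fix k :: "nat \<Rightarrow> nat" and m
      assume k: "(\<lambda>n. real (k n)) \<sim>[sequentially] (\<lambda>n. \<alpha> * real n)"
      have "(\<lambda>n. real (k n) / real n) \<sim>[sequentially] (\<lambda>n. \<alpha> * real n / real n)"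
        by (intro asymp_equiv_divide k asymp_equiv_refl)
      moreover have "(\<lambda>n. \<alpha> * real n / real n) \<longlonglongrightarrow> \<alpha>"
      proof (rule Lim_transform_eventually[OF tendsto_const])
        show "\<forall>\<^sub>F n in sequentially. \<alpha> = \<alpha> * real n / real n"
          using eventually_gt_at_top[of 0] by eventually_elim simp
      qed
      ultimately have "(\<lambda>n. real (k n) / real n) \<longlonglongrightarrow> \<alpha>"
        by (subst tendsto_asymp_equiv_cong)
      thus "(\<lambda>n. pmf (R n (k n)) m) \<longlonglongrightarrow> pmf p m"
        unfolding p[rule_format] by (rule pmf_R_limit_proportional[OF a])
    qed
  qed
qed

lemma R_limit_law_constant:
  assumes d: "d > 0"
  shows "\<exists>D :: nat pmf.
           (\<forall>j. pmf D j =
              exp (- real d) * (real d * real (d + j) powi (int j - 1) / fact j)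
                * exp (- real j)) \<and>
           (\<forall>v :: complex. norm v \<le> 1 \<longrightarrow>
              (\<lambda>j. of_real (pmf D j) * v ^ j) sums
                exp (of_nat d * (cayley_T (v / of_real (exp 1)) - 1))) \<and>
           weak_conv_m (\<lambda>n. law (R n (n - d)) (\<lambda>m. real n - real d - real m))
             (law D real)"
proof -
  from borel_pmf_exists[OF d] show ?thesis
  proof (elim exE conjE, intro exI conjI)
    fix D :: "nat pmf"
    assume D: "\<forall>j. pmf D j = exp (- real d) * (real d * real (d + j) powi (int j - 1) / fact j) * exp (- real j)"
    show "weak_conv_m (\<lambda>n. law (R n (n - d)) (\<lambda>m. real n - real d - real m)) (law D real)"
    proof (rule weak_conv_m_cong)
      show "weak_conv_m (\<lambda>n. law (map_pmf (\<lambda>m. (n - d) - m) (R n (n - d))) real) (law D real)"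
        by (rule weak_conv_m_discrete) (unfold D[rule_format], rule pmf_R_limit_constant[OF d])
      show "\<forall>\<^sub>F n in sequentially. law (R n (n - d)) (\<lambda>m. real n - real d - real m)
          = law (map_pmf (\<lambda>m. (n - d) - m) (R n (n - d))) real"
        using eventually_ge_at_top[of "max 1 d"]
      proof eventually_elim
        case (elim n)
        show ?case
        proof (rule law_map_pmf)
          fix m assume "m \<in> set_pmf (R n (n - d))"
          hence "m \<le> n - d" using set_pmf_R[of n "n - d"] elim by force
          hence "d + m \<le> n" using elim by arith
          thus "real n - real d - real m = real (n - d - m)" using elim by simp
        qed
      qed
    qed
  qed
qed

theorem theorem9:
  shows
    "(\<forall>n k m. n \<ge> 1 \<longrightarrow> k \<le> n \<longrightarrow>
        pmf (R n k) m =
          (if m = 0 then 1 - real k / real n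
           else if m \<le> k \<and> k < n then
             real m ^ m * (real n - real k) * (real n - real m) powi (int k - int m - 1)
               / real n ^ k * real (k choose m)
           else if m = k \<and> k = n then 1
           else 0)) \<and>
     (\<forall>k :: nat \<Rightarrow> nat.
        (\<lambda>n. real (k n)) \<in> o(\<lambda>n. real n) \<longrightarrow>
        tendsto_in_prob_const (\<lambda>n. law (R n (k n)) real) 0) \<and>
     (\<forall>\<alpha> :: real. 0 < \<alpha> \<longrightarrow> \<alpha> < 1 \<longrightarrow>
        (\<exists>R\<^sub>\<alpha> :: nat pmf.
           (\<forall>m. pmf R\<^sub>\<alpha> m =
              (if m = 0 then 1 - \<alpha>
               else real m ^ m / fact m * (1 - \<alpha>) * \<alpha> ^ m * exp (- \<alpha> * real m))) \<and>
           (\<forall>v :: complex. norm v \<le> 1 \<longrightarrow>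
              (\<lambda>m. of_real (pmf R\<^sub>\<alpha> m) * v ^ m) sums
                ((1 - of_real \<alpha>) / (1 - cayley_T (v * of_real (\<alpha> * exp (- \<alpha>)))))) \<and>
           (\<forall>k :: nat \<Rightarrow> nat.
              ((\<lambda>n. real (k n)) \<sim>[sequentially] (\<lambda>n. \<alpha> * real n)) \<longrightarrow>
              weak_conv_m (\<lambda>n. law (R n (k n)) real) (law R\<^sub>\<alpha> real)))) \<and>
     (real_distribution (law_density (gamma_density (1/2) (1/2))) \<and>
      (\<forall>x>0. gamma_density (1/2) (1/2) x = 1 / sqrt (2 * pi * x) * exp (- x / 2)) \<and>
      (\<forall>d :: nat \<Rightarrow> nat.
         (\<lambda>n. real (d n)) \<in> \<omega>(\<lambda>n. sqrt (real n)) \<longrightarrow>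
         (\<lambda>n. real (d n)) \<in> o(\<lambda>n. real n) \<longrightarrow>
         weak_conv_m (\<lambda>n. law (R n (n - d n)) (\<lambda>m. (real (d n) / real n)\<^sup>2 * real m))
           (law_density (gamma_density (1/2) (1/2))))) \<and>
     (\<forall>c :: real. c > 0 \<longrightarrow>
        real_distribution (law_density (giant_fraction_density c)) \<and>
        (\<forall>d :: nat \<Rightarrow> nat.
           ((\<lambda>n. real (d n)) \<sim>[sequentially] (\<lambda>n. c * sqrt (real n))) \<longrightarrow>
           weak_conv_m (\<lambda>n. law (R n (n - d n)) (\<lambda>m. 1 / real n * real m))
             (law_density (giant_fraction_density c)))) \<and>
     (real_distribution (law_density levy_density) \<and>
      (\<forall>d :: nat \<Rightarrow> nat.
         (\<lambda>n. real (d n)) \<in> \<omega>(\<lambda>_. 1) \<longrightarrow>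
         (\<lambda>n. real (d n)) \<in> o(\<lambda>n. sqrt (real n)) \<longrightarrow>
         weak_conv_m
           (\<lambda>n. law (R n (n - d n)) (\<lambda>m. 1 / (real (d n))\<^sup>2 * (real n - real m)))
           (law_density levy_density))) \<and>
     (\<forall>d :: nat. d > 0 \<longrightarrow>
        (\<exists>D :: nat pmf.
           (\<forall>j. pmf D j =
              exp (- real d) * (real d * real (d + j) powi (int j - 1) / fact j)
                * exp (- real j)) \<and>
           (\<forall>v :: complex. norm v \<le> 1 \<longrightarrow>
              (\<lambda>j. of_real (pmf D j) * v ^ j) sums
                exp (of_nat d * (cayley_T (v / of_real (exp 1)) - 1))) \<and>
           weak_conv_m (\<lambda>n. law (R n (n - d)) (\<lambda>m. real n - real d - real m))
             (law D real)))"
  by (intro conjI allI impI pmf_root_cluster R_tendsto_0 R_limit_law_proportional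
      real_distribution_law_density density_measurable nn_integral_gamma_density
      nn_integral_giant_fraction_density nn_integral_levy_density gamma_density_half
      R_weak_conv_gamma R_weak_conv_giant_fraction R_weak_conv_levy R_limit_law_constant)

end
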